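(* Let $R\subset S$ be an integral distributive FCP extension with $R$ a local ring. Set $T:={}_S^tR$ and $U:={}_S^uR$. Then $|\mathrm{Max}(U)|\leq 2$ and $|\mathrm{Supp}_U(T/U)|\leq 1$. Moreover: (1) If $|\mathrm{Supp}_U(T/U)|=0$, then $|[R,S]|=\ell[R,{}_S^+R]+|[T,S]|+\lambda$, where $\lambda=0$ when ${}_S^+R=T$ and $\lambda=1$ when ${}_S^+R\neq T$. (2) Suppose $|\mathrm{Supp}_U(T/U)|=1$ and $|\mathrm{Max}(U)|=2$, and set $\mathrm{Max}(U)=\{M,M'\}$ where $\mathrm{Supp}_U(T/U)=\{M\}$. (a) If $|\mathrm{Supp}_U(S/U)|=2$ and $V$ denotes the splitter of $U\subseteq S$ at $\{M'\}$, then $$|[R,S]|=\ell[R,{}_S^+R]+|[T,S]|+\ell[U,T]\cdot|[U,V]|+1.$$ (b) If $|\mathrm{Supp}_U(S/U)|=1$, then $$|[R,S]|=\ell[R,{}_S^+R]+|[T,S]|+\ell[U,T]+1.$$ (3) If $|\mathrm{Supp}_U(T/U)|=|\mathrm{Max}(U)|=1$, then $|[R,S]|=\ell[R,{}_S^+R]+|[T,S]|$.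
   Context: All rings are commutative with unit; a local ring is a ring with a unique maximal ideal. $[R,S]$ denotes the set of all $R$-subalgebras of $S$, ordered by inclusion; it is a lattice with infimum the intersection and supremum the compositum. The extension $R\subseteq S$ is distributive if the lattice $[R,S]$ is distributive; it has FCP if every chain in $[R,S]$ is finite (a distributive FCP extension has $[R,S]$ finite). The length $\ell[R,S]$ is the supremum of the lengths of chains in $[R,S]$, where a chain $R_0\subset\cdots\subset R_n$ has length $n$. An extension $B\subseteq S$ is: t-closed if $b\in S$, $r\in B$, $b^2-rb\in B$, $b^3-rb^2\in B$ imply $b\in B$; seminormal if $b\in S$, $b^2\in B$, $b^3\in B$ imply $b\in B$; u-closed if $b\in S$, $b^2-b\in B$, $b^3-b^2\in B$ imply $b\in B$. The t-closure ${}_S^tR$ (resp. seminormalization ${}_S^+R$, resp. u-closure ${}_S^uR$) of $R$ in $S$ is the smallest $B\in[R,S]$ such that $B\subseteq S$ is t-closed (resp. seminormal, resp. u-closed); for integral FCP extensions ${}_S^uR\subseteq{}_S^tR$. $\mathrm{Supp}_A(C/B)$ denotes the support of the $A$-module $C/B$, and $\mathrm{MSupp}_A(C/B)=\mathrm{Supp}_A(C/B)\cap\mathrm{Max}(A)$. For an extension $A\subseteq B$ and $E\subseteq\mathrm{MSupp}_A(B/A)$, the splitter of the extension at $E$ is the (unique if it exists; it exists for integral FCP extensions) element $T'\in[A,B]$ with $\mathrm{MSupp}_A(T'/A)=E$ and $\mathrm{MSupp}_A(B/T')=\mathrm{MSupp}_A(B/A)\setminus E$. *)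

theory Defs
  imports "HOL-Algebra.Algebra" "HOL-Library.Extended_Nat"
begin

text \<open>
  All rings in play are subrings of one ambient commutative ring \<open>S\<close>; a subring is given by its
  carrier set, and \<open>S\<lparr>carrier := A\<rparr>\<close> is the corresponding ring.
\<close>

section \<open>The lattice of intermediate rings\<close>

text \<open>The \<open>A\<close>-subalgebras of \<open>B\<close> are the subrings of the ambient ring that lie between \<open>A\<close> and \<open>B\<close>.\<close>
definition intermediate_rings :: "('a, 'm) ring_scheme \<Rightarrow> 'a set \<Rightarrow> 'a set \<Rightarrow> 'a set set" where
  "intermediate_rings S A B = {C. subring C S \<and> A \<subseteq> C \<and> C \<subseteq> B}"

definition compositum :: "('a, 'm) ring_scheme \<Rightarrow> 'a set \<Rightarrow> 'a set \<Rightarrow> 'a set" where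
  "compositum S B C = generate_ring S (B \<union> C)"

definition distributive_extension :: "('a, 'm) ring_scheme \<Rightarrow> 'a set \<Rightarrow> 'a set \<Rightarrow> bool" where
  "distributive_extension S A B \<longleftrightarrow>
     (\<forall>C \<in> intermediate_rings S A B. \<forall>D \<in> intermediate_rings S A B. \<forall>E \<in> intermediate_rings S A B.
        C \<inter> compositum S D E = compositum S (C \<inter> D) (C \<inter> E))"

definition FCP_extension :: "('a, 'm) ring_scheme \<Rightarrow> 'a set \<Rightarrow> 'a set \<Rightarrow> bool" where
  "FCP_extension S A B \<longleftrightarrow> (\<forall>\<C>. subset.chain (intermediate_rings S A B) \<C> \<longrightarrow> finite \<C>)"

definition extension_length :: "('a, 'm) ring_scheme \<Rightarrow> 'a set \<Rightarrow> 'a set \<Rightarrow> enat" where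
  "extension_length S A B =
     Sup {enat n | n. \<exists>C :: nat \<Rightarrow> 'a set.
            (\<forall>i \<le> n. C i \<in> intermediate_rings S A B) \<and> (\<forall>i < n. C i \<subset> C (Suc i))}"

text \<open>Unlike \<^const>\<open>card\<close>, which is \<open>0\<close> on infinite sets.\<close>
definition ecard :: "'b set \<Rightarrow> enat" where
  "ecard Q = (if finite Q then enat (card Q) else \<infinity>)"

section \<open>Integral extensions, maximal ideals\<close>

text \<open>Elements of \<^const>\<open>univ_poly\<close> are coefficient lists with the leading coefficient first;
  \<open>p \<noteq> []\<close> is needed because \<^term>\<open>lead_coeff []\<close> is unspecified.\<close>
definition integral_extension :: "('a, 'm) ring_scheme \<Rightarrow> 'a set \<Rightarrow> 'a set \<Rightarrow> bool" where
  "integral_extension S A B \<longleftrightarrow>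
     (\<forall>x \<in> B. \<exists>p \<in> carrier (univ_poly S A).
        p \<noteq> [] \<and> lead_coeff p = \<one>\<^bsub>S\<^esub> \<and> ring.eval S p x = \<zero>\<^bsub>S\<^esub>)"

definition Max_ideals :: "('a, 'm) ring_scheme \<Rightarrow> 'a set set" where
  "Max_ideals A = {M. maximalideal M A}"

definition local_ring :: "('a, 'm) ring_scheme \<Rightarrow> bool" where
  "local_ring A \<longleftrightarrow> cring A \<and> (\<exists>!M. M \<in> Max_ideals A)"

section \<open>Closures\<close>

definition t_closed :: "('a, 'm) ring_scheme \<Rightarrow> 'a set \<Rightarrow> bool" where
  "t_closed S B \<longleftrightarrow>
     (\<forall>b \<in> carrier S. \<forall>r \<in> B.
        b [^]\<^bsub>S\<^esub> (2::nat) \<ominus>\<^bsub>S\<^esub> r \<otimes>\<^bsub>S\<^esub> b \<in> B \<longrightarrow>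
        b [^]\<^bsub>S\<^esub> (3::nat) \<ominus>\<^bsub>S\<^esub> r \<otimes>\<^bsub>S\<^esub> b [^]\<^bsub>S\<^esub> (2::nat) \<in> B \<longrightarrow> b \<in> B)"

definition seminormal :: "('a, 'm) ring_scheme \<Rightarrow> 'a set \<Rightarrow> bool" where
  "seminormal S B \<longleftrightarrow>
     (\<forall>b \<in> carrier S. b [^]\<^bsub>S\<^esub> (2::nat) \<in> B \<longrightarrow> b [^]\<^bsub>S\<^esub> (3::nat) \<in> B \<longrightarrow> b \<in> B)"

definition u_closed :: "('a, 'm) ring_scheme \<Rightarrow> 'a set \<Rightarrow> bool" where
  "u_closed S B \<longleftrightarrow>
     (\<forall>b \<in> carrier S.
        b [^]\<^bsub>S\<^esub> (2::nat) \<ominus>\<^bsub>S\<^esub> b \<in> B \<longrightarrow>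
        b [^]\<^bsub>S\<^esub> (3::nat) \<ominus>\<^bsub>S\<^esub> b [^]\<^bsub>S\<^esub> (2::nat) \<in> B \<longrightarrow> b \<in> B)"

text \<open>\<open>LEAST\<close> is with respect to inclusion of sets; the smallest element exists since the three
  properties are stable under intersections.\<close>

definition t_closure :: "('a, 'm) ring_scheme \<Rightarrow> 'a set \<Rightarrow> 'a set" where
  "t_closure S A = (LEAST B. B \<in> intermediate_rings S A (carrier S) \<and> t_closed S B)"

definition seminormalization :: "('a, 'm) ring_scheme \<Rightarrow> 'a set \<Rightarrow> 'a set" where
  "seminormalization S A = (LEAST B. B \<in> intermediate_rings S A (carrier S) \<and> seminormal S B)"

definition u_closure :: "('a, 'm) ring_scheme \<Rightarrow> 'a set \<Rightarrow> 'a set" where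
  "u_closure S A = (LEAST B. B \<in> intermediate_rings S A (carrier S) \<and> u_closed S B)"

section \<open>Support of a module, splitters\<close>

text \<open>
  The additive quotient \<open>C / B\<close> of subrings \<open>B \<subseteq> C\<close> of \<open>S\<close>, with scalar multiplication
  \<open>a \<odot> (B + x) = B + a x\<close>; it is a module over every subring \<open>A \<subseteq> B\<close>. The multiplicative fields
  of the record have no meaning for a module and are left undefined.
\<close>
definition quotient_module :: "('a, 'm) ring_scheme \<Rightarrow> 'a set \<Rightarrow> 'a set \<Rightarrow> ('a, 'a set) module" where
  "quotient_module S C B =
     \<lparr>carrier = a_rcosets\<^bsub>S\<lparr>carrier := C\<rparr>\<^esub> B, monoid.mult = undefined, one = undefined,
      ring.zero = B, ring.add = set_add S,
      smult = (\<lambda>a K. \<Union>x \<in> K. B +>\<^bsub>S\<^esub> (a \<otimes>\<^bsub>S\<^esub> x))\<rparr>"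

text \<open>The fractions \<open>m / s\<close> and \<open>n / t\<close> of the localization of \<open>M\<close> at the prime \<open>P\<close> are equal
  iff \<open>u (t m) = u (s n)\<close> for some \<open>u \<notin> P\<close>.\<close>
definition localization_rel ::
    "('a, 'm) ring_scheme \<Rightarrow> ('a, 'b, 'n) module_scheme \<Rightarrow> 'a set \<Rightarrow> (('b \<times> 'a) \<times> ('b \<times> 'a)) set" where
  "localization_rel A M P =
     {((m, s), (n, t)) | m s n t.
        m \<in> carrier M \<and> n \<in> carrier M \<and> s \<in> carrier A - P \<and> t \<in> carrier A - P \<and>
        (\<exists>u \<in> carrier A - P. u \<odot>\<^bsub>M\<^esub> (t \<odot>\<^bsub>M\<^esub> m) = u \<odot>\<^bsub>M\<^esub> (s \<odot>\<^bsub>M\<^esub> n))}"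

definition localized_module ::
    "('a, 'm) ring_scheme \<Rightarrow> ('a, 'b, 'n) module_scheme \<Rightarrow> 'a set \<Rightarrow> ('b \<times> 'a) set set" where
  "localized_module A M P = (carrier M \<times> (carrier A - P)) // localization_rel A M P"

definition Supp :: "('a, 'm) ring_scheme \<Rightarrow> ('a, 'b, 'n) module_scheme \<Rightarrow> 'a set set" where
  "Supp A M =
     {P. primeideal P A \<and>
         localized_module A M P \<noteq> {localization_rel A M P `` {(\<zero>\<^bsub>M\<^esub>, \<one>\<^bsub>A\<^esub>)}}}"

text \<open>\<open>Supp_quot S A C B\<close> is the support of the \<open>A\<close>-module \<open>C / B\<close>.\<close>
definition Supp_quot :: "('a, 'm) ring_scheme \<Rightarrow> 'a set \<Rightarrow> 'a set \<Rightarrow> 'a set \<Rightarrow> 'a set set" where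
  "Supp_quot S A C B = Supp (S\<lparr>carrier := A\<rparr>) (quotient_module S C B)"

definition MSupp_quot :: "('a, 'm) ring_scheme \<Rightarrow> 'a set \<Rightarrow> 'a set \<Rightarrow> 'a set \<Rightarrow> 'a set set" where
  "MSupp_quot S A C B = Supp_quot S A C B \<inter> Max_ideals (S\<lparr>carrier := A\<rparr>)"

definition splitter :: "('a, 'm) ring_scheme \<Rightarrow> 'a set \<Rightarrow> 'a set \<Rightarrow> 'a set set \<Rightarrow> 'a set" where
  "splitter S A B E =
     (THE T'. T' \<in> intermediate_rings S A B \<and> MSupp_quot S A T' A = E \<and>
              MSupp_quot S A B T' = MSupp_quot S A B A - E)"

end

theory Submission
  imports Defs "HOL-Decision_Procs.Commutative_Ring"
begin

text \<open>
  Let \<open>m\<close> be the maximal ideal of \<open>R\<close>, and let \<open>N\<close>, \<open>T\<close>, \<open>U\<close> be the seminormalization, the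
  t-closure and the u-closure. Everything is extracted from one obstruction to distributivity: if
  \<open>E\<close> is contained in the compositum of \<open>D\<close> and \<open>F\<close> but meets each of them inside \<open>A\<close>, then
  \<open>E \<subseteq> A\<close> (\<open>pairwise_trivial_meet\<close>). The three rings \<open>A + A x\<close>, \<open>A + A y\<close>, \<open>A + A (x + y)\<close>, with
  \<open>x\<close> and \<open>y\<close> independent over the residue field, form such a configuration
  (\<open>no_independent_pair\<close>).

  A minimal extension of a local ring is ramified (it adds an \<open>x\<close> with \<open>x\<^sup>2\<close> in the maximal ideal),
  decomposed (it adds an idempotent modulo the maximal ideal) or inert (it extends the residue
  field): \<open>cover_trichotomy\<close>. This needs that the maximal ideal is the conductor, which is the one
  place where integrality is used, in the form of Nakayama's lemma (\<open>power_conducts\<close>). The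
  obstruction then has four consequences.
  Two ramified steps from the same ring span the same line, so the rings between \<open>R\<close> and \<open>N\<close>
  form a chain (\<open>N_chain\<close>). Three orthogonal idempotents are impossible, so \<open>T\<close> is \<open>N\<close> or
  \<open>N + N e\<close> for one element \<open>e\<close> that is idempotent modulo the maximal ideal \<open>n\<close> of \<open>N\<close>
  (\<open>T_eq_Ne\<close>). A ramified or decomposed step cannot start where an inert one starts
  (\<open>inert_exclusion\<close>). Hence a ring \<open>H\<close> whose intersection with \<open>T\<close> is local is comparable
  with \<open>T\<close>: otherwise, above \<open>H \<inter> T\<close> there would be an inert step inside \<open>H\<close> and a ramified or
  decomposed one inside \<open>T\<close> (\<open>comparable\<close>).

  If \<open>N = T\<close>, then \<open>U = R\<close> and the lattice is the union of the chain \<open>[R, N]\<close> and of \<open>[T, S]\<close>,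
  glued at \<open>N = T\<close> (\<open>count_local\<close>).

  If \<open>N \<noteq> T\<close>, the element \<open>e\<close> can be chosen such that \<open>e\<^sup>2 - e\<close> and \<open>(e\<^sup>2 - e) e\<close> lie in \<open>R\<close>
  (\<open>split_idem_exists\<close>). Then \<open>U = R + R e\<close>, this ring has exactly the two maximal ideals \<open>M e\<close> and
  \<open>M (1 - e)\<close>, and it is contained in every intermediate ring that is not contained in \<open>N\<close>
  (\<open>dichotomy\<close>). So the lattice is the disjoint union of the chain \<open>[R, N]\<close> and of \<open>[U, S]\<close>. Let
  \<open>V e\<close> be the set of the elements of \<open>S\<close> that lie in \<open>U\<close> after localization at \<open>M e\<close>. The rings
  \<open>V e\<close> and \<open>V (1 - e)\<close> have intersection \<open>U\<close> and compositum \<open>S\<close>, so distributivity splits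
  \<open>[U, S]\<close> into the product of \<open>[U, V e]\<close> and \<open>[U, V (1 - e)]\<close> (\<open>component_bij\<close>). Their
  intersections with \<open>N\<close> belong to the chain \<open>[R, N]\<close>, so one of them is contained in \<open>U\<close>;
  replacing \<open>e\<close> by \<open>1 - e\<close> if necessary, \<open>T \<inter> V e = U\<close> and \<open>T \<subseteq> V (1 - e)\<close> (\<open>one_sided\<close>,
  \<open>T_le_V\<close>). This is the bound on the support of \<open>T / U\<close>. In the second factor every ring is
  comparable with \<open>T\<close>, and \<open>[U, T]\<close> is a chain; counting gives
  \<open>|[U, S]| = |[U, V e]| (\<ell>[U, T] + |[T, V (1 - e)]|)\<close> and \<open>|[T, S]| = |[U, V e]| |[T, V (1 - e)]|\<close>
  (\<open>count_components\<close>).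

  Finally \<open>M e\<close> belongs to the support of \<open>C / U\<close> if and only if \<open>C\<close> is not contained in \<open>V e\<close>
  (\<open>Supp_U_V\<close>), and \<open>V e\<close> is the splitter of \<open>U \<subseteq> S\<close> at \<open>M (1 - e)\<close> when both maximal ideals
  support \<open>S / U\<close> (\<open>splitter_V\<close>).
\<close>

section \<open>Polynomial identities in a commutative ring\<close>

context cring
begin

text \<open>
  Polynomial identities are proved by reflection: both sides are described by formal expressions with
  the same normal form. The normal form and its correctness come from the theory \<open>Commutative_Ring\<close>.
\<close>
definition denotes :: "'a list \<Rightarrow> 'a \<Rightarrow> polex \<Rightarrow> bool" where
  "denotes l t P \<longleftrightarrow> t = Ipolex l P"

text \<open>
  Used as introduction rules from first to last, these rules compute the formal expression of a term;
  only the last two, which look up an atom in the list, depend on that order.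
\<close>
lemma poly_reify:
  "denotes l \<zero> (Const 0)"
  "denotes l \<one> (Const 1)"
  "denotes l s P \<Longrightarrow> denotes l t Q \<Longrightarrow> denotes l (s \<oplus> t) (Add P Q)"
  "denotes l s P \<Longrightarrow> denotes l t Q \<Longrightarrow> denotes l (s \<ominus> t) (Sub P Q)"
  "denotes l s P \<Longrightarrow> denotes l t Q \<Longrightarrow> denotes l (s \<otimes> t) (Mul P Q)"
  "denotes l s P \<Longrightarrow> denotes l (\<ominus> s) (Neg P)"
  "denotes l s P \<Longrightarrow> denotes l (s [^] (n::nat)) (Pow P n)"
  "denotes (x # l) x (Var 0)"
  "denotes l x (Var n) \<Longrightarrow> denotes (y # l) x (Var (Suc n))"
  by (simp_all add: denotes_def)

lemma poly_eqI:
  assumes "denotes l s P" and "denotes l t Q" and "set l \<subseteq> carrier R"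
    and "Commutative_Ring.norm P = Commutative_Ring.norm Q"
  shows "s = t"
  using norm_eq[of l P Q] assms by (auto simp: denotes_def in_carrier_def)

lemmas poly_simps = mkPX_def mkPinj_def sub_def

end

section \<open>The lattice of intermediate rings\<close>

locale distributive_local_extension = cring S for S :: "('a, 'm) ring_scheme" (structure) +
  fixes R :: "'a set"
  assumes sub: "subring R S"
    and int: "integral_extension S R (carrier S)"
    and dis: "distributive_extension S R (carrier S)"
    and FCP: "FCP_extension S R (carrier S)"
    and loc: "local_ring (S\<lparr>carrier := R\<rparr>)"
begin

abbreviation L :: "'a set set" where
  "L \<equiv> intermediate_rings S R (carrier S)"

lemma L_iff: "B \<in> L \<longleftrightarrow> subring B S \<and> R \<subseteq> B"
  by (auto simp: intermediate_rings_def dest: subringE(1))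

lemma L_carrier: "B \<in> L \<Longrightarrow> x \<in> B \<Longrightarrow> x \<in> carrier S"
  and L_R: "B \<in> L \<Longrightarrow> r \<in> R \<Longrightarrow> r \<in> B"
  by (auto simp: intermediate_rings_def)

lemma L_closed [simp]:
  assumes "B \<in> L"
  shows "\<zero> \<in> B" "\<one> \<in> B" "x \<in> B \<Longrightarrow> \<ominus> x \<in> B"
    "x \<in> B \<Longrightarrow> y \<in> B \<Longrightarrow> x \<oplus> y \<in> B" "x \<in> B \<Longrightarrow> y \<in> B \<Longrightarrow> x \<otimes> y \<in> B"
    "x \<in> B \<Longrightarrow> y \<in> B \<Longrightarrow> x \<ominus> y \<in> B"
  using assms subringE[of B S] by (simp_all add: L_iff a_minus_def)

lemma L_pow [simp]: "B \<in> L \<Longrightarrow> x \<in> B \<Longrightarrow> x [^] (k::nat) \<in> B"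
  by (induction k) simp_all

lemma L_I:
  assumes "R \<subseteq> B" "B \<subseteq> carrier S"
    and "\<And>x y. x \<in> B \<Longrightarrow> y \<in> B \<Longrightarrow> x \<oplus> y \<in> B"
    and "\<And>x y. x \<in> B \<Longrightarrow> y \<in> B \<Longrightarrow> x \<otimes> y \<in> B"
  shows "B \<in> L"
proof -
  have one: "\<one> \<in> B" and m1: "\<ominus> \<one> \<in> B"
    using assms(1) subringE[OF sub] by auto
  have "\<ominus> x \<in> B" if "x \<in> B" for x
  proof -
    have "\<ominus> x = \<ominus> \<one> \<otimes> x"
      using that assms(2) by (auto simp: l_minus)
    then show ?thesis
      using assms(4)[OF m1 that] by simp
  qed
  then show ?thesis
    using assms one by (auto simp: L_iff intro!: subringI)
qed

lemma R_L [simp]: "R \<in> L"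
  using sub by (simp add: L_iff)

lemma S_L [simp]: "carrier S \<in> L"
  using carrier_is_subring subringE(1)[OF sub] by (simp add: L_iff)

lemma inter_L [simp]: "H \<in> L \<Longrightarrow> Y \<in> L \<Longrightarrow> H \<inter> Y \<in> L"
  using subring_inter by (auto simp: L_iff)

lemma R_le: "H \<in> L \<Longrightarrow> R \<subseteq> H"
  by (simp add: L_iff)

lemma le_S: "H \<in> L \<Longrightarrow> H \<subseteq> carrier S"
  by (auto dest: L_carrier)

lemma compositum_L [simp]: "H \<in> L \<Longrightarrow> Y \<in> L \<Longrightarrow> compositum S H Y \<in> L"
  and compositum_upper: "H \<in> L \<Longrightarrow> Y \<in> L \<Longrightarrow> H \<subseteq> compositum S H Y"
    "H \<in> L \<Longrightarrow> Y \<in> L \<Longrightarrow> Y \<subseteq> compositum S H Y"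
  and compositum_least: "Z \<in> L \<Longrightarrow> H \<subseteq> Z \<Longrightarrow> Y \<subseteq> Z \<Longrightarrow> compositum S H Y \<subseteq> Z"
proof -
  show u: "H \<in> L \<Longrightarrow> Y \<in> L \<Longrightarrow> H \<subseteq> compositum S H Y"
    "H \<in> L \<Longrightarrow> Y \<in> L \<Longrightarrow> Y \<subseteq> compositum S H Y"
    by (auto simp: compositum_def intro: generate_ring.incl)
  show "H \<in> L \<Longrightarrow> Y \<in> L \<Longrightarrow> compositum S H Y \<in> L"
    using u le_S[of H] le_S[of Y] generate_ring_is_subring[of "H \<union> Y"]
    by (auto simp: L_iff compositum_def intro: generate_ring.incl)
  show "Z \<in> L \<Longrightarrow> H \<subseteq> Z \<Longrightarrow> Y \<subseteq> Z \<Longrightarrow> compositum S H Y \<subseteq> Z"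
    using generate_ring_min_subring1[of "H \<union> Y" Z] le_S[of Z]
    by (auto simp: L_iff compositum_def)
qed

lemma distrib_inf_sup:
  assumes "H \<in> L" "Y \<in> L" "Z \<in> L"
  shows "H \<inter> compositum S Y Z = compositum S (H \<inter> Y) (H \<inter> Z)"
  using dis assms by (simp add: distributive_extension_def)

lemma compositum_absorb: "H \<in> L \<Longrightarrow> Y \<in> L \<Longrightarrow> H \<subseteq> Y \<Longrightarrow> compositum S H Y = Y"
  using compositum_least[of Y H Y] compositum_upper by blast

lemma compositum_commute: "compositum S H Y = compositum S Y H"
  by (simp add: compositum_def Un_commute)

text \<open>
  Distributivity turns \<open>E = E \<inter> (D \<or> F)\<close> into the join of two rings that are contained in \<open>A\<close>.
  All uses of distributivity against a configuration of rings go through this lemma.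
\<close>
lemma pairwise_trivial_meet:
  assumes "A \<in> L" "D \<in> L" "E \<in> L" "F \<in> L"
    and "E \<subseteq> compositum S D F" "E \<inter> D \<subseteq> A" "E \<inter> F \<subseteq> A"
  shows "E \<subseteq> A"
proof -
  have "E = E \<inter> compositum S D F"
    using assms by blast
  also have "\<dots> = compositum S (E \<inter> D) (E \<inter> F)"
    using assms by (simp add: distrib_inf_sup)
  also have "\<dots> \<subseteq> A"
    using assms by (simp add: compositum_least)
  finally show ?thesis .
qed

section \<open>Chain conditions and minimal extensions\<close>

text \<open>
  The range of such a sequence is a chain, hence finite.
\<close>
lemma FCP_repeats:
  fixes f :: "nat \<Rightarrow> 'a set"
  assumes "\<And>i. f i \<in> L" and "\<And>i j. f i \<subseteq> f j \<or> f j \<subseteq> f i"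
  shows "\<exists>i j. i < j \<and> f i = f j"
proof -
  have "subset.chain L (range f)"
    using assms by (auto simp: subset_chain_def)
  then have "finite (range f)"
    using FCP by (auto simp: FCP_extension_def)
  then have "\<not> inj f"
    using finite_imageD infinite_UNIV_nat by blast
  then obtain i j where "i \<noteq> j" "f i = f j"
    by (auto simp: inj_on_def)
  then show ?thesis
    by (metis nat_neq_iff)
qed

lemma no_strict_sequence:
  fixes f :: "nat \<Rightarrow> 'a set"
  assumes L: "\<And>i. f i \<in> L"
    and strict: "(\<forall>i. f i \<subset> f (Suc i)) \<or> (\<forall>i. f (Suc i) \<subset> f i)"
  shows False
proof -
  have less: "(\<forall>i j. i < j \<longrightarrow> f i \<subset> f j) \<or> (\<forall>i j. i < j \<longrightarrow> f j \<subset> f i)"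
    using strict
  proof
    assume up: "\<forall>i. f i \<subset> f (Suc i)"
    show ?thesis
      using lift_Suc_mono_less[of f, OF spec[OF up]] by blast
  next
    assume down: "\<forall>i. f (Suc i) \<subset> f i"
    have "f j \<subset> f i" if "i < j" for i j
      using that
    proof (induction j)
      case (Suc j)
      then show ?case
        using spec[OF down, of j] by (metis less_SucE psubset_trans)
    qed simp
    then show ?thesis
      by blast
  qed
  then have "f i \<subseteq> f j \<or> f j \<subseteq> f i" for i j
    by (cases i j rule: linorder_cases) blast+
  then obtain i j where "i < j" "f i = f j"
    using FCP_repeats[of f, OF L] by blast
  then show False
    using less by blast
qed

lemma obtain_maximal:
  assumes "Q \<subseteq> L" "H \<in> Q"
  obtains Y where "Y \<in> Q" "\<And>Z. Z \<in> Q \<Longrightarrow> Y \<subseteq> Z \<Longrightarrow> Z = Y"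
proof -
  let ?r = "{(Z, Y). Y \<in> L \<and> Z \<in> L \<and> Y \<subset> Z}"
  have "wf ?r"
    unfolding wf_iff_no_infinite_down_chain
  proof (rule notI, elim exE)
    fix f :: "nat \<Rightarrow> 'a set"
    assume f: "\<forall>i. (f (Suc i), f i) \<in> ?r"
    have *: "f i \<in> L \<and> f i \<subset> f (Suc i)" for i
      using spec[OF f, of i] by simp
    show False
      by (rule no_strict_sequence[of f]) (simp_all add: *)
  qed
  then show thesis
  proof (rule wfE_min[OF _ assms(2)])
    fix Y assume Y: "Y \<in> Q" "\<And>Z. (Z, Y) \<in> ?r \<Longrightarrow> Z \<notin> Q"
    show thesis
    proof (rule that[OF Y(1)])
      fix Z assume "Z \<in> Q" "Y \<subseteq> Z"
      then show "Z = Y"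
        using Y(1) Y(2)[of Z] assms(1) by fast
    qed
  qed
qed

lemma obtain_minimal:
  assumes "Q \<subseteq> L" "H \<in> Q"
  obtains Y where "Y \<in> Q" "\<And>Z. Z \<in> Q \<Longrightarrow> Z \<subseteq> Y \<Longrightarrow> Z = Y"
proof -
  let ?r = "{(Y, Z). Y \<in> L \<and> Z \<in> L \<and> Y \<subset> Z}"
  have "wf ?r"
    unfolding wf_iff_no_infinite_down_chain
  proof (rule notI, elim exE)
    fix f :: "nat \<Rightarrow> 'a set"
    assume f: "\<forall>i. (f (Suc i), f i) \<in> ?r"
    have *: "f i \<in> L \<and> f (Suc i) \<subset> f i" for i
      using spec[OF f, of i] by simp
    show False
      by (rule no_strict_sequence[of f]) (simp_all add: *)
  qed
  then show thesis
  proof (rule wfE_min[OF _ assms(2)])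
    fix Y assume Y: "Y \<in> Q" "\<And>Z. (Z, Y) \<in> ?r \<Longrightarrow> Z \<notin> Q"
    show thesis
    proof (rule that[OF Y(1)])
      fix Z assume "Z \<in> Q" "Z \<subseteq> Y"
      then show "Z = Y"
        using Y(1) Y(2)[of Z] assms(1) by fast
    qed
  qed
qed

text \<open>
  The minimal extensions \<open>B \<subset> C\<close>.
\<close>
definition covers :: "'a set \<Rightarrow> 'a set \<Rightarrow> bool" where
  "covers C B \<longleftrightarrow> C \<in> L \<and> B \<subset> C \<and> (\<forall>D \<in> L. B \<subseteq> D \<longrightarrow> D \<subseteq> C \<longrightarrow> D = B \<or> D = C)"

lemma covers_D: "covers C B \<Longrightarrow> D \<in> L \<Longrightarrow> B \<subseteq> D \<Longrightarrow> D \<subseteq> C \<Longrightarrow> D \<noteq> B \<Longrightarrow> D = C"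
  unfolding covers_def by blast

text \<open>
  The descending chain condition, applied to the rings strictly above \<open>B\<close> inside \<open>H\<close>.
\<close>
lemma obtain_cover:
  assumes "H \<in> L" "B \<subset> H"
  obtains C where "covers C B" "C \<subseteq> H"
proof -
  let ?Q = "{D \<in> L. B \<subset> D \<and> D \<subseteq> H}"
  have "?Q \<subseteq> L" "H \<in> ?Q"
    using assms by auto
  then show thesis
  proof (rule obtain_minimal)
  fix C assume C: "C \<in> ?Q" "\<And>Z. Z \<in> ?Q \<Longrightarrow> Z \<subseteq> C \<Longrightarrow> Z = C"
  have "D = B \<or> D = C" if "D \<in> L" "B \<subseteq> D" "D \<subseteq> C" for D
    using C(1) C(2)[of D] that by blast
  then have "covers C B"
    using C(1) by (simp add: covers_def)
  then show thesis
    using C(1) that by blast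
  qed
qed

section \<open>Adjoining the multiples of an element\<close>

text \<open>
  \<open>A + C x\<close>. With \<open>C = A\<close> this is a quadratic extension; with \<open>x \<in> C\<close> it is \<open>A\<close> plus a principal
  ideal of \<open>C\<close>; and with \<open>A\<close> an ideal of \<open>C\<close> it describes the ideals of quadratic extensions.
\<close>
definition adjoin :: "'a set \<Rightarrow> 'a set \<Rightarrow> 'a \<Rightarrow> 'a set" where
  "adjoin A C x = {a \<oplus> c \<otimes> x | a c. a \<in> A \<and> c \<in> C}"

lemma adjoinI: "a \<in> A \<Longrightarrow> c \<in> C \<Longrightarrow> y = a \<oplus> c \<otimes> x \<Longrightarrow> y \<in> adjoin A C x"
  by (auto simp: adjoin_def)

lemma adjoinE:
  assumes "y \<in> adjoin A C x"
  obtains a c where "a \<in> A" "c \<in> C" "y = a \<oplus> c \<otimes> x"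
  using assms unfolding adjoin_def by blast

lemma adjoin_add:
  assumes "A \<subseteq> carrier S" "C \<subseteq> carrier S" "x \<in> carrier S"
    and "\<And>a b. a \<in> A \<Longrightarrow> b \<in> A \<Longrightarrow> a \<oplus> b \<in> A" "\<And>a b. a \<in> C \<Longrightarrow> b \<in> C \<Longrightarrow> a \<oplus> b \<in> C"
    and "u \<in> adjoin A C x" "v \<in> adjoin A C x"
  shows "u \<oplus> v \<in> adjoin A C x"
proof -
  obtain a c a' c' where *: "a \<in> A" "c \<in> C" "a' \<in> A" "c' \<in> C"
    and u: "u = a \<oplus> c \<otimes> x" and v: "v = a' \<oplus> c' \<otimes> x"
    using assms(6,7) by (auto simp: adjoin_def)
  have [simp]: "a \<in> carrier S" "c \<in> carrier S" "a' \<in> carrier S" "c' \<in> carrier S"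
    using * assms by blast+
  show ?thesis
    unfolding u v
  proof (rule adjoinI)
    show "(a \<oplus> c \<otimes> x) \<oplus> (a' \<oplus> c' \<otimes> x) = (a \<oplus> a') \<oplus> (c \<oplus> c') \<otimes> x"
      using assms(3) by - (rule poly_eqI[of "[a,c,a',c',x]"], (rule poly_reify)+, simp_all add: poly_simps)
  qed (use * assms in auto)
qed

text \<open>
  A product of two elements lies in \<open>A + C x + C x\<^sup>2\<close>, so only \<open>C x\<^sup>2\<close> has to be absorbed.
\<close>
lemma adjoin_L:
  assumes A: "A \<in> L" and C: "C \<in> L" and "A \<subseteq> C" and x: "x \<in> carrier S"
    and sq: "\<And>c. c \<in> C \<Longrightarrow> c \<otimes> (x \<otimes> x) \<in> adjoin A C x"
  shows "adjoin A C x \<in> L"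
proof (rule L_I)
  have "a \<in> adjoin A C x" if "a \<in> A" for a
    using that A C x by (intro adjoinI[of a A \<zero> C]) (auto simp: L_carrier[OF A])
  then show "R \<subseteq> adjoin A C x"
    using R_le[OF A] by blast
  show "adjoin A C x \<subseteq> carrier S"
    using x by (auto simp: adjoin_def L_carrier[OF A] L_carrier[OF C])
  fix u v assume uv: "u \<in> adjoin A C x" "v \<in> adjoin A C x"
  show "u \<oplus> v \<in> adjoin A C x"
    using adjoin_add[OF le_S[OF A] le_S[OF C] x L_closed(4)[OF A] L_closed(4)[OF C] uv] .
  obtain a c a' c' where *: "a \<in> A" "c \<in> C" "a' \<in> A" "c' \<in> C"
    and u: "u = a \<oplus> c \<otimes> x" and v: "v = a' \<oplus> c' \<otimes> x"
    using uv by (auto simp: adjoin_def)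
  have [simp]: "a \<in> carrier S" "c \<in> carrier S" "a' \<in> carrier S" "c' \<in> carrier S"
    using * assms L_carrier by blast+
  have "u \<otimes> v = (a \<otimes> a' \<oplus> (a \<otimes> c' \<oplus> a' \<otimes> c) \<otimes> x) \<oplus> (c \<otimes> c') \<otimes> (x \<otimes> x)"
    unfolding u v using x by - (rule poly_eqI[of "[a,c,a',c',x]"], (rule poly_reify)+, simp_all add: poly_simps)
  also have "\<dots> \<in> adjoin A C x"
  proof (rule adjoin_add[OF le_S[OF A] le_S[OF C] x L_closed(4)[OF A] L_closed(4)[OF C]])
    show "a \<otimes> a' \<oplus> (a \<otimes> c' \<oplus> a' \<otimes> c) \<otimes> x \<in> adjoin A C x"
      using * assms by (intro adjoinI[of "a \<otimes> a'" A "a \<otimes> c' \<oplus> a' \<otimes> c"]) (auto simp: subset_iff)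
    show "c \<otimes> c' \<otimes> (x \<otimes> x) \<in> adjoin A C x"
      using * C by (intro sq) simp
  qed
  finally show "u \<otimes> v \<in> adjoin A C x" .
qed

lemma adjoin_base: "A \<in> L \<Longrightarrow> C \<in> L \<Longrightarrow> x \<in> carrier S \<Longrightarrow> A \<subseteq> adjoin A C x"
  using adjoinI[of _ A \<zero> C _ x] L_carrier[of A] by fastforce

lemma adjoin_gen: "A \<in> L \<Longrightarrow> C \<in> L \<Longrightarrow> x \<in> carrier S \<Longrightarrow> x \<in> adjoin A C x"
  using adjoinI[of \<zero> A \<one> C x x] by simp

lemma adjoin_least: "H \<in> L \<Longrightarrow> A \<subseteq> H \<Longrightarrow> C \<subseteq> H \<Longrightarrow> x \<in> H \<Longrightarrow> adjoin A C x \<subseteq> H"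
  by (auto simp: adjoin_def subset_iff)

lemma adjoin_scalar:
  assumes "A \<in> L" "C \<in> L" "x \<in> carrier S" "c \<in> C"
  shows "c \<otimes> x \<in> adjoin A C x"
  using assms L_carrier[of C c] by (intro adjoinI[of \<zero> A c C]) auto

lemma adjoin_multiples_L:
  assumes "A \<in> L" "C \<in> L" "A \<subseteq> C" "x \<in> C"
  shows "adjoin A C x \<in> L"
proof (rule adjoin_L)
  fix c assume c: "c \<in> C"
  have [simp]: "c \<in> carrier S" "x \<in> carrier S"
    using assms c L_carrier by blast+
  show "c \<otimes> (x \<otimes> x) \<in> adjoin A C x"
  proof (rule adjoinI[of \<zero> A "c \<otimes> x"])
    show "c \<otimes> (x \<otimes> x) = \<zero> \<oplus> c \<otimes> x \<otimes> x" by - (rule poly_eqI[of "[c,x]"], (rule poly_reify)+, simp_all add: poly_simps)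
  qed (use assms c in auto)
qed (use assms L_carrier in auto)

lemma simple_adjoin_L:
  assumes "A \<in> L" "x \<in> carrier S" "x \<otimes> x \<in> adjoin A A x"
  shows "adjoin A A x \<in> L"
proof (rule adjoin_L)
  fix c assume c: "c \<in> A"
  obtain a b where ab: "a \<in> A" "b \<in> A" and sq: "x \<otimes> x = a \<oplus> b \<otimes> x"
    using assms(3) by (auto simp: adjoin_def)
  have [simp]: "c \<in> carrier S" "a \<in> carrier S" "b \<in> carrier S"
    using assms(1) c ab L_carrier by blast+
  show "c \<otimes> (x \<otimes> x) \<in> adjoin A A x"
    unfolding sq
  proof (rule adjoinI[of "c \<otimes> a" A "c \<otimes> b"])
    show "c \<otimes> (a \<oplus> b \<otimes> x) = c \<otimes> a \<oplus> c \<otimes> b \<otimes> x"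
      using assms(2) by - (rule poly_eqI[of "[c,a,b,x]"], (rule poly_reify)+, simp_all add: poly_simps)
  qed (use assms ab c in auto)
qed (use assms in auto)

text \<open>
  The rings \<open>A + A x\<close>, \<open>A + A y\<close> and \<open>A + A (x + y)\<close> meet pairwise in \<open>A\<close> because \<open>x\<close> and \<open>y\<close>
  are independent modulo \<open>P\<close>, while the third is contained in the compositum of the first two.
\<close>
lemma no_independent_pair:
  assumes A: "A \<in> L" and x: "x \<in> carrier S" and y: "y \<in> carrier S"
    and rings: "adjoin A A x \<in> L" "adjoin A A y \<in> L" "adjoin A A (x \<oplus> y) \<in> L"
    and P: "\<And>p. p \<in> P \<Longrightarrow> p \<otimes> x \<in> A" "\<And>p. p \<in> P \<Longrightarrow> p \<otimes> y \<in> A" "\<one> \<notin> P"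
    and indep: "\<And>b c. b \<in> A \<Longrightarrow> c \<in> A \<Longrightarrow> b \<otimes> x \<oplus> c \<otimes> y \<in> A \<Longrightarrow> b \<in> P \<and> c \<in> P"
  shows False
proof -
  note c = L_carrier[OF A]
  let ?E = "adjoin A A (x \<oplus> y)"
  \<comment> \<open>The case \<open>d = 0\<close> is the intersection with \<open>A + A x\<close>, the case \<open>c = 0\<close> the one with \<open>A + A y\<close>.\<close>
  have meet: "a \<oplus> b \<otimes> (x \<oplus> y) \<in> A"
    if "a \<in> A" "b \<in> A" "c \<in> A" "d \<in> A" "a' \<in> A"
      and e: "a \<oplus> b \<otimes> (x \<oplus> y) = a' \<oplus> c \<otimes> x \<oplus> d \<otimes> y" and z: "c = \<zero> \<or> d = \<zero>" for a b a' c d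
  proof -
    have [simp]: "a \<in> carrier S" "b \<in> carrier S" "a' \<in> carrier S" "c \<in> carrier S" "d \<in> carrier S"
      using that c by auto
    have "(b \<ominus> c) \<otimes> x \<oplus> (b \<ominus> d) \<otimes> y
        = (a \<oplus> b \<otimes> (x \<oplus> y)) \<ominus> (a' \<oplus> c \<otimes> x \<oplus> d \<otimes> y) \<oplus> (a' \<ominus> a)"
      using x y by - (rule poly_eqI[of "[a,b,a',c,d,x,y]"], (rule poly_reify)+, simp_all add: poly_simps)
    also have "\<dots> = a' \<ominus> a"
      unfolding e using x y by - (rule poly_eqI[of "[a,b,a',c,d,x,y]"], (rule poly_reify)+, simp_all add: poly_simps)
    finally have "(b \<ominus> c) \<otimes> x \<oplus> (b \<ominus> d) \<otimes> y \<in> A"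
      using that A by simp
    then have "b \<ominus> c \<in> P \<and> b \<ominus> d \<in> P"
      using that A by (intro indep) auto
    then have "b \<in> P"
      using z by (auto simp: a_minus_def)
    moreover have "b \<otimes> (x \<oplus> y) = b \<otimes> x \<oplus> b \<otimes> y"
      using x y by - (rule poly_eqI[of "[b,x,y]"], (rule poly_reify)+, simp_all add: poly_simps)
    ultimately have "b \<otimes> (x \<oplus> y) \<in> A"
      using P A by simp
    then show ?thesis
      using A that(1) by (simp del: r_distr)
  qed
  have "?E \<subseteq> A"
  proof (rule pairwise_trivial_meet[OF A rings(1,3,2)])
    have "x \<oplus> y \<in> compositum S (adjoin A A x) (adjoin A A y)"
      using compositum_upper[OF rings(1,2)] compositum_L[OF rings(1,2)]
        adjoin_gen[OF A A x] adjoin_gen[OF A A y] by (metis L_closed(4) subset_iff)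
    then show "?E \<subseteq> compositum S (adjoin A A x) (adjoin A A y)"
      using compositum_upper(1)[OF rings(1,2)] adjoin_base[OF A A x]
      by (intro adjoin_least) (use rings in auto)
    show "?E \<inter> adjoin A A x \<subseteq> A"
    proof
      fix u assume "u \<in> ?E \<inter> adjoin A A x"
      then obtain a b a' d where *: "a \<in> A" "b \<in> A" "a' \<in> A" "d \<in> A"
        and "u = a \<oplus> b \<otimes> (x \<oplus> y)" "u = a' \<oplus> d \<otimes> x"
        by (auto simp: adjoin_def)
      then show "u \<in> A"
        using meet[of a b d \<zero> a'] A x y by (auto simp: c)
    qed
    show "?E \<inter> adjoin A A y \<subseteq> A"
    proof
      fix u assume "u \<in> ?E \<inter> adjoin A A y"
      then obtain a b a' d where *: "a \<in> A" "b \<in> A" "a' \<in> A" "d \<in> A"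
        and "u = a \<oplus> b \<otimes> (x \<oplus> y)" "u = a' \<oplus> d \<otimes> y"
        by (auto simp: adjoin_def)
      then show "u \<in> A"
        using meet[of a b \<zero> d a'] A x y by (auto simp: c)
    qed
  qed
  then have "x \<oplus> y \<in> A"
    using adjoin_gen[OF A A, of "x \<oplus> y"] x y by auto
  then have "\<one> \<in> P"
    using indep[of \<one> \<one>] A x y by simp
  then show False
    using P(3) by simp
qed

section \<open>Local conditions at a maximal ideal\<close>

text \<open>
  Ideals of a subring as plain sets of elements of the ambient ring; \<open>ideal_iff\<close> below relates them
  to the ideals of the ring with carrier \<open>B\<close>.
\<close>
definition sub_ideal :: "'a set \<Rightarrow> 'a set \<Rightarrow> bool" where
  "sub_ideal P B \<longleftrightarrow> P \<subseteq> B \<and> \<zero> \<in> P \<and> (\<forall>p \<in> P. \<forall>q \<in> P. p \<oplus> q \<in> P) \<and> (\<forall>b \<in> B. \<forall>p \<in> P. b \<otimes> p \<in> P)"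

lemma sub_ideal_closed:
  assumes P: "sub_ideal P B" and B: "B \<in> L"
  shows "\<zero> \<in> P" "p \<in> P \<Longrightarrow> p \<in> B" "p \<in> P \<Longrightarrow> q \<in> P \<Longrightarrow> p \<oplus> q \<in> P"
    "p \<in> P \<Longrightarrow> q \<in> P \<Longrightarrow> p \<ominus> q \<in> P" "p \<in> P \<Longrightarrow> \<ominus> p \<in> P"
    "b \<in> B \<Longrightarrow> p \<in> P \<Longrightarrow> b \<otimes> p \<in> P" "b \<in> B \<Longrightarrow> p \<in> P \<Longrightarrow> p \<otimes> b \<in> P"
proof -
  note c = L_carrier[OF B]
  show *: "\<zero> \<in> P" "p \<in> P \<Longrightarrow> p \<in> B" "p \<in> P \<Longrightarrow> q \<in> P \<Longrightarrow> p \<oplus> q \<in> P"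
    "b \<in> B \<Longrightarrow> p \<in> P \<Longrightarrow> b \<otimes> p \<in> P" for b p q
    using P by (auto simp: sub_ideal_def)
  show m: "\<ominus> p \<in> P" if "p \<in> P" for p
  proof -
    have "\<ominus> p = \<ominus> \<one> \<otimes> p"
      using c *(2) that by (simp add: l_minus)
    then show ?thesis
      using *(4)[of "\<ominus> \<one>" p] that B by simp
  qed
  show "p \<in> P \<Longrightarrow> q \<in> P \<Longrightarrow> p \<ominus> q \<in> P"
    using m *(3) by (simp add: a_minus_def)
  show "b \<in> B \<Longrightarrow> p \<in> P \<Longrightarrow> p \<otimes> b \<in> P"
    using *(4)[of b p] *(2)[of p] c by (simp add: m_comm)
qed

text \<open>
  \<open>P\<close> is a maximal ideal of \<open>B\<close>, and \<open>W / B\<close> is a module over the localization of \<open>B\<close> at \<open>P\<close>: the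
  last clause says that \<open>s \<in> B - P\<close> acts bijectively on \<open>B x\<close> modulo \<open>B\<close>. If \<open>B\<close> is local with maximal
  ideal \<open>P\<close>, then \<open>W\<close> can be the whole ring \<open>S\<close>; the general case is needed for rings with two maximal
  ideals, where it replaces passing to the localization.
\<close>
definition local_at :: "'a set \<Rightarrow> 'a set \<Rightarrow> 'a set \<Rightarrow> bool" where
  "local_at B P W \<longleftrightarrow> B \<in> L \<and> W \<in> L \<and> B \<subseteq> W \<and> sub_ideal P B \<and> \<one> \<notin> P \<and>
     (\<forall>s \<in> B - P. \<exists>z \<in> B. s \<otimes> z \<ominus> \<one> \<in> P) \<and>
     (\<forall>s \<in> B - P. \<forall>x \<in> W. \<exists>p \<in> B. \<exists>q \<in> B. \<one> = p \<otimes> s \<oplus> q \<and> q \<otimes> x \<in> B)"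

context
  fixes B P W
  assumes loc_at: "local_at B P W"
begin

lemma local_at_facts:
  shows B_L: "B \<in> L" and W_L: "W \<in> L" and B_W: "B \<subseteq> W" and P_B: "sub_ideal P B" and one_P: "\<one> \<notin> P"
  using loc_at by (simp_all add: local_at_def)

lemma P_closed [simp]:
  "\<zero> \<in> P" "p \<in> P \<Longrightarrow> p \<in> B" "p \<in> P \<Longrightarrow> q \<in> P \<Longrightarrow> p \<oplus> q \<in> P"
    "p \<in> P \<Longrightarrow> q \<in> P \<Longrightarrow> p \<ominus> q \<in> P" "p \<in> P \<Longrightarrow> \<ominus> p \<in> P"
    "b \<in> B \<Longrightarrow> p \<in> P \<Longrightarrow> b \<otimes> p \<in> P" "b \<in> B \<Longrightarrow> p \<in> P \<Longrightarrow> p \<otimes> b \<in> P"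
  using sub_ideal_closed[OF P_B B_L] by auto

lemma B_carrier: "b \<in> B \<Longrightarrow> b \<in> carrier S"
  and W_carrier: "b \<in> W \<Longrightarrow> b \<in> carrier S"
  and P_carrier: "b \<in> P \<Longrightarrow> b \<in> carrier S"
  using L_carrier B_L W_L by auto

lemma inverse_mod: "s \<in> B \<Longrightarrow> s \<notin> P \<Longrightarrow> \<exists>z \<in> B. s \<otimes> z \<ominus> \<one> \<in> P"
  using loc_at by (simp add: local_at_def)

lemma P_sum_one: "p \<in> P \<Longrightarrow> \<one> \<ominus> p \<in> B - P"
proof -
  assume p: "p \<in> P"
  have "\<one> = (\<one> \<ominus> p) \<oplus> p" using P_carrier[OF p] by - (rule poly_eqI[of "[p]"], (rule poly_reify)+, simp_all add: poly_simps)
  then show ?thesis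
    using P_closed(3)[of "\<one> \<ominus> p" p] one_P p B_L by auto
qed

text \<open>
  With \<open>1 = p s + q\<close> and \<open>q y \<in> B\<close>, the element \<open>y\<close> is \<open>p (s y) + q y\<close>.
\<close>
lemma divide_submodule:
  assumes y: "y \<in> W" and s: "s \<in> B" "s \<notin> P" and D: "B \<subseteq> D"
    "\<And>u v. u \<in> D \<Longrightarrow> v \<in> D \<Longrightarrow> u \<oplus> v \<in> D" "\<And>b u. b \<in> B \<Longrightarrow> u \<in> D \<Longrightarrow> b \<otimes> u \<in> D"
    and sy: "s \<otimes> y \<in> D"
  shows "y \<in> D"
proof -
  obtain p q where pq: "p \<in> B" "q \<in> B" "\<one> = p \<otimes> s \<oplus> q" "q \<otimes> y \<in> B"
    using loc_at y s unfolding local_at_def by blast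
  have [simp]: "p \<in> carrier S" "q \<in> carrier S" "y \<in> carrier S" "s \<in> carrier S"
    using pq y s B_carrier W_carrier by auto
  have "y = \<one> \<otimes> y" by simp
  also have "\<dots> = p \<otimes> (s \<otimes> y) \<oplus> q \<otimes> y"
    unfolding pq(3) by - (rule poly_eqI[of "[p,q,s,y]"], (rule poly_reify)+, simp_all add: poly_simps)
  finally show ?thesis
    using D(2)[OF D(3)[OF pq(1) sy], of "q \<otimes> y"] pq(4) D(1) by auto
qed

lemma divide_ring:
  assumes "y \<in> W" "s \<in> B" "s \<notin> P" "D \<in> L" "B \<subseteq> D" "s \<otimes> y \<in> D"
  shows "y \<in> D"
  using assms by (intro divide_submodule[of y s D]) auto

text \<open>
  Modulo the maximal ideal \<open>P\<close> there are no idempotents other than \<open>0\<close> and \<open>1\<close>.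
\<close>
lemma P_prime_idem:
  assumes e: "e \<in> B" and ee: "e \<otimes> e \<ominus> e \<in> P"
  shows "e \<in> P \<or> \<one> \<ominus> e \<in> P"
proof (rule disjCI)
  assume "\<one> \<ominus> e \<notin> P"
  then obtain z where z: "z \<in> B" "(\<one> \<ominus> e) \<otimes> z \<ominus> \<one> \<in> P"
    using inverse_mod[of "\<one> \<ominus> e"] e B_L by auto
  have "e = \<ominus> (z \<otimes> (e \<otimes> e \<ominus> e)) \<ominus> e \<otimes> ((\<one> \<ominus> e) \<otimes> z \<ominus> \<one>)"
    using B_carrier[OF e] B_carrier[OF z(1)] by - (rule poly_eqI[of "[e,z]"], (rule poly_reify)+, simp_all add: poly_simps)
  also have "\<dots> \<in> P"
    using z e ee by simp
  finally show "e \<in> P" .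
qed

end

section \<open>Nakayama's lemma\<close>

text \<open>
  \<open>A + A x + \<dots> + A x\<^sup>k\<^sup>-\<^sup>1\<close>, by recursion on \<open>k\<close> because the proof of \<open>power_conducts\<close> removes the
  highest power of \<open>x\<close> first.
\<close>
fun powers_span :: "'a set \<Rightarrow> 'a \<Rightarrow> nat \<Rightarrow> 'a set" where
  "powers_span A x 0 = {\<zero>}"
| "powers_span A x (Suc k) = {u \<oplus> b \<otimes> x [^] k | u b. u \<in> powers_span A x k \<and> b \<in> A}"

lemma powers_span_SucI: "u \<in> powers_span A x k \<Longrightarrow> b \<in> A \<Longrightarrow> u \<oplus> b \<otimes> x [^] k \<in> powers_span A x (Suc k)"
  by auto

context
  fixes A x
  assumes A: "A \<in> L" and x: "x \<in> carrier S"
begin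

lemma powers_span_subset: "powers_span A x k \<subseteq> carrier S"
  using x L_carrier[OF A] by (induction k) auto

lemma powers_span_carrier: "u \<in> powers_span A x k \<Longrightarrow> u \<in> carrier S"
  using powers_span_subset by blast

lemma powers_span_zero: "\<zero> \<in> powers_span A x k"
proof (induction k)
  case (Suc k)
  then show ?case
    using powers_span_SucI[of \<zero> A x k \<zero>] A x by simp
qed simp

lemma powers_span_add: "u \<in> powers_span A x k \<Longrightarrow> v \<in> powers_span A x k \<Longrightarrow> u \<oplus> v \<in> powers_span A x k"
proof (induction k arbitrary: u v)
  case (Suc k)
  obtain u' b v' c where *: "u' \<in> powers_span A x k" "v' \<in> powers_span A x k" "b \<in> A" "c \<in> A"
    "u = u' \<oplus> b \<otimes> x [^] k" "v = v' \<oplus> c \<otimes> x [^] k"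
    using Suc.prems by auto
  have [simp]: "u' \<in> carrier S" "v' \<in> carrier S" "b \<in> carrier S" "c \<in> carrier S" "x [^] k \<in> carrier S"
    using * powers_span_carrier L_carrier[OF A] x by auto
  have "u \<oplus> v = (u' \<oplus> v') \<oplus> (b \<oplus> c) \<otimes> x [^] k"
    unfolding *(5,6) by (simp add: l_distr a_ac)
  then show ?case
    using powers_span_SucI[OF Suc.IH[OF *(1,2)], of "b \<oplus> c"] * A by simp
qed simp

lemma powers_span_smult: "a \<in> A \<Longrightarrow> u \<in> powers_span A x k \<Longrightarrow> a \<otimes> u \<in> powers_span A x k"
proof (induction k arbitrary: u)
  case 0
  then show ?case
    using L_carrier[OF A] by simp
next
  case (Suc k)
  obtain u' b where *: "u' \<in> powers_span A x k" "b \<in> A" "u = u' \<oplus> b \<otimes> x [^] k"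
    using Suc.prems by auto
  have [simp]: "u' \<in> carrier S" "b \<in> carrier S" "a \<in> carrier S" "x [^] k \<in> carrier S"
    using * powers_span_carrier L_carrier[OF A] x Suc.prems by auto
  have "a \<otimes> u = a \<otimes> u' \<oplus> (a \<otimes> b) \<otimes> x [^] k"
    unfolding *(3) by (simp add: r_distr m_assoc)
  then show ?case
    using powers_span_SucI[OF Suc.IH[OF Suc.prems(1) *(1)], of "a \<otimes> b"] * A Suc.prems by simp
qed

lemma powers_span_Suc: "powers_span A x k \<subseteq> powers_span A x (Suc k)"
proof
  fix u assume u: "u \<in> powers_span A x k"
  have "u \<in> carrier S"
    using powers_span_carrier u by blast
  then have "u = u \<oplus> \<zero> \<otimes> x [^] k"
    using x by simp
  then show "u \<in> powers_span A x (Suc k)"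
    using powers_span_SucI[OF u, of \<zero>] A by simp
qed

lemma powers_span_shift: "u \<in> powers_span A x k \<Longrightarrow> x \<otimes> u \<in> powers_span A x (Suc k)"
proof (induction k arbitrary: u)
  case 0
  then show ?case
    using powers_span_zero[of 1] x by simp
next
  case (Suc k)
  obtain u' b where *: "u' \<in> powers_span A x k" "b \<in> A" "u = u' \<oplus> b \<otimes> x [^] k"
    using Suc.prems by auto
  have [simp]: "u' \<in> carrier S" "b \<in> carrier S" "x [^] k \<in> carrier S"
    using * powers_span_carrier L_carrier[OF A] x by auto
  have "x \<otimes> u = x \<otimes> u' \<oplus> b \<otimes> x [^] (Suc k)"
    unfolding *(3) using x by (simp add: r_distr m_ac)
  then show ?case
    using powers_span_SucI[OF Suc.IH[OF *(1)] *(2)] by simp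
qed

lemma eval_in_powers_span: "set q \<subseteq> A \<Longrightarrow> eval q x \<in> powers_span A x (length q)"
proof (induction q)
  case (Cons a q)
  have [simp]: "a \<in> carrier S" "eval q x \<in> carrier S"
    using Cons powers_span_carrier L_carrier[OF A] by auto
  have "eval (a # q) x = eval q x \<oplus> a \<otimes> x [^] length q"
    using x by (simp add: a_comm)
  then show ?case
    using powers_span_SucI[of "eval q x" A x "length q" a] Cons by simp
qed simp

text \<open>
  Integrality of \<open>x\<close> over \<open>R\<close>: its monic equation expresses a power of \<open>x\<close> by smaller ones.
\<close>
lemma monic_relation: "\<exists>n. x [^] n \<in> powers_span A x n"
proof -
  obtain p where p: "p \<in> carrier (univ_poly S R)" "p \<noteq> []" "lead_coeff p = \<one>" "eval p x = \<zero>"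
    using int x by (auto simp: integral_extension_def)
  then obtain q where q: "p = \<one> # q"
    by (cases p) auto
  have "set q \<subseteq> A"
    using p(1) q R_le[OF A] by (auto simp: univ_poly_carrier[symmetric] polynomial_def)
  then have e: "eval q x \<in> powers_span A x (length q)"
    by (rule eval_in_powers_span)
  then have [simp]: "eval q x \<in> carrier S"
    using powers_span_carrier by auto
  have "x [^] length q \<oplus> eval q x = \<zero>"
    using p(4) q x by simp
  then have eq: "x [^] length q = \<ominus> \<one> \<otimes> eval q x"
    using x by (simp add: l_minus minus_equality)
  have "x [^] length q \<in> powers_span A x (length q)"
    unfolding eq using powers_span_smult[OF _ e, of "\<ominus> \<one>"] A by simp
  then show ?thesis
    by blast
qed

text \<open>
  The ring \<open>A[x]\<close> is a finitely generated module.
\<close>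
lemma powers_span_ring: "\<exists>n. powers_span A x n \<in> L \<and> A \<subseteq> powers_span A x n \<and> x \<in> powers_span A x n"
proof -
  obtain n0 where "x [^] n0 \<in> powers_span A x n0"
    using monic_relation by blast
  \<comment> \<open>One more than the degree, so that \<open>A = A x\<^sup>0\<close> is included even for degree \<open>0\<close>.\<close>
  define n where "n = Suc n0"
  have xn: "x [^] n \<in> powers_span A x n"
    using powers_span_shift[OF \<open>x [^] n0 \<in> _\<close>] x by (simp add: n_def m_comm)
  let ?C = "powers_span A x n"
  have shift: "x \<otimes> u \<in> ?C" if u: "u \<in> ?C" for u
  proof -
    obtain v b where *: "v \<in> ?C" "b \<in> A" "x \<otimes> u = v \<oplus> b \<otimes> x [^] n"
      using powers_span_shift[OF u] by auto
    then show ?thesis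
      using powers_span_add powers_span_smult xn by simp
  qed
  have pow: "x [^] (k::nat) \<otimes> u \<in> ?C" if "u \<in> ?C" for u k
  proof (induction k)
    case 0
    have "u \<in> carrier S"
      using that powers_span_carrier by blast
    then show ?case
      using that by simp
  next
    case (Suc k)
    have "u \<in> carrier S"
      using that powers_span_carrier by auto
    then have "x [^] Suc k \<otimes> u = x \<otimes> (x [^] k \<otimes> u)"
      using x by (simp add: m_ac)
    then show ?case
      using shift[OF Suc] by simp
  qed
  have A_le: "A \<subseteq> ?C"
  proof
    fix a assume a: "a \<in> A"
    have "a \<in> powers_span A x (Suc k)" for k
    proof (induction k)
      case 0
      then show ?case
        using powers_span_SucI[of \<zero> A x 0 a] a L_carrier[OF A] by simp
    next
      case (Suc k)
      then show ?case
        using powers_span_Suc by blast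
    qed
    then show "a \<in> ?C"
      unfolding n_def .
  qed
  have mult: "u \<otimes> v \<in> ?C" if u: "u \<in> ?C" and v: "v \<in> powers_span A x k" for u v k
    using v
  proof (induction k arbitrary: v)
    case 0
    then show ?case
      using u powers_span_carrier powers_span_zero by auto
  next
    case (Suc k)
    obtain w b where *: "w \<in> powers_span A x k" "b \<in> A" "v = w \<oplus> b \<otimes> x [^] k"
      using Suc.prems by auto
    have [simp]: "w \<in> carrier S" "b \<in> carrier S" "u \<in> carrier S" "x [^] k \<in> carrier S"
      using * u powers_span_carrier L_carrier[OF A] x by auto
    have "u \<otimes> v = u \<otimes> w \<oplus> b \<otimes> (x [^] k \<otimes> u)"
      unfolding *(3) by (simp add: r_distr m_ac)
    then show ?case
      using powers_span_add[OF Suc.IH[OF *(1)] powers_span_smult[OF *(2) pow[OF u]]] by simp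
  qed
  have "?C \<in> L"
    using A_le R_le[OF A] powers_span_subset powers_span_add mult by (intro L_I) auto
  moreover have "x \<in> ?C"
    using pow[of \<one> 1] subsetD[OF A_le, of \<one>] A x by simp
  ultimately show ?thesis
    using A_le by blast
qed

end

text \<open>
  Nakayama's lemma for \<open>f\<close> in \<open>P\<close> and the ring \<open>C = B[x]\<close>. By FCP the descending sequence of rings
  \<open>B + C f\<^sup>j\<close> becomes stationary, say at \<open>j\<close>. Then \<open>C f\<^sup>j \<subseteq> B + (C f\<^sup>j) f\<close>, and the generators
  \<open>x\<^sup>k f\<^sup>j\<close> of \<open>C f\<^sup>j\<close> can be eliminated one after the other, starting with the highest power, since
  \<open>1 - f \<beta>\<close> can be divided by; in the end \<open>C f\<^sup>j \<subseteq> B\<close>.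
\<close>
lemma power_conducts:
  assumes la: "local_at B P W" and f: "f \<in> P" and x: "x \<in> W"
  obtains j C where "C \<in> L" "B \<subseteq> C" "x \<in> C" "\<And>c. c \<in> C \<Longrightarrow> c \<otimes> f [^] (j::nat) \<in> B"
proof -
  note B = B_L[OF la] and W = W_L[OF la] and BW = B_W[OF la]
  have fB: "f \<in> B"
    using P_closed(2)[OF la f] .
  have [simp]: "x \<in> carrier S" "f \<in> carrier S"
    using x f W_carrier[OF la] P_carrier[OF la] by auto
  obtain n where n: "powers_span B x n \<in> L" "B \<subseteq> powers_span B x n" "x \<in> powers_span B x n"
    using powers_span_ring[OF B \<open>x \<in> carrier S\<close>] by blast
  let ?C = "powers_span B x n"
  have C_W: "powers_span B x k \<subseteq> W" for k
    using x W BW by (induction k) (auto simp: subset_iff)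
  let ?D = "\<lambda>j::nat. adjoin B ?C (f [^] j)"
  have D_L: "?D j \<in> L" for j
    using fB n by (intro adjoin_multiples_L B n(1,2)) auto
  have D_Suc: "?D (Suc j) \<subseteq> ?D j" for j
  proof
    fix u assume "u \<in> ?D (Suc j)"
    then obtain b c where *: "b \<in> B" "c \<in> ?C" "u = b \<oplus> c \<otimes> f [^] Suc j"
      by (auto simp: adjoin_def)
    have [simp]: "c \<in> carrier S"
      using L_carrier[OF n(1) *(2)] .
    have "u = b \<oplus> (c \<otimes> f) \<otimes> f [^] j"
      unfolding *(3) by (simp add: m_ac)
    then show "u \<in> ?D j"
      using * n fB by (intro adjoinI[of b B "c \<otimes> f"]) auto
  qed
  then have anti: "i \<le> j \<Longrightarrow> ?D j \<subseteq> ?D i" for i j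
    using lift_Suc_antimono_le[of ?D] by blast
  obtain i j where ij: "i < j" "?D i = ?D j"
    using FCP_repeats[of ?D] D_L anti nat_le_linear by metis
  have stable: "?D i = ?D (Suc i)"
    using anti[of i "Suc i"] anti[of "Suc i" j] ij by auto
  let ?A = "\<lambda>k. adjoin B (powers_span B x k) (f [^] i)"
  have A_add: "u \<oplus> v \<in> ?A k" if "u \<in> ?A k" "v \<in> ?A k" for u v k
    by (rule adjoin_add[OF le_S[OF B] powers_span_subset[OF B]])
      (use that B powers_span_add[OF B] in auto)
  have A_smult: "b \<otimes> u \<in> ?A k" if b: "b \<in> B" and u: "u \<in> ?A k" for b u k
  proof -
    obtain a c where *: "a \<in> B" "c \<in> powers_span B x k" "u = a \<oplus> c \<otimes> f [^] i"
      using u by (auto simp: adjoin_def)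
    have [simp]: "a \<in> carrier S" "b \<in> carrier S" "c \<in> carrier S"
      using * b L_carrier[OF B] powers_span_carrier[OF B \<open>x \<in> carrier S\<close>] by auto
    show ?thesis
      by (rule adjoinI[of "b \<otimes> a" B "b \<otimes> c"])
        (use * b B powers_span_smult[OF B] in \<open>simp_all add: r_distr m_assoc\<close>)
  qed
  have A_B: "B \<subseteq> ?A k" for k
  proof
    fix b assume "b \<in> B"
    then show "b \<in> ?A k"
      using powers_span_zero[OF B] L_carrier[OF B] by (intro adjoinI[of b B \<zero>]) auto
  qed
  \<comment> \<open>The generator \<open>y = x\<^sup>k f\<^sup>i\<close> satisfies \<open>(1 - f \<beta>) y \<in> A\<^sub>k\<close>, where \<open>A\<^sub>k\<close> is spanned by the lower ones.\<close>
  have eliminate: "\<forall>c \<in> ?C. c \<otimes> f [^] i \<in> ?A k" if "\<forall>c \<in> ?C. c \<otimes> f [^] i \<in> ?A (Suc k)" for k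
  proof -
    have "x [^] k \<otimes> f [^] i \<in> ?D i"
      using n B fB by (intro adjoinI[of \<zero> B "x [^] k"]) auto
    then obtain b c where bc: "b \<in> B" "c \<in> ?C" and e1: "x [^] k \<otimes> f [^] i = b \<oplus> c \<otimes> f [^] Suc i"
      unfolding stable by (auto simp: adjoin_def)
    have "c \<otimes> f [^] i \<in> ?A (Suc k)"
      using that bc by blast
    then obtain b' u \<beta> where *: "b' \<in> B" "u \<in> powers_span B x k" "\<beta> \<in> B"
      and e2: "c \<otimes> f [^] i = b' \<oplus> (u \<oplus> \<beta> \<otimes> x [^] k) \<otimes> f [^] i"
      by (auto simp: adjoin_def)
    have cs: "b \<in> carrier S" "c \<in> carrier S" "b' \<in> carrier S" "u \<in> carrier S" "\<beta> \<in> carrier S"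
      using * bc L_carrier[OF B] L_carrier[OF n(1)] powers_span_carrier[OF B \<open>x \<in> carrier S\<close>] by auto
    define y where "y = x [^] k \<otimes> f [^] i"
    define g where "g = f [^] i"
    have [simp]: "y \<in> carrier S" "g \<in> carrier S" "x [^] k \<in> carrier S"
      by (simp_all add: y_def g_def)
    have "y = b \<oplus> (c \<otimes> g) \<otimes> f"
      using e1 cs by (simp add: y_def g_def m_assoc)
    also have "c \<otimes> g = b' \<oplus> u \<otimes> g \<oplus> \<beta> \<otimes> y"
      using e2 cs by (simp add: y_def g_def l_distr m_assoc a_assoc)
    finally have y_eq: "y = b \<oplus> (b' \<oplus> u \<otimes> g \<oplus> \<beta> \<otimes> y) \<otimes> f" .
    have "(\<one> \<ominus> f \<otimes> \<beta>) \<otimes> y = y \<ominus> f \<otimes> \<beta> \<otimes> y"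
      using cs by - (rule poly_eqI[of "[y,f,\<beta>]"], (rule poly_reify)+, simp_all add: poly_simps)
    also have "\<dots> = (b \<oplus> (b' \<oplus> u \<otimes> g \<oplus> \<beta> \<otimes> y) \<otimes> f) \<ominus> f \<otimes> \<beta> \<otimes> y"
      using y_eq by simp
    also have "\<dots> = (b \<oplus> f \<otimes> b') \<oplus> (f \<otimes> u) \<otimes> g"
      using cs by - (rule poly_eqI[of "[b,b',u,g,\<beta>,y,f]"], (rule poly_reify)+, simp_all add: poly_simps)
    also have "\<dots> \<in> ?A k"
      unfolding g_def using * bc fB B powers_span_smult[OF B] by (intro adjoinI) auto
    finally have "(\<one> \<ominus> f \<otimes> \<beta>) \<otimes> y \<in> ?A k" .
    moreover have "y \<in> W"
      unfolding y_def using x fB BW W by auto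
    moreover have "\<one> \<ominus> f \<otimes> \<beta> \<in> B - P"
      using f * by (intro P_sum_one[OF la] P_closed(7)[OF la])
    ultimately have yA: "y \<in> ?A k"
      by (intro divide_submodule[OF la, of y "\<one> \<ominus> f \<otimes> \<beta>" "?A k"]) (use A_B A_add A_smult in auto)
    show ?thesis
    proof
      fix c assume "c \<in> ?C"
      then have "c \<otimes> f [^] i \<in> ?A (Suc k)"
        using that by blast
      then obtain b' u \<beta> where *: "b' \<in> B" "u \<in> powers_span B x k" "\<beta> \<in> B"
        and e2: "c \<otimes> f [^] i = b' \<oplus> (u \<oplus> \<beta> \<otimes> x [^] k) \<otimes> f [^] i"
        by (auto simp: adjoin_def)
      have cs: "b' \<in> carrier S" "u \<in> carrier S" "\<beta> \<in> carrier S"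
        using * L_carrier[OF B] powers_span_carrier[OF B \<open>x \<in> carrier S\<close>] by auto
      have "c \<otimes> f [^] i = (b' \<oplus> u \<otimes> f [^] i) \<oplus> \<beta> \<otimes> y"
        unfolding e2 using cs by (simp add: y_def l_distr m_assoc a_assoc)
      moreover have "b' \<oplus> u \<otimes> f [^] i \<in> ?A k"
        using * by (intro adjoinI) auto
      ultimately show "c \<otimes> f [^] i \<in> ?A k"
        using A_add A_smult[OF *(3) yA] by simp
    qed
  qed
  have eliminate_all: "(\<forall>c \<in> ?C. c \<otimes> f [^] i \<in> ?A k) \<longrightarrow> (\<forall>c \<in> ?C. c \<otimes> f [^] i \<in> ?A 0)" for k
    using eliminate by (induction k) blast+
  have "\<forall>c \<in> ?C. c \<otimes> f [^] i \<in> ?A n"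
    using B powers_span_carrier[OF B \<open>x \<in> carrier S\<close>] by (auto intro!: adjoinI[of \<zero> B])
  then have "\<forall>c \<in> ?C. c \<otimes> f [^] i \<in> ?A 0"
    using eliminate_all by blast
  then have "c \<otimes> f [^] i \<in> B" if "c \<in> ?C" for c
    using that L_carrier[OF B] by (fastforce simp: adjoin_def)
  then show thesis
    using that[OF n] by blast
qed

section \<open>Types of minimal extensions\<close>

lemma local_at_mono: "local_at B P W \<Longrightarrow> W' \<in> L \<Longrightarrow> B \<subseteq> W' \<Longrightarrow> W' \<subseteq> W \<Longrightarrow> local_at B P W'"
  unfolding local_at_def by blast

text \<open>
  In a minimal extension, the ring \<open>B + C f\<close> is \<open>B\<close> or \<open>C\<close>. If it were \<open>C\<close>, then \<open>C = B + C f\<^sup>j\<close> for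
  all \<open>j\<close>, against \<open>power_conducts\<close>. So \<open>P C \<subseteq> B\<close>; and an element \<open>f c\<close> outside \<open>P\<close> would bring \<open>c\<close>
  into \<open>B\<close>, because \<open>f c \<cdot> c = f c\<^sup>2 \<in> B\<close>.
\<close>
lemma cover_conductor:
  assumes la: "local_at B P W" and cov: "covers C B" and CW: "C \<subseteq> W" and f: "f \<in> P" and c: "c \<in> C"
  shows "f \<otimes> c \<in> P"
proof -
  note B = B_L[OF la]
  have C: "C \<in> L" "B \<subset> C"
    using cov by (auto simp: covers_def)
  have fB: "f \<in> B"
    using P_closed(2)[OF la f] .
  have [simp]: "f \<in> carrier S"
    using P_carrier[OF la f] .
  have conduct: "f \<otimes> c \<in> B" if f: "f \<in> P" and c: "c \<in> C" for f c
  proof (rule ccontr)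
    assume notin: "f \<otimes> c \<notin> B"
    have fB: "f \<in> B"
      using P_closed(2)[OF la f] .
    have [simp]: "f \<in> carrier S" "c \<in> carrier S"
      using P_carrier[OF la f] L_carrier[OF C(1) c] by auto
    let ?D = "adjoin B C f"
    have BC: "B \<subseteq> C"
      using C by blast
    have fC: "f \<in> C"
      using fB BC by blast
    have D: "?D \<in> L" "B \<subseteq> ?D" "?D \<subseteq> C"
      using adjoin_multiples_L[OF B C(1) BC fC] adjoin_base[OF B C(1), of f]
        adjoin_least[OF C(1) BC order_refl fC] by simp_all
    have "f \<otimes> c \<in> ?D"
      using adjoin_scalar[OF B C(1) _ c, of f] by (simp add: m_comm)
    then have D_eq: "?D = C"
      using covers_D[OF cov D] notin by blast
    have deep: "C \<subseteq> adjoin B C (f [^] (j::nat))" for j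
    proof (induction j)
      case 0
      show ?case
      proof
        fix c assume "c \<in> C"
        then show "c \<in> adjoin B C (f [^] (0::nat))"
          using adjoin_scalar[OF B C(1) one_closed, of c] L_carrier[OF C(1)] by simp
      qed
    next
      case (Suc j)
      show ?case
      proof
        fix c assume "c \<in> C"
        then have "c \<in> ?D"
          using D_eq by simp
        then obtain b c' where 1: "b \<in> B" "c' \<in> C" "c = b \<oplus> c' \<otimes> f"
          by (rule adjoinE)
        have "c' \<in> adjoin B C (f [^] j)"
          using Suc 1(2) by blast
        then obtain b' c'' where 2: "b' \<in> B" "c'' \<in> C" "c' = b' \<oplus> c'' \<otimes> f [^] j"
          by (rule adjoinE)
        have cs: "b \<in> carrier S" "b' \<in> carrier S" "c'' \<in> carrier S"
          using 1 2 L_carrier[OF B] L_carrier[OF C(1)] by auto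
        have "c = (b \<oplus> b' \<otimes> f) \<oplus> c'' \<otimes> f [^] (Suc j)"
          unfolding 1(3) 2(3) using cs by (simp add: l_distr a_assoc m_assoc)
        moreover have "b \<oplus> b' \<otimes> f \<in> B"
          using 1(1) 2(1) fB B by simp
        ultimately show "c \<in> adjoin B C (f [^] Suc j)"
          using 2(2) by (intro adjoinI[of "b \<oplus> b' \<otimes> f" B c''])
      qed
    qed
    obtain x where x: "x \<in> C" "x \<notin> B"
      using C by blast
    then have "x \<in> W"
      using CW by blast
    obtain j C' where j: "C' \<in> L" "B \<subseteq> C'" "x \<in> C'" "\<And>c. c \<in> C' \<Longrightarrow> c \<otimes> f [^] (j::nat) \<in> B"
      by (rule power_conducts[OF la f \<open>x \<in> W\<close>]) (rule that; assumption)
    have "x \<in> C' \<inter> C"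
      using x j(3) by simp
    then have "C' \<inter> C \<noteq> B"
      using x(2) by (auto simp only:)
    then have "C' \<inter> C = C"
      using j(2) BC by (intro covers_D[OF cov inter_L[OF j(1) C(1)]]) simp_all
    then have CC: "C \<subseteq> C'"
      by (simp only: inf.absorb_iff2)
    obtain b c where bc: "b \<in> B" "c \<in> C" "x = b \<oplus> c \<otimes> f [^] j"
      using subsetD[OF deep x(1)] by (rule adjoinE)
    have "x \<in> B"
      unfolding bc(3) using L_closed(4)[OF B bc(1) j(4)[OF subsetD[OF CC bc(2)]]] .
    then show False
      using x(2) by simp
  qed
  show ?thesis
  proof (rule ccontr)
    assume notP: "f \<otimes> c \<notin> P"
    have [simp]: "c \<in> carrier S"
      using L_carrier[OF C(1) c] .
    have "f \<otimes> c \<otimes> c = f \<otimes> (c \<otimes> c)"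
      by (simp add: m_assoc)
    then have "f \<otimes> c \<otimes> c \<in> B"
      using conduct[OF f, of "c \<otimes> c"] c C by simp
    then have "c \<in> B"
      by (rule divide_ring[OF la subsetD[OF CW c] conduct[OF f c] notP B order_refl])
    then show False
      using notP f P_closed(7)[OF la] by blast
  qed
qed

text \<open>
  Modulo \<open>P\<close>, the ring \<open>C\<close> is a minimal algebra over a field. If it is not a field, take a nonunit
  \<open>y\<close> outside \<open>P\<close>. Either \<open>y\<^sup>2\<close> is in the base field, hence zero, or \<open>y\<^sup>2\<close> generates \<open>C\<close>; in the latter
  case \<open>y = a + c y\<^sup>2\<close> with \<open>a\<close> zero modulo \<open>P\<close>, and \<open>y c\<close> is a nontrivial idempotent.
\<close>
lemma cover_trichotomy:
  assumes la: "local_at B P W" and cov: "covers C B" and CW: "C \<subseteq> W"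
  obtains (ramified) x where "x \<in> C" "x \<notin> B" "x \<otimes> x \<in> P"
  | (decomposed) e where "e \<in> C" "e \<notin> B" "e \<otimes> e \<ominus> e \<in> P"
  | (inert) "\<And>y. y \<in> C \<Longrightarrow> y \<notin> P \<Longrightarrow> \<exists>z \<in> C. y \<otimes> z \<ominus> \<one> \<in> P"
proof (rule ccontr)
  assume contr: "\<not> thesis"
  note B = B_L[OF la]
  have C: "C \<in> L" "B \<subset> C"
    using cov by (auto simp: covers_def)
  have cond: "f \<in> P \<Longrightarrow> c \<in> C \<Longrightarrow> f \<otimes> c \<in> P" for f c
    using cover_conductor[OF la cov CW] .
  have BC: "B \<subseteq> C"
    using C by blast
  have "\<exists>z \<in> C. y \<otimes> z \<ominus> \<one> \<in> P" if y: "y \<in> C" "y \<notin> P" for y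
  proof (rule ccontr)
    assume nonunit: "\<not> (\<exists>z \<in> C. y \<otimes> z \<ominus> \<one> \<in> P)"
    have [simp]: "y \<in> carrier S"
      using L_carrier[OF C(1)] y by blast
    have yB: "y \<notin> B"
      using inverse_mod[OF la _ y(2)] nonunit BC by blast
    have "y \<otimes> y \<notin> B"
    proof
      assume yy: "y \<otimes> y \<in> B"
      have "y \<otimes> y \<notin> P"
        using ramified[OF y(1) yB] contr by auto
      then obtain z where z: "z \<in> B" "y \<otimes> y \<otimes> z \<ominus> \<one> \<in> P"
        using inverse_mod[OF la yy] by blast
      have "y \<otimes> (y \<otimes> z) \<ominus> \<one> \<in> P"
        using z L_carrier[OF B z(1)] by (simp add: m_assoc)
      moreover have "y \<otimes> z \<in> C"
        using z BC y C by auto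
      ultimately show False
        using nonunit by blast
    qed
    let ?D = "adjoin B C (y \<otimes> y)"
    have yyC: "y \<otimes> y \<in> C"
      using y C by simp
    have D: "?D \<in> L" "B \<subseteq> ?D" "?D \<subseteq> C"
      using adjoin_multiples_L[OF B C(1) BC yyC] adjoin_base[OF B C(1), of "y \<otimes> y"]
        adjoin_least[OF C(1) BC order_refl yyC] by simp_all
    have "y \<otimes> y \<in> ?D"
      using B C by (intro adjoin_gen) auto
    then have "?D = C"
      using covers_D[OF cov D] \<open>y \<otimes> y \<notin> B\<close> by blast
    then have "y \<in> ?D"
      using y(1) by simp
    then obtain a c where ac: "a \<in> B" "c \<in> C" and e1: "y = a \<oplus> c \<otimes> (y \<otimes> y)"
      by (rule adjoinE)
    have [simp]: "a \<in> carrier S" "c \<in> carrier S"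
      using ac L_carrier[OF B] L_carrier[OF C(1)] by auto
    have "y \<otimes> (\<one> \<ominus> y \<otimes> c) = y \<ominus> c \<otimes> (y \<otimes> y)"
      by - (rule poly_eqI[of "[y,c]"], (rule poly_reify)+, simp_all add: poly_simps)
    also have "\<dots> = (a \<oplus> c \<otimes> (y \<otimes> y)) \<ominus> c \<otimes> (y \<otimes> y)"
      using e1 by simp
    also have "\<dots> = a"
      by - (rule poly_eqI[of "[a,y,c]"], (rule poly_reify)+, simp_all add: poly_simps)
    finally have ya: "y \<otimes> (\<one> \<ominus> y \<otimes> c) = a" .
    have aP: "a \<in> P"
    proof (rule ccontr)
      assume "a \<notin> P"
      then obtain z where z: "z \<in> B" "a \<otimes> z \<ominus> \<one> \<in> P"
        using inverse_mod[OF la ac(1)] by blast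
      have [simp]: "z \<in> carrier S"
        using z L_carrier[OF B] by blast
      have "y \<otimes> ((\<one> \<ominus> y \<otimes> c) \<otimes> z) = a \<otimes> z"
        unfolding ya[symmetric] by - (rule poly_eqI[of "[y,c,z]"], (rule poly_reify)+, simp_all add: poly_simps)
      then have "y \<otimes> ((\<one> \<ominus> y \<otimes> c) \<otimes> z) \<ominus> \<one> \<in> P"
        using z by simp
      moreover have "(\<one> \<ominus> y \<otimes> c) \<otimes> z \<in> C"
        using C BC y ac z by auto
      ultimately show False
        using nonunit by blast
    qed
    define e where "e = y \<otimes> c"
    have eC: "e \<in> C" and [simp]: "e \<in> carrier S"
      using y ac C by (simp_all add: e_def)
    have "e \<otimes> e \<ominus> e = \<ominus> (y \<otimes> (\<one> \<ominus> y \<otimes> c) \<otimes> c)"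
      unfolding e_def by - (rule poly_eqI[of "[y,c]"], (rule poly_reify)+, simp_all add: poly_simps)
    then have "e \<otimes> e \<ominus> e = \<ominus> (a \<otimes> c)"
      unfolding ya .
    then have ee: "e \<otimes> e \<ominus> e \<in> P"
      using cond[OF aP ac(2)] P_closed(5)[OF la] by simp
    have "e \<in> B"
      using decomposed[OF eC _ ee] contr by auto
    then consider "e \<in> P" | "\<one> \<ominus> e \<in> P"
      using P_prime_idem[OF la _ ee] by blast
    then show False
    proof cases
      case 1
      have "(\<one> \<ominus> e) \<otimes> y = a"
        unfolding ya[symmetric] e_def by - (rule poly_eqI[of "[y,c]"], (rule poly_reify)+, simp_all add: poly_simps)
      then have "(\<one> \<ominus> e) \<otimes> y \<in> B"
        using ac(1) by simp
      then have "y \<in> B"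
        using divide_ring[OF la subsetD[OF CW y(1)], of "\<one> \<ominus> e" B] P_sum_one[OF la 1] B by blast
      then show False
        using yB by simp
    next
      case 2
      have "y \<otimes> c \<ominus> \<one> = \<ominus> (\<one> \<ominus> e)"
        unfolding e_def by - (rule poly_eqI[of "[y,c]"], (rule poly_reify)+, simp_all add: poly_simps)
      then have "y \<otimes> c \<ominus> \<one> \<in> P"
        using P_closed(5)[OF la 2] by simp
      then show False
        using nonunit ac by blast
    qed
  qed
  then have thesis
    by (rule inert)
  then show False
    using contr by simp
qed

section \<open>Steps towards the t-closure\<close>

text \<open>
  The elements that prevent \<open>B\<close> from being t-closed.
\<close>
definition t_step :: "'a set \<Rightarrow> 'a \<Rightarrow> bool" where
  "t_step B b \<longleftrightarrow> b \<in> carrier S \<and> b \<notin> B \<and>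
     (\<exists>r \<in> B. b \<otimes> b \<ominus> r \<otimes> b \<in> B \<and> (b \<otimes> b \<ominus> r \<otimes> b) \<otimes> b \<in> B)"

lemma quadratic_adjoin_L:
  assumes "B \<in> L" "b \<in> carrier S" "r \<in> B" "b \<otimes> b \<ominus> r \<otimes> b \<in> B"
  shows "adjoin B B b \<in> L"
proof (rule simple_adjoin_L[OF assms(1,2)])
  have [simp]: "r \<in> carrier S"
    using assms L_carrier by blast
  show "b \<otimes> b \<in> adjoin B B b"
  proof (rule adjoinI)
    show "b \<otimes> b = (b \<otimes> b \<ominus> r \<otimes> b) \<oplus> r \<otimes> b"
      using assms(2) by - (rule poly_eqI[of "[b,r]"], (rule poly_reify)+, simp_all add: poly_simps)
  qed (use assms in auto)
qed

text \<open>
  Among the rings \<open>B + B q\<close> with \<open>q \<in> Q\<close> take a minimal one. If \<open>a q \<notin> B\<close> for some \<open>a \<in> I\<close>, then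
  \<open>B + B a q\<close> is the same ring, so \<open>q = \<alpha> + \<beta> a q\<close> and \<open>(1 - \<beta> a) q \<in> B\<close>, whence \<open>q \<in> B\<close>.
\<close>
lemma shrink:
  assumes B: "B \<in> L" and I: "sub_ideal I B" and Q: "Q \<subseteq> carrier S" "q0 \<in> Q"
    and ring: "\<And>q. q \<in> Q \<Longrightarrow> adjoin B B q \<in> L"
    and new: "\<And>q. q \<in> Q \<Longrightarrow> q \<notin> B"
    and scale: "\<And>a q. a \<in> I \<Longrightarrow> q \<in> Q \<Longrightarrow> a \<otimes> q \<notin> B \<Longrightarrow> a \<otimes> q \<in> Q"
    and div: "\<And>a q. a \<in> I \<Longrightarrow> q \<in> Q \<Longrightarrow> (\<one> \<ominus> a) \<otimes> q \<in> B \<Longrightarrow> q \<in> B"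
  obtains q where "q \<in> Q" "\<And>a. a \<in> I \<Longrightarrow> a \<otimes> q \<in> B"
proof -
  let ?Q = "adjoin B B ` Q"
  have sub: "?Q \<subseteq> L" and ne: "adjoin B B q0 \<in> ?Q"
    using ring Q by auto
  show thesis
  proof (rule obtain_minimal[OF sub ne])
    fix Y assume Y: "Y \<in> ?Q" and min: "\<And>Z. Z \<in> ?Q \<Longrightarrow> Z \<subseteq> Y \<Longrightarrow> Z = Y"
    obtain q where q: "q \<in> Q" "Y = adjoin B B q"
      using Y by blast
    have [simp]: "q \<in> carrier S"
      using q Q by blast
    have "a \<otimes> q \<in> B" if a: "a \<in> I" for a
    proof (rule ccontr)
      assume n: "a \<otimes> q \<notin> B"
      then have aq: "a \<otimes> q \<in> Q"
        using scale a q by blast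
      have aB: "a \<in> B"
        using sub_ideal_closed(2)[OF I B a] .
      then have [simp]: "a \<in> carrier S"
        using L_carrier[OF B] by blast
      have "adjoin B B (a \<otimes> q) \<subseteq> Y"
        unfolding q(2)
      proof (rule adjoin_least[OF ring[OF q(1)] adjoin_base[OF B B] adjoin_base[OF B B]])
        show "a \<otimes> q \<in> adjoin B B q"
          using aB B by (intro adjoinI[of \<zero> B a]) auto
      qed auto
      then have "adjoin B B (a \<otimes> q) = adjoin B B q"
        using min[of "adjoin B B (a \<otimes> q)"] aq q(2) by blast
      then have "q \<in> adjoin B B (a \<otimes> q)"
        using adjoin_gen[OF B B, of q] by simp
      then obtain \<alpha> \<beta> where *: "\<alpha> \<in> B" "\<beta> \<in> B" "q = \<alpha> \<oplus> \<beta> \<otimes> (a \<otimes> q)"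
        by (rule adjoinE)
      have [simp]: "\<alpha> \<in> carrier S" "\<beta> \<in> carrier S"
        using * L_carrier[OF B] by auto
      have "(\<one> \<ominus> \<beta> \<otimes> a) \<otimes> q = q \<ominus> \<beta> \<otimes> (a \<otimes> q)"
        by - (rule poly_eqI[of "[q,a,\<beta>]"], (rule poly_reify)+, simp_all add: poly_simps)
      also have "\<dots> = (\<alpha> \<oplus> \<beta> \<otimes> (a \<otimes> q)) \<ominus> \<beta> \<otimes> (a \<otimes> q)"
        using *(3) by simp
      also have "\<dots> = \<alpha>"
        by - (rule poly_eqI[of "[q,a,\<alpha>,\<beta>]"], (rule poly_reify)+, simp_all add: poly_simps)
      finally have "q \<in> B"
        using div[OF sub_ideal_closed(6)[OF I B *(2) a] q(1)] *(1) by simp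
      then show False
        using new q by blast
    qed
    then show thesis
      using that[OF q(1)] by blast
  qed
qed

text \<open>
  If \<open>q\<close> is a step with parameter \<open>r\<close>, then \<open>a q\<close> is a step with parameter \<open>a r\<close>.
\<close>
lemma t_step_scale:
  assumes B: "B \<in> L" and a: "a \<in> B" and q: "t_step B q" and n: "a \<otimes> q \<notin> B"
  shows "t_step B (a \<otimes> q)"
proof -
  obtain r where r: "r \<in> B" "q \<otimes> q \<ominus> r \<otimes> q \<in> B" "(q \<otimes> q \<ominus> r \<otimes> q) \<otimes> q \<in> B" and [simp]: "q \<in> carrier S"
    using q by (auto simp: t_step_def)
  have [simp]: "a \<in> carrier S" "r \<in> carrier S"
    using a r L_carrier[OF B] by auto
  have e: "(a \<otimes> q) \<otimes> (a \<otimes> q) \<ominus> (a \<otimes> r) \<otimes> (a \<otimes> q) = a \<otimes> a \<otimes> (q \<otimes> q \<ominus> r \<otimes> q)"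
    by - (rule poly_eqI[of "[a,q,r]"], (rule poly_reify)+, simp_all add: poly_simps)
  have e2: "a \<otimes> a \<otimes> (q \<otimes> q \<ominus> r \<otimes> q) \<otimes> (a \<otimes> q) = a \<otimes> a \<otimes> a \<otimes> ((q \<otimes> q \<ominus> r \<otimes> q) \<otimes> q)"
    by - (rule poly_eqI[of "[a,q,r]"], (rule poly_reify)+, simp_all add: poly_simps)
  show ?thesis
    unfolding t_step_def
    by (intro conjI bexI[of _ "a \<otimes> r"]) (use n r a B in \<open>simp_all add: e e2\<close>)
qed

text \<open>
  After shrinking, \<open>P q \<subseteq> P\<close> and \<open>c = q\<^sup>2 - r q\<close> lies in \<open>P\<close>. If \<open>r \<in> P\<close>, then \<open>q\<^sup>2 \<in> P\<close>; otherwise \<open>q / r\<close>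
  is idempotent modulo \<open>P\<close>.
\<close>
lemma t_step_types:
  assumes la: "local_at B P W" and b0: "b0 \<in> W" "t_step B b0"
  obtains b where "b \<in> W" "b \<notin> B" "\<And>p. p \<in> P \<Longrightarrow> p \<otimes> b \<in> P" "b \<otimes> b \<in> P \<or> b \<otimes> b \<ominus> b \<in> P"
proof -
  note B = B_L[OF la] and W = W_L[OF la] and BW = B_W[OF la]
  obtain q where q: "q \<in> {b \<in> W. t_step B b}" "\<And>a. a \<in> P \<Longrightarrow> a \<otimes> q \<in> B"
  proof (rule shrink[OF B P_B[OF la], of "{b \<in> W. t_step B b}" b0])
    show "{b \<in> W. t_step B b} \<subseteq> carrier S" "b0 \<in> {b \<in> W. t_step B b}"
      using b0 by (auto simp: t_step_def)
    fix q assume q: "q \<in> {b \<in> W. t_step B b}"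
    then obtain r where r: "r \<in> B" "q \<otimes> q \<ominus> r \<otimes> q \<in> B" "(q \<otimes> q \<ominus> r \<otimes> q) \<otimes> q \<in> B"
      and qW: "q \<in> W" and [simp]: "q \<in> carrier S" and qB: "q \<notin> B"
      by (auto simp: t_step_def)
    show "adjoin B B q \<in> L"
      using quadratic_adjoin_L[OF B _ r(1,2)] by simp
    show "q \<notin> B"
      by (fact qB)
    fix a assume a: "a \<in> P"
    have aB: "a \<in> B"
      using P_closed(2)[OF la a] .
    have [simp]: "a \<in> carrier S" "r \<in> carrier S"
      using aB r L_carrier[OF B] by auto
    show "q \<in> B" if "(\<one> \<ominus> a) \<otimes> q \<in> B"
      using divide_ring[OF la qW, of "\<one> \<ominus> a" B] P_sum_one[OF la a] that B by auto
    show "a \<otimes> q \<in> {b \<in> W. t_step B b}" if n: "a \<otimes> q \<notin> B"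
      using t_step_scale[OF B aB _ n] q aB BW W by auto
  qed blast
  obtain r where r: "r \<in> B" "q \<otimes> q \<ominus> r \<otimes> q \<in> B" "(q \<otimes> q \<ominus> r \<otimes> q) \<otimes> q \<in> B"
    and qW: "q \<in> W" and [simp]: "q \<in> carrier S" and qB: "q \<notin> B"
    using q(1) by (auto simp: t_step_def)
  have [simp]: "r \<in> carrier S"
    using r L_carrier[OF B] by auto
  define c where "c = q \<otimes> q \<ominus> r \<otimes> q"
  have cB: "c \<in> B" "c \<otimes> q \<in> B" and [simp]: "c \<in> carrier S"
    using r by (simp_all add: c_def)
  have cP: "c \<in> P"
    using divide_ring[OF la qW cB(1) _ B _ cB(2)] qB by blast
  have Pq: "p \<otimes> q \<in> P" if p: "p \<in> P" for p
  proof (rule ccontr)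
    assume n: "p \<otimes> q \<notin> P"
    have pB: "p \<in> B" and [simp]: "p \<in> carrier S"
      using P_closed(2)[OF la p] P_carrier[OF la p] by auto
    have "p \<otimes> q \<otimes> q = r \<otimes> (p \<otimes> q) \<oplus> p \<otimes> c"
      unfolding c_def by - (rule poly_eqI[of "[p,q,r]"], (rule poly_reify)+, simp_all add: poly_simps)
    then have "p \<otimes> q \<otimes> q \<in> B"
      using q(2)[OF p] r pB cB B by simp
    then show False
      using divide_ring[OF la qW q(2)[OF p] n B] qB by blast
  qed
  show thesis
  proof (cases "r \<in> P")
    case True
    have "q \<otimes> q = r \<otimes> q \<oplus> c"
      unfolding c_def by - (rule poly_eqI[of "[q,r]"], (rule poly_reify)+, simp_all add: poly_simps)
    then have "q \<otimes> q \<in> P"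
      using Pq[OF True] cP P_closed(3)[OF la] by simp
    then show thesis
      using that[of q] qW qB Pq by blast
  next
    case False
    then obtain z where z: "z \<in> B" "r \<otimes> z \<ominus> \<one> \<in> P"
      using inverse_mod[OF la r(1)] by blast
    have [simp]: "z \<in> carrier S"
      using z L_carrier[OF B] by auto
    have 1: "z \<otimes> q \<notin> B"
    proof
      assume zq: "z \<otimes> q \<in> B"
      have "q = r \<otimes> (z \<otimes> q) \<ominus> (r \<otimes> z \<ominus> \<one>) \<otimes> q"
        by - (rule poly_eqI[of "[q,r,z]"], (rule poly_reify)+, simp_all add: poly_simps)
      also have "\<dots> \<in> B"
        using zq r B P_closed(2)[OF la Pq[OF z(2)]] by simp
      finally show False
        using qB by simp
    qed
    have "(z \<otimes> q) \<otimes> (z \<otimes> q) \<ominus> z \<otimes> q = z \<otimes> ((r \<otimes> z \<ominus> \<one>) \<otimes> q) \<oplus> z \<otimes> z \<otimes> c"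
      unfolding c_def by - (rule poly_eqI[of "[q,r,z]"], (rule poly_reify)+, simp_all add: poly_simps)
    also have "\<dots> \<in> P"
      using Pq[OF z(2)] z(1) cP B P_closed[OF la] by simp
    finally have 2: "(z \<otimes> q) \<otimes> (z \<otimes> q) \<ominus> z \<otimes> q \<in> P" .
    have 3: "p \<otimes> (z \<otimes> q) \<in> P" if p: "p \<in> P" for p
    proof -
      have "p \<otimes> (z \<otimes> q) = z \<otimes> (p \<otimes> q)"
        using P_carrier[OF la p] by (simp add: m_ac)
      then show ?thesis
        using Pq[OF p] z(1) P_closed(6)[OF la] by simp
    qed
    have "z \<otimes> q \<in> W"
      using z BW qW W by auto
    then show thesis
      using that[of "z \<otimes> q"] 1 2 3 by blast
  qed
qed

text \<open>
  Let \<open>k \<subset> K\<close> be the residue fields of \<open>B \<subset> C\<close> and let \<open>b\<close> be a ramified or decomposed step.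
  In the ramified case \<open>b\<close> and \<open>x b\<close>, with \<open>x \<in> C - B\<close>, are an independent pair. In the decomposed case
  the diagonal \<open>C\<close>, that is \<open>K\<close> in \<open>K \<times> K\<close>, is contained in the compositum of \<open>B + C b\<close> and
  \<open>B + C (1 - b)\<close>, that is of \<open>K \<times> k\<close> and \<open>k \<times> K\<close>, but meets both of them in \<open>B\<close>.
\<close>
lemma inert_exclusion:
  assumes la: "local_at B P W" and cov: "covers C B" and CW: "C \<subseteq> W"
    and inert: "\<And>y. y \<in> C \<Longrightarrow> y \<notin> P \<Longrightarrow> \<exists>z \<in> C. y \<otimes> z \<ominus> \<one> \<in> P"
    and b: "b \<in> W" "b \<notin> C" and Pb: "\<And>p. p \<in> P \<Longrightarrow> p \<otimes> b \<in> P"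
    and type: "b \<otimes> b \<in> P \<or> b \<otimes> b \<ominus> b \<in> P"
  shows False
proof -
  note B = B_L[OF la] and W = W_L[OF la] and BW = B_W[OF la] and Pc = P_closed[OF la]
  have C: "C \<in> L" "B \<subset> C"
    using cov by (auto simp: covers_def)
  have BC: "y \<in> B \<Longrightarrow> y \<in> C" for y
    using C by blast
  note Cc = L_carrier[OF C(1)] and Bc = L_carrier[OF B] and Pcar = P_carrier[OF la]
  have [simp]: "b \<in> carrier S"
    using b W_carrier[OF la] by blast
  have cond: "f \<in> P \<Longrightarrow> c \<in> C \<Longrightarrow> f \<otimes> c \<in> P" for f c
    using cover_conductor[OF la cov CW] .
  have cond': "f \<in> P \<Longrightarrow> c \<in> C \<Longrightarrow> c \<otimes> f \<in> P" for f c
    using cond[of f c] m_comm[OF Pcar[of f] Cc[of c]] by simp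
  \<comment> \<open>A unit \<open>w\<close> modulo \<open>P\<close> cannot send \<open>d \<notin> C\<close> into \<open>C\<close>.\<close>
  have unit_mult: "w \<in> P" if w: "w \<in> C" and wb: "w \<otimes> d \<in> C" and d: "d \<in> carrier S" "d \<notin> C"
    and Pd: "\<And>p. p \<in> P \<Longrightarrow> p \<otimes> d \<in> P" for w d
  proof (rule ccontr)
    assume "w \<notin> P"
    then obtain z where z: "z \<in> C" "w \<otimes> z \<ominus> \<one> \<in> P"
      using inert[OF w] by blast
    have "d = z \<otimes> (w \<otimes> d) \<ominus> (w \<otimes> z \<ominus> \<one>) \<otimes> d"
      using Cc[OF w] Cc[OF z(1)] d(1) by - (rule poly_eqI[of "[d,w,z]"], (rule poly_reify)+, simp_all add: poly_simps)
    also have "\<dots> \<in> C"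
      using z wb C BC Pc(2)[OF Pd[OF z(2)]] by simp
    finally show False
      using d(2) by simp
  qed
  from type show False
  proof
    assume bb: "b \<otimes> b \<in> P"
    obtain x where x: "x \<in> C" "x \<notin> B"
      using C by blast
    have [simp]: "x \<in> carrier S"
      using Cc x by blast
    have ring: "adjoin B B (y \<otimes> b) \<in> L" if y: "y \<in> C" for y
    proof (rule quadratic_adjoin_L[OF B, of _ \<zero>])
      have "y \<otimes> b \<otimes> (y \<otimes> b) \<ominus> \<zero> \<otimes> (y \<otimes> b) = y \<otimes> (y \<otimes> (b \<otimes> b))"
        using Cc[OF y] by - (rule poly_eqI[of "[y,b]"], (rule poly_reify)+, simp_all add: poly_simps)
      then show "y \<otimes> b \<otimes> (y \<otimes> b) \<ominus> \<zero> \<otimes> (y \<otimes> b) \<in> B"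
        using Pc(2) cond'[OF cond'[OF bb y] y] by simp
    qed (use Cc[OF y] B in auto)
    show False
    proof (rule no_independent_pair[OF B, of b "x \<otimes> b" P])
      show "adjoin B B b \<in> L" "adjoin B B (x \<otimes> b) \<in> L"
        using ring[of \<one>] ring[OF x(1)] C by auto
      have "b \<oplus> x \<otimes> b = (\<one> \<oplus> x) \<otimes> b"
        by - (rule poly_eqI[of "[b,x]"], (rule poly_reify)+, simp_all add: poly_simps)
      then show "adjoin B B (b \<oplus> x \<otimes> b) \<in> L"
        using ring[of "\<one> \<oplus> x"] x C by simp
      show "\<one> \<notin> P"
        using one_P[OF la] .
      show "p \<otimes> b \<in> B" "p \<otimes> (x \<otimes> b) \<in> B" if p: "p \<in> P" for p
      proof -
        show "p \<otimes> b \<in> B"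
          using Pc(2) Pb[OF p] by blast
        have "p \<otimes> (x \<otimes> b) = x \<otimes> (p \<otimes> b)"
          using Pcar[OF p] by (simp add: m_ac)
        then show "p \<otimes> (x \<otimes> b) \<in> B"
          using Pc(2) cond'[OF Pb[OF p] x(1)] by simp
      qed
      fix \<beta> \<gamma> assume *: "\<beta> \<in> B" "\<gamma> \<in> B" "\<beta> \<otimes> b \<oplus> \<gamma> \<otimes> (x \<otimes> b) \<in> B"
      have [simp]: "\<beta> \<in> carrier S" "\<gamma> \<in> carrier S"
        using * Bc by auto
      let ?w = "\<beta> \<oplus> \<gamma> \<otimes> x"
      have "?w \<otimes> b = \<beta> \<otimes> b \<oplus> \<gamma> \<otimes> (x \<otimes> b)"
        by - (rule poly_eqI[of "[\<beta>,\<gamma>,x,b]"], (rule poly_reify)+, simp_all add: poly_simps)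
      then have wP: "?w \<in> P"
        using unit_mult[of ?w b] * x BC C b Pb by simp
      have "?w \<ominus> \<beta> = \<gamma> \<otimes> x"
        by - (rule poly_eqI[of "[\<beta>,\<gamma>,x]"], (rule poly_reify)+, simp_all add: poly_simps)
      then have "\<gamma> \<otimes> x \<in> B"
        using L_closed(6)[OF B Pc(2)[OF wP] *(1)] by (simp only:)
      then have \<gamma>: "\<gamma> \<in> P"
        using divide_ring[OF la _ *(2) _ B, of x] x CW by blast
      have "\<beta> = ?w \<ominus> \<gamma> \<otimes> x"
        by - (rule poly_eqI[of "[\<beta>,\<gamma>,x]"], (rule poly_reify)+, simp_all add: poly_simps)
      also have "\<dots> \<in> P"
        using wP cond[OF \<gamma> x(1)] by (rule Pc(4))
      finally show "\<beta> \<in> P \<and> \<gamma> \<in> P"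
        using \<gamma> by simp
    qed simp_all
  next
    assume bb: "b \<otimes> b \<ominus> b \<in> P"
    have half: "adjoin B C d \<in> L \<and> C \<inter> adjoin B C d \<subseteq> B"
      if d: "d \<in> carrier S" "d \<notin> C" "d \<otimes> d \<ominus> d \<in> P" and Pd: "\<And>p. p \<in> P \<Longrightarrow> p \<otimes> d \<in> P" for d
    proof
      show "adjoin B C d \<in> L"
      proof (rule adjoin_L[OF B C(1)])
        fix c assume c: "c \<in> C"
        show "c \<otimes> (d \<otimes> d) \<in> adjoin B C d"
        proof (rule adjoinI)
          show "c \<otimes> (d \<otimes> d) = c \<otimes> (d \<otimes> d \<ominus> d) \<oplus> c \<otimes> d"
            using Cc[OF c] d(1) by - (rule poly_eqI[of "[c,d]"], (rule poly_reify)+, simp_all add: poly_simps)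
          show "c \<otimes> (d \<otimes> d \<ominus> d) \<in> B"
            using cond'[OF d(3) c] Pc(2) by blast
        qed (fact c)
      qed (use C d in auto)
      show "C \<inter> adjoin B C d \<subseteq> B"
      proof
        fix y assume "y \<in> C \<inter> adjoin B C d"
        then obtain a c where y: "y \<in> C" "a \<in> B" "c \<in> C" "y = a \<oplus> c \<otimes> d"
          by (auto simp: adjoin_def)
        have [simp]: "a \<in> carrier S" "c \<in> carrier S" "d \<in> carrier S"
          using y Bc Cc d by auto
        have "(a \<oplus> c \<otimes> d) \<ominus> a = c \<otimes> d"
          by - (rule poly_eqI[of "[a,c,d]"], (rule poly_reify)+, simp_all add: poly_simps)
        then have "c \<otimes> d \<in> C"
          using L_closed(6)[OF C(1) y(1) BC[OF y(2)]] y(4) by simp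
        then have "c \<in> P"
          using unit_mult[OF y(3)] d Pd by blast
        then show "y \<in> B"
          unfolding y(4) using Pc(2) Pd y(2) B by simp
      qed
    qed
    let ?b = "\<one> \<ominus> b"
    have D: "adjoin B C b \<in> L \<and> C \<inter> adjoin B C b \<subseteq> B"
      using half[of b] b bb Pb by simp
    have F: "adjoin B C ?b \<in> L \<and> C \<inter> adjoin B C ?b \<subseteq> B"
    proof (rule half)
      show "?b \<notin> C"
      proof
        assume "?b \<in> C"
        then have "\<one> \<ominus> ?b \<in> C"
          using C by simp
        moreover have "\<one> \<ominus> ?b = b"
          by - (rule poly_eqI[of "[b]"], (rule poly_reify)+, simp_all add: poly_simps)
        ultimately show False
          using b by simp
      qed
      have "?b \<otimes> ?b \<ominus> ?b = b \<otimes> b \<ominus> b"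
        by - (rule poly_eqI[of "[b]"], (rule poly_reify)+, simp_all add: poly_simps)
      then show "?b \<otimes> ?b \<ominus> ?b \<in> P"
        using bb by simp
      show "p \<otimes> ?b \<in> P" if p: "p \<in> P" for p
      proof -
        have "p \<otimes> ?b = p \<ominus> p \<otimes> b"
          using Pcar[OF p] by - (rule poly_eqI[of "[p,b]"], (rule poly_reify)+, simp_all add: poly_simps)
        then show ?thesis
          using Pc(4)[OF p Pb[OF p]] by simp
      qed
    qed simp
    have "C \<subseteq> B"
    proof (rule pairwise_trivial_meet[OF B])
      show "C \<subseteq> compositum S (adjoin B C b) (adjoin B C ?b)"
      proof
        fix c assume c: "c \<in> C"
        have [simp]: "c \<in> carrier S"
          using Cc[OF c] .
        have "c \<otimes> b \<in> adjoin B C b" "c \<otimes> ?b \<in> adjoin B C ?b"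
          using c B C by (auto intro: adjoin_scalar)
        then have "c \<otimes> b \<oplus> c \<otimes> ?b \<in> compositum S (adjoin B C b) (adjoin B C ?b)"
          using D F compositum_upper[of "adjoin B C b" "adjoin B C ?b"] by (intro L_closed(4)) auto
        moreover have "c = c \<otimes> b \<oplus> c \<otimes> ?b"
          by - (rule poly_eqI[of "[c,b]"], (rule poly_reify)+, simp_all add: poly_simps)
        ultimately show "c \<in> compositum S (adjoin B C b) (adjoin B C ?b)"
          by simp
      qed
    qed (use D F C in auto)
    then show False
      using C by blast
  qed
qed

text \<open>
  Otherwise take a minimal extension \<open>C\<close> of \<open>B = H \<inter> T\<close> inside \<open>H\<close>. It is inert, because a ramified or
  decomposed generator would belong to the t-closed ring \<open>T\<close>. But \<open>T\<close> contains a ramified or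
  decomposed step over \<open>B\<close>.
\<close>
lemma comparable:
  assumes la: "local_at B P W" and H: "H \<in> L" "H \<subseteq> W" and T: "T \<in> L" "T \<subseteq> W" and B_eq: "B = H \<inter> T"
    and closed: "\<And>b r. b \<in> carrier S \<Longrightarrow> r \<in> T \<Longrightarrow> b \<otimes> b \<ominus> r \<otimes> b \<in> T \<Longrightarrow>
      (b \<otimes> b \<ominus> r \<otimes> b) \<otimes> b \<in> T \<Longrightarrow> b \<in> T"
    and reach: "B \<noteq> T \<Longrightarrow> \<exists>b \<in> T. t_step B b"
  shows "H \<subseteq> T \<or> T \<subseteq> H"
proof (rule ccontr)
  assume "\<not> ?thesis"
  then have "B \<subset> H" "B \<noteq> T"
    using B_eq by blast+
  then obtain C where cov: "covers C B" and CH: "C \<subseteq> H"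
    using obtain_cover[OF H(1)] by blast
  then have CW: "C \<subseteq> W"
    using H by blast
  have C: "C \<in> L" "B \<subset> C"
    using cov by (auto simp: covers_def)
  note cond = cover_conductor[OF la cov CW]
  have PT: "p \<in> P \<Longrightarrow> p \<in> T" for p
    using P_closed(2)[OF la] B_eq by blast
  have CT: "c \<in> C \<Longrightarrow> c \<in> T \<Longrightarrow> c \<in> B" for c
    using CH B_eq by blast
  from la cov CW show False
  proof (cases rule: cover_trichotomy)
    case (ramified x)
    have [simp]: "x \<in> carrier S"
      using ramified L_carrier[OF C(1)] by blast
    have e: "x \<otimes> x \<ominus> \<zero> \<otimes> x = x \<otimes> x"
      by - (rule poly_eqI[of "[x]"], (rule poly_reify)+, simp_all add: poly_simps)
    have "x \<in> T"
      by (rule closed[of x \<zero>]) (use ramified cond[OF ramified(3,1)] PT T in \<open>simp_all add: e\<close>)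
    then show False
      using CT ramified by blast
  next
    case (decomposed x)
    have [simp]: "x \<in> carrier S"
      using decomposed L_carrier[OF C(1)] by blast
    have e: "x \<otimes> x \<ominus> \<one> \<otimes> x = x \<otimes> x \<ominus> x"
      by - (rule poly_eqI[of "[x]"], (rule poly_reify)+, simp_all add: poly_simps)
    have "x \<in> T"
      by (rule closed[of x \<one>]) (use decomposed cond[OF decomposed(3,1)] PT T in \<open>simp_all add: e\<close>)
    then show False
      using CT decomposed by blast
  next
    case inert
    obtain b0 where b0: "b0 \<in> T" "t_step B b0"
      using reach \<open>B \<noteq> T\<close> by blast
    have "local_at B P T"
      using local_at_mono[OF la T(1) _ T(2)] B_eq by blast
    then obtain b where b: "b \<in> T" "b \<notin> B" "\<And>p. p \<in> P \<Longrightarrow> p \<otimes> b \<in> P" "b \<otimes> b \<in> P \<or> b \<otimes> b \<ominus> b \<in> P"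
      using t_step_types[OF _ b0] by blast
    have "b \<in> W" "b \<notin> C"
      using b T CT by blast+
    then show False
      using inert_exclusion[OF la cov CW inert _ _ b(3,4)] by blast
  qed
qed

section \<open>Ideals of intermediate rings\<close>

lemma L_ring: "B \<in> L \<Longrightarrow> ring (S\<lparr>carrier := B\<rparr>)"
  using subring_is_ring L_iff by blast

lemma L_cring: "B \<in> L \<Longrightarrow> cring (S\<lparr>carrier := B\<rparr>)"
  using subcringI' subcring_iff le_S L_iff by metis

lemma L_a_inv: "B \<in> L \<Longrightarrow> x \<in> B \<Longrightarrow> a_inv (S\<lparr>carrier := B\<rparr>) x = \<ominus> x"
  using group.m_inv_consistent[OF add.group_axioms, of B x] L_iff[of B]
  by (simp add: a_inv_def subring_def)

lemma ideal_iff: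
  assumes B: "B \<in> L"
  shows "ideal P (S\<lparr>carrier := B\<rparr>) \<longleftrightarrow> sub_ideal P B"
proof
  assume P: "ideal P (S\<lparr>carrier := B\<rparr>)"
  note a = ideal.axioms(1)[OF P]
  show "sub_ideal P B"
    unfolding sub_ideal_def
    using additive_subgroup.a_subset[OF a] additive_subgroup.zero_closed[OF a]
      additive_subgroup.a_closed[OF a] ideal.I_l_closed[OF P] by simp
next
  assume P: "sub_ideal P B"
  note c = sub_ideal_closed[OF P B]
  show "ideal P (S\<lparr>carrier := B\<rparr>)"
  proof (rule idealI)
    show "ring (S\<lparr>carrier := B\<rparr>)"
      using L_ring[OF B] .
    show "subgroup P (add_monoid (S\<lparr>carrier := B\<rparr>))"
    proof (rule subgroup.intro)
      fix x assume "x \<in> P"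
      then show "inv\<^bsub>add_monoid (S\<lparr>carrier := B\<rparr>)\<^esub> x \<in> P"
        using L_a_inv[OF B c(2)] c(5) by (simp add: a_inv_def)
    qed (use c in auto)
  qed (use c in auto)
qed

lemma Max_ideals_iff:
  assumes B: "B \<in> L"
  shows "M \<in> Max_ideals (S\<lparr>carrier := B\<rparr>) \<longleftrightarrow>
    sub_ideal M B \<and> M \<noteq> B \<and> (\<forall>J. sub_ideal J B \<longrightarrow> M \<subseteq> J \<longrightarrow> J = M \<or> J = B)"
proof -
  have "sub_ideal J B \<Longrightarrow> J \<subseteq> B" for J
    by (simp add: sub_ideal_def)
  then show ?thesis
    using B by (auto simp: Max_ideals_def maximalideal_def maximalideal_axioms_def ideal_iff)
qed

lemma primeideal_iff:
  assumes B: "B \<in> L"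
  shows "primeideal P (S\<lparr>carrier := B\<rparr>) \<longleftrightarrow>
    sub_ideal P B \<and> P \<noteq> B \<and> (\<forall>a \<in> B. \<forall>b \<in> B. a \<otimes> b \<in> P \<longrightarrow> a \<in> P \<or> b \<in> P)"
  using L_cring[OF B] by (auto simp: primeideal_def primeideal_axioms_def ideal_iff[OF B])

lemma sub_ideal_one:
  assumes "B \<in> L" "sub_ideal P B" "\<one> \<in> P"
  shows "P = B"
proof -
  have "b \<in> P" if "b \<in> B" for b
    using sub_ideal_closed(6)[OF assms(2,1) that assms(3)] L_carrier[OF assms(1) that] by simp
  then show ?thesis
    using sub_ideal_closed(2)[OF assms(2,1)] by blast
qed

text \<open>
  Zorn's lemma.
\<close>
lemma ideal_le_maximal:
  assumes B: "B \<in> L" and I: "sub_ideal I B" "\<one> \<notin> I"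
  obtains M where "M \<in> Max_ideals (S\<lparr>carrier := B\<rparr>)" "I \<subseteq> M"
proof -
  let ?A = "{J. sub_ideal J B \<and> I \<subseteq> J \<and> \<one> \<notin> J}"
  have "\<exists>M \<in> ?A. \<forall>J \<in> ?A. M \<subseteq> J \<longrightarrow> J = M"
  proof (rule subset_Zorn_nonempty)
    show "?A \<noteq> {}"
      using I by blast
    fix C assume C: "C \<noteq> {}" "subset.chain ?A C"
    then have mem: "J \<in> C \<Longrightarrow> J \<in> ?A" for J
      by (auto simp: subset_chain_def)
    then have mem': "J \<in> C \<Longrightarrow> sub_ideal J B" for J
      by blast
    note cl = sub_ideal_closed[OF mem' B]
    have "sub_ideal (\<Union>C) B"
      unfolding sub_ideal_def
    proof (intro conjI ballI)
      show "\<Union>C \<subseteq> B"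
        using cl(2) by blast
      show "\<zero> \<in> \<Union>C"
        using cl(1) C(1) by blast
      fix p assume p: "p \<in> \<Union>C"
      then obtain J where J: "J \<in> C" "p \<in> J"
        by blast
      show "b \<otimes> p \<in> \<Union>C" if "b \<in> B" for b
        using cl(6)[OF J(1) that J(2)] J(1) by blast
      fix q assume "q \<in> \<Union>C"
      then obtain K where K: "K \<in> C" "q \<in> K"
        by blast
      obtain H where "H \<in> C" "p \<in> H" "q \<in> H"
        using C(2) J K unfolding subset_chain_def by blast
      then show "p \<oplus> q \<in> \<Union>C"
        using cl(3) by blast
    qed
    then show "\<Union>C \<in> ?A"
      using mem C(1) by blast
  qed
  then obtain M where M: "sub_ideal M B" "I \<subseteq> M" "\<one> \<notin> M"
    and max: "\<And>J. sub_ideal J B \<Longrightarrow> M \<subseteq> J \<Longrightarrow> \<one> \<notin> J \<Longrightarrow> J = M"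
    by auto
  have "M \<in> Max_ideals (S\<lparr>carrier := B\<rparr>)"
    unfolding Max_ideals_iff[OF B]
    using M max sub_ideal_one[OF B] B L_closed(2) by metis
  then show thesis
    using that M(2) by blast
qed

text \<open>
  The maximal ideal of \<open>R\<close>.
\<close>
definition m :: "'a set" where
  "m = (THE M. M \<in> Max_ideals (S\<lparr>carrier := R\<rparr>))"

lemma Max_ideals_R: "Max_ideals (S\<lparr>carrier := R\<rparr>) = {m}"
proof -
  have ex: "\<exists>!M. M \<in> Max_ideals (S\<lparr>carrier := R\<rparr>)"
    using loc by (simp add: local_ring_def)
  then show ?thesis
    using theI'[OF ex] by (auto simp: m_def)
qed

lemma m_ideal: "sub_ideal m R" and one_m: "\<one> \<notin> m"
proof -
  have "m \<in> Max_ideals (S\<lparr>carrier := R\<rparr>)"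
    using Max_ideals_R by simp
  then have *: "sub_ideal m R" "m \<noteq> R"
    by (simp_all add: Max_ideals_iff)
  then show "sub_ideal m R" "\<one> \<notin> m"
    using sub_ideal_one[OF R_L] by auto
qed

lemmas m_closed [simp] = sub_ideal_closed[OF m_ideal R_L]

lemma R_unit:
  assumes r: "r \<in> R" "r \<notin> m"
  shows "\<exists>z \<in> R. r \<otimes> z = \<one>"
proof (rule ccontr)
  assume n: "\<not> ?thesis"
  note c = L_carrier[OF R_L]
  let ?I = "(\<lambda>z. r \<otimes> z) ` R"
  have "sub_ideal ?I R"
    unfolding sub_ideal_def
  proof (intro conjI ballI)
    show "?I \<subseteq> R"
      using r by auto
    show "\<zero> \<in> ?I"
      using c[OF r(1)] by (intro image_eqI[of _ _ \<zero>]) auto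
    fix p assume "p \<in> ?I"
    then obtain y where y: "y \<in> R" "p = r \<otimes> y"
      by blast
    show "b \<otimes> p \<in> ?I" if "b \<in> R" for b
      unfolding y(2) using that y c[OF r(1)] c[OF y(1)] c[OF that]
      by (intro image_eqI[of _ _ "b \<otimes> y"]) (simp_all add: m_ac)
    fix q assume "q \<in> ?I"
    then obtain y' where y': "y' \<in> R" "q = r \<otimes> y'"
      by blast
    show "p \<oplus> q \<in> ?I"
      unfolding y(2) y'(2) using y(1) y'(1) c[OF r(1)] c[OF y(1)] c[OF y'(1)]
      by (intro image_eqI[of _ _ "y \<oplus> y'"]) (simp_all add: r_distr)
  qed
  moreover have "\<one> \<notin> ?I"
    using n by force
  ultimately obtain M where "M \<in> Max_ideals (S\<lparr>carrier := R\<rparr>)" "?I \<subseteq> M"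
    by (rule ideal_le_maximal[OF R_L])
  then have "r \<otimes> \<one> \<in> m"
    using Max_ideals_R R_L L_closed(2) by blast
  then show False
    using r c by simp
qed

section \<open>The closures of R\<close>

text \<open>
  The intersection of all rings with the property \<open>\<Phi>\<close> is the least one.
\<close>
lemma Least_ring:
  assumes "\<Phi> (carrier S)"
    and "\<And>Q. Q \<subseteq> L \<Longrightarrow> Q \<noteq> {} \<Longrightarrow> (\<And>B. B \<in> Q \<Longrightarrow> \<Phi> B) \<Longrightarrow> \<Phi> (\<Inter>Q)"
  shows "(LEAST B. B \<in> L \<and> \<Phi> B) \<in> L \<and> \<Phi> (LEAST B. B \<in> L \<and> \<Phi> B)
    \<and> (\<forall>B \<in> L. \<Phi> B \<longrightarrow> (LEAST B. B \<in> L \<and> \<Phi> B) \<subseteq> B)"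
proof -
  let ?Q = "{B \<in> L. \<Phi> B}"
  have ne: "?Q \<noteq> {}"
    using assms(1) S_L by blast
  have "subring (\<Inter>?Q) S"
    using ne by (intro subring_Inter) (auto simp: L_iff)
  then have 1: "\<Inter>?Q \<in> L"
    using R_le by (auto simp: L_iff)
  have 2: "\<Phi> (\<Inter>?Q)"
    using ne by (intro assms(2)) auto
  have "(LEAST B. B \<in> L \<and> \<Phi> B) = \<Inter>?Q"
    using 1 2 by (intro Least_equality) auto
  then show ?thesis
    using 1 2 by auto
qed

abbreviation N :: "'a set" where "N \<equiv> seminormalization S R"
abbreviation T :: "'a set" where "T \<equiv> t_closure S R"
abbreviation U :: "'a set" where "U \<equiv> u_closure S R"

lemma pow_two_three: "b \<in> carrier S \<Longrightarrow> b [^] (2::nat) = b \<otimes> b"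
  "b \<in> carrier S \<Longrightarrow> b [^] (3::nat) = b \<otimes> b \<otimes> b"
  by (simp_all add: numeral_2_eq_2 numeral_3_eq_3)

lemma t_closed_iff:
  assumes "B \<in> L"
  shows "t_closed S B \<longleftrightarrow> (\<forall>b \<in> carrier S. \<forall>r \<in> B. b \<otimes> b \<ominus> r \<otimes> b \<in> B \<longrightarrow>
    (b \<otimes> b \<ominus> r \<otimes> b) \<otimes> b \<in> B \<longrightarrow> b \<in> B)"
proof -
  have e: "b \<otimes> b \<otimes> b \<ominus> r \<otimes> (b \<otimes> b) = (b \<otimes> b \<ominus> r \<otimes> b) \<otimes> b" if "b \<in> carrier S" "r \<in> B" for b r
    using that(1) L_carrier[OF assms that(2)] by - (rule poly_eqI[of "[b,r]"], (rule poly_reify)+, simp_all add: poly_simps)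
  show ?thesis
    unfolding t_closed_def by (simp add: pow_two_three e cong: ball_cong)
qed

lemma u_closed_iff:
  "u_closed S B \<longleftrightarrow> (\<forall>b \<in> carrier S. b \<otimes> b \<ominus> b \<in> B \<longrightarrow> (b \<otimes> b \<ominus> b) \<otimes> b \<in> B \<longrightarrow> b \<in> B)"
proof -
  have e: "b \<otimes> b \<otimes> b \<ominus> b \<otimes> b = (b \<otimes> b \<ominus> b) \<otimes> b" if "b \<in> carrier S" for b
    using that by - (rule poly_eqI[of "[b]"], (rule poly_reify)+, simp_all add: poly_simps)
  show ?thesis
    unfolding u_closed_def by (simp add: pow_two_three e cong: ball_cong)
qed

lemma seminormal_iff:
  "seminormal S B \<longleftrightarrow> (\<forall>b \<in> carrier S. b \<otimes> b \<in> B \<longrightarrow> b \<otimes> b \<otimes> b \<in> B \<longrightarrow> b \<in> B)"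
  unfolding seminormal_def by (simp add: pow_two_three cong: ball_cong)

lemma T_Least: "T \<in> L \<and> t_closed S T \<and> (\<forall>B \<in> L. t_closed S B \<longrightarrow> T \<subseteq> B)"
  unfolding t_closure_def
proof (rule Least_ring)
  show "t_closed S (carrier S)"
    by (simp add: t_closed_iff)
  fix Q assume "Q \<subseteq> L" "Q \<noteq> {}" "\<And>B. B \<in> Q \<Longrightarrow> t_closed S B"
  then show "t_closed S (\<Inter>Q)"
    unfolding t_closed_def by blast
qed

lemma U_Least: "U \<in> L \<and> u_closed S U \<and> (\<forall>B \<in> L. u_closed S B \<longrightarrow> U \<subseteq> B)"
  unfolding u_closure_def
proof (rule Least_ring)
  show "u_closed S (carrier S)"
    by (simp add: u_closed_iff)
  fix Q assume "Q \<subseteq> L" "Q \<noteq> {}" "\<And>B. B \<in> Q \<Longrightarrow> u_closed S B"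
  then show "u_closed S (\<Inter>Q)"
    unfolding u_closed_def by blast
qed

lemma N_Least: "N \<in> L \<and> seminormal S N \<and> (\<forall>B \<in> L. seminormal S B \<longrightarrow> N \<subseteq> B)"
  unfolding seminormalization_def
proof (rule Least_ring)
  show "seminormal S (carrier S)"
    by (simp add: seminormal_iff)
  fix Q assume "Q \<subseteq> L" "Q \<noteq> {}" "\<And>B. B \<in> Q \<Longrightarrow> seminormal S B"
  then show "seminormal S (\<Inter>Q)"
    unfolding seminormal_def by blast
qed

lemma N_L [simp]: "N \<in> L" and T_L [simp]: "T \<in> L" and U_L [simp]: "U \<in> L"
  using N_Least T_Least U_Least by auto

lemma T_closed:
  "b \<in> carrier S \<Longrightarrow> r \<in> T \<Longrightarrow> b \<otimes> b \<ominus> r \<otimes> b \<in> T \<Longrightarrow> (b \<otimes> b \<ominus> r \<otimes> b) \<otimes> b \<in> T \<Longrightarrow> b \<in> T"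
  using T_Least t_closed_iff[OF T_L] by blast

lemma N_closed: "b \<in> carrier S \<Longrightarrow> b \<otimes> b \<in> N \<Longrightarrow> b \<otimes> b \<otimes> b \<in> N \<Longrightarrow> b \<in> N"
  using N_Least seminormal_iff by blast

lemma t_closed_seminormal: "B \<in> L \<Longrightarrow> t_closed S B \<Longrightarrow> seminormal S B"
  unfolding seminormal_iff
proof (intro ballI impI)
  fix b assume "B \<in> L" "t_closed S B" and b: "b \<in> carrier S" "b \<otimes> b \<in> B" "b \<otimes> b \<otimes> b \<in> B"
  moreover have "b \<otimes> b \<ominus> \<zero> \<otimes> b = b \<otimes> b"
    using b(1) by - (rule poly_eqI[of "[b]"], (rule poly_reify)+, simp_all add: poly_simps)
  ultimately show "b \<in> B"
    using t_closed_iff[of B] L_closed(1)[of B] by metis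
qed

lemma t_closed_u_closed: "B \<in> L \<Longrightarrow> t_closed S B \<Longrightarrow> u_closed S B"
  unfolding u_closed_iff
proof (intro ballI impI)
  fix b assume "B \<in> L" "t_closed S B" and b: "b \<in> carrier S" "b \<otimes> b \<ominus> b \<in> B" "(b \<otimes> b \<ominus> b) \<otimes> b \<in> B"
  moreover have "b \<otimes> b \<ominus> \<one> \<otimes> b = b \<otimes> b \<ominus> b"
    using b(1) by simp
  ultimately show "b \<in> B"
    using t_closed_iff[of B] L_closed(2)[of B] by metis
qed

lemma N_T: "N \<subseteq> T" and U_T: "U \<subseteq> T"
  using N_Least U_Least T_Least t_closed_seminormal t_closed_u_closed by auto

text \<open>
  Since \<open>B\<close> is not t-closed there is a step over \<open>B\<close>, and \<open>T\<close> is closed under the steps over its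
  subrings.
\<close>
lemma T_reach:
  assumes B: "B \<in> L" "B \<subseteq> T" "B \<noteq> T"
  shows "\<exists>b \<in> T. t_step B b"
proof -
  have "\<not> t_closed S B"
    using B T_Least by blast
  then obtain b r where b: "b \<in> carrier S" "r \<in> B" "b \<otimes> b \<ominus> r \<otimes> b \<in> B" "(b \<otimes> b \<ominus> r \<otimes> b) \<otimes> b \<in> B" "b \<notin> B"
    unfolding t_closed_iff[OF B(1)] by blast
  then have "b \<in> T"
    using T_closed[of b r] B(2) by blast
  then show ?thesis
    using b unfolding t_step_def by blast
qed

section \<open>The seminormalization is local\<close>

text \<open>
  \<open>B\<close> is local with maximal ideal \<open>I\<close>, has the same residue field as \<open>R\<close>, and the elements of \<open>I\<close> are
  nilpotent modulo \<open>m\<close>. Exponents \<open>2 ^ k\<close> are used because all inductions square.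
\<close>
definition resid :: "'a set \<Rightarrow> 'a set \<Rightarrow> bool" where
  "resid B I \<longleftrightarrow> B \<in> L \<and> sub_ideal I B \<and> m \<subseteq> I \<and> \<one> \<notin> I \<and> (\<forall>b \<in> B. \<exists>r \<in> R. b \<ominus> r \<in> I) \<and>
     (\<forall>x \<in> I. \<exists>k::nat. x [^] (2 ^ k :: nat) \<in> m)"

text \<open>
  The factorization \<open>1 - x\<^sup>2 = (1 - x) (1 + x)\<close> reduces \<open>x\<close> to \<open>x\<^sup>2\<close>, and finally to an element of \<open>m\<close>.
\<close>
lemma nilpotent_unit:
  "B \<in> L \<Longrightarrow> x \<in> B \<Longrightarrow> x [^] (2 ^ k :: nat) \<in> m \<Longrightarrow> \<exists>u \<in> B. (\<one> \<ominus> x) \<otimes> u = \<one>"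
proof (induction k arbitrary: x)
  case 0
  then have x: "x \<in> m"
    using L_carrier by simp
  then have [simp]: "x \<in> carrier S"
    using 0 L_carrier by blast
  have "\<one> = (\<one> \<ominus> x) \<oplus> x"
    by - (rule poly_eqI[of "[x]"], (rule poly_reify)+, simp_all add: poly_simps)
  then have "\<one> \<ominus> x \<notin> m"
    using m_closed(3)[OF _ x, of "\<one> \<ominus> x"] one_m by auto
  then obtain z where "z \<in> R" "(\<one> \<ominus> x) \<otimes> z = \<one>"
    using R_unit[of "\<one> \<ominus> x"] x by auto
  then show ?case
    using L_R[OF 0(1)] by blast
next
  case (Suc k)
  have [simp]: "x \<in> carrier S"
    using Suc.prems L_carrier by blast
  have "(x \<otimes> x) [^] (2 ^ k :: nat) = x [^] (2 ^ Suc k :: nat)"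
    by (simp add: nat_pow_distrib nat_pow_mult mult_2)
  then obtain u where u: "u \<in> B" "(\<one> \<ominus> x \<otimes> x) \<otimes> u = \<one>"
    using Suc.IH[of "x \<otimes> x"] Suc.prems by auto
  have "u \<in> carrier S"
    using u Suc.prems L_carrier by blast
  then have "(\<one> \<ominus> x) \<otimes> ((\<one> \<oplus> x) \<otimes> u) = (\<one> \<ominus> x \<otimes> x) \<otimes> u"
    by - (rule poly_eqI[of "[x,u]"], (rule poly_reify)+, simp_all add: poly_simps)
  then show ?case
    using u Suc.prems by (intro bexI[of _ "(\<one> \<oplus> x) \<otimes> u"]) simp_all
qed

lemma resid_facts:
  assumes "resid B I"
  shows "B \<in> L" "sub_ideal I B" "m \<subseteq> I" "\<one> \<notin> I" "b \<in> B \<Longrightarrow> \<exists>r \<in> R. b \<ominus> r \<in> I"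
    "x \<in> I \<Longrightarrow> \<exists>k::nat. x [^] (2 ^ k :: nat) \<in> m"
  using assms by (simp_all add: resid_def)

text \<open>
  Up to a unit of \<open>R\<close> and an element of \<open>I\<close>, every element outside \<open>I\<close> is \<open>1\<close>.
\<close>
lemma resid_unit:
  assumes r: "resid B I" and s: "s \<in> B" "s \<notin> I"
  shows "\<exists>u \<in> B. s \<otimes> u = \<one>"
proof -
  note B = resid_facts(1)[OF r] and I = sub_ideal_closed[OF resid_facts(2,1)[OF r]]
  obtain t where t: "t \<in> R" "s \<ominus> t \<in> I"
    using resid_facts(5)[OF r s(1)] by blast
  have [simp]: "s \<in> carrier S" "t \<in> carrier S"
    using s t L_carrier B R_L by blast+
  have "t \<notin> m"
  proof
    assume "t \<in> m"
    then have "(s \<ominus> t) \<oplus> t \<in> I"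
      using t(2) resid_facts(3)[OF r] I(3) by blast
    moreover have "(s \<ominus> t) \<oplus> t = s"
      by - (rule poly_eqI[of "[s,t]"], (rule poly_reify)+, simp_all add: poly_simps)
    ultimately show False
      using s by simp
  qed
  then obtain z where z: "z \<in> R" "t \<otimes> z = \<one>"
    using R_unit t by blast
  have zB: "z \<in> B" and [simp]: "z \<in> carrier S"
    using z L_R[OF B] L_carrier[OF R_L] by auto
  define x where "x = \<ominus> (z \<otimes> (s \<ominus> t))"
  have x: "x \<in> I"
    unfolding x_def using I(5,6) zB t(2) by blast
  have "s \<otimes> z = t \<otimes> z \<oplus> z \<otimes> (s \<ominus> t)"
    by - (rule poly_eqI[of "[s,t,z]"], (rule poly_reify)+, simp_all add: poly_simps)
  also have "\<dots> = \<one> \<ominus> x"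
    unfolding z(2) x_def by - (rule poly_eqI[of "[s,t,z]"], (rule poly_reify)+, simp_all add: poly_simps)
  finally have sz: "s \<otimes> z = \<one> \<ominus> x" .
  obtain k where "x [^] (2 ^ k :: nat) \<in> m"
    using resid_facts(6)[OF r x] by blast
  then obtain u where u: "u \<in> B" "(\<one> \<ominus> x) \<otimes> u = \<one>"
    using nilpotent_unit[OF B I(2)[OF x]] by blast
  then have "s \<otimes> (z \<otimes> u) = \<one>"
    using L_carrier[OF B u(1)] sz by (simp add: m_assoc[symmetric])
  then show ?thesis
    using u zB B by (intro bexI[of _ "z \<otimes> u"]) simp_all
qed

lemma resid_local_at:
  assumes r: "resid B I"
  shows "local_at B I (carrier S)"
proof -
  note B = resid_facts(1)[OF r] and I = sub_ideal_closed[OF resid_facts(2,1)[OF r]]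
  have *: "\<exists>u \<in> B. s \<otimes> u = \<one>" if "s \<in> B - I" for s
    using resid_unit[OF r] that by blast
  show ?thesis
    unfolding local_at_def
  proof (intro conjI ballI)
    show "B \<in> L" "carrier S \<in> L" "B \<subseteq> carrier S" "sub_ideal I B" "\<one> \<notin> I"
      using r le_S[OF B] by (simp_all add: resid_def)
    fix s assume s: "s \<in> B - I"
    then obtain u where u: "u \<in> B" "s \<otimes> u = \<one>"
      using * by blast
    have [simp]: "s \<in> carrier S" "u \<in> carrier S"
      using s u L_carrier[OF B] by auto
    show "\<exists>z \<in> B. s \<otimes> z \<ominus> \<one> \<in> I"
    proof (rule bexI[OF _ u(1)])
      show "s \<otimes> u \<ominus> \<one> \<in> I"
        unfolding u(2) using I(1) by (simp add: a_minus_def r_neg)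
    qed
    fix x assume "x \<in> carrier S"
    then show "\<exists>p \<in> B. \<exists>q \<in> B. \<one> = p \<otimes> s \<oplus> q \<and> q \<otimes> x \<in> B"
      using u B by (intro bexI[of _ u] bexI[of _ \<zero>]) (simp_all add: m_comm[of u s])
  qed
qed

lemma resid_sub:
  assumes r: "resid B I" and A: "A \<in> L" "A \<subseteq> B"
  shows "resid A (A \<inter> I)"
proof -
  note B = resid_facts(1)[OF r] and I = sub_ideal_closed[OF resid_facts(2,1)[OF r]]
  have res: "\<exists>r \<in> R. b \<ominus> r \<in> A \<inter> I" if b: "b \<in> A" for b
  proof -
    obtain t where t: "t \<in> R" "b \<ominus> t \<in> I"
      using resid_facts(5)[OF r, of b] b A(2) by blast
    then show ?thesis
      using L_closed(6)[OF A(1) b L_R[OF A(1) t(1)]] by blast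
  qed
  have "sub_ideal (A \<inter> I) A"
    unfolding sub_ideal_def using A I by (auto simp: subset_iff)
  moreover have "m \<subseteq> A \<inter> I"
    using resid_facts(3)[OF r] m_closed(2) L_R[OF A(1)] by blast
  ultimately show ?thesis
    unfolding resid_def using A res resid_facts(4,6)[OF r] by blast
qed

lemma resid_R: "resid R m"
proof -
  have "\<exists>r \<in> R. b \<ominus> r \<in> m" if "b \<in> R" for b
    using that L_carrier[OF R_L that] by (intro bexI[of _ b]) (simp_all add: a_minus_def r_neg)
  moreover have "\<exists>k::nat. x [^] (2 ^ k :: nat) \<in> m" if "x \<in> m" for x
    using that L_carrier[OF R_L m_closed(2)[OF that]] by (intro exI[of _ 0]) simp
  ultimately show ?thesis
    unfolding resid_def using m_ideal one_m by simp
qed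

text \<open>
  So \<open>I\<close> is determined by \<open>B\<close>; this is the reason for the definition of \<open>n\<close> below.
\<close>
lemma resid_ideal_eq:
  assumes r: "resid B I"
  shows "I = {x \<in> B. \<exists>k::nat. x [^] (2 ^ k :: nat) \<in> m}"
proof (intro equalityI subsetI)
  note B = resid_facts(1)[OF r] and I = sub_ideal_closed[OF resid_facts(2,1)[OF r]]
  fix x
  show "x \<in> I \<Longrightarrow> x \<in> {x \<in> B. \<exists>k::nat. x [^] (2 ^ k :: nat) \<in> m}"
    using I(2) resid_facts(6)[OF r] by blast
  assume "x \<in> {x \<in> B. \<exists>k::nat. x [^] (2 ^ k :: nat) \<in> m}"
  then obtain k where x: "x \<in> B" "x [^] (2 ^ k :: nat) \<in> m"
    by blast
  show "x \<in> I"
  proof (rule ccontr)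
    assume "x \<notin> I"
    then obtain u where u: "u \<in> B" "x \<otimes> u = \<one>"
      using resid_unit[OF r x(1)] by blast
    have "x [^] (2 ^ k :: nat) \<otimes> u [^] (2 ^ k :: nat) = \<one>"
      using u x L_carrier[OF B] by (simp add: nat_pow_distrib[symmetric])
    moreover have "x [^] (2 ^ k :: nat) \<otimes> u [^] (2 ^ k :: nat) \<in> I"
      using I(7)[OF L_pow[OF B u(1)]] x(2) resid_facts(3)[OF r] by blast
    ultimately show False
      using resid_facts(4)[OF r] by simp
  qed
qed

text \<open>
  The maximal ideal of \<open>N\<close>, see \<open>resid_N\<close>.
\<close>
definition n :: "'a set" where
  "n = {x \<in> N. \<exists>k::nat. x [^] (2 ^ k :: nat) \<in> m}"

text \<open>
  A ramified step preserves \<open>resid\<close>: with \<open>q\<^sup>2\<close> and \<open>I q\<close> in \<open>I\<close>, the squares of the elements of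
  \<open>I + B q\<close> are in \<open>I\<close>.
\<close>
lemma resid_extend:
  assumes r: "resid B I" and q: "q \<in> carrier S" "q \<notin> B" "q \<otimes> q \<in> B" "q \<otimes> q \<otimes> q \<in> B"
    and Iq: "\<And>a. a \<in> I \<Longrightarrow> a \<otimes> q \<in> B"
  shows "resid (adjoin B B q) (adjoin I B q)"
proof -
  note B = resid_facts(1)[OF r] and I = sub_ideal_closed[OF resid_facts(2,1)[OF r]]
  note Bc = L_carrier[OF B]
  have Ic: "x \<in> I \<Longrightarrow> x \<in> carrier S" for x
    using Bc I(2) by blast
  note [simp] = q(1)
  have qq: "q \<otimes> q \<in> I"
  proof (rule ccontr)
    assume "q \<otimes> q \<notin> I"
    then obtain u where u: "u \<in> B" "q \<otimes> q \<otimes> u = \<one>"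
      using resid_unit[OF r q(3)] by blast
    have "q \<otimes> (q \<otimes> q \<otimes> u) = q \<otimes> q \<otimes> q \<otimes> u"
      using Bc[OF u(1)] by - (rule poly_eqI[of "[q,u]"], (rule poly_reify)+, simp_all add: poly_simps)
    then have "q \<otimes> q \<otimes> q \<otimes> u = q"
      unfolding u(2) by simp
    moreover have "q \<otimes> q \<otimes> q \<otimes> u \<in> B"
      using L_closed(5)[OF B q(4) u(1)] .
    ultimately show False
      using q(2) by simp
  qed
  have Iq': "a \<otimes> q \<in> I" if a: "a \<in> I" for a
  proof (rule ccontr)
    assume "a \<otimes> q \<notin> I"
    then obtain u where u: "u \<in> B" "a \<otimes> q \<otimes> u = \<one>"
      using resid_unit[OF r Iq[OF a]] by blast
    have "q \<otimes> (a \<otimes> q \<otimes> u) = q \<otimes> q \<otimes> (a \<otimes> u)"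
      using Bc[OF u(1)] Ic[OF a] by - (rule poly_eqI[of "[q,a,u]"], (rule poly_reify)+, simp_all add: poly_simps)
    then have "q \<otimes> q \<otimes> (a \<otimes> u) = q"
      unfolding u(2) by simp
    moreover have "q \<otimes> q \<otimes> (a \<otimes> u) \<in> B"
      using q(3) u(1) I(2)[OF a] B by simp
    ultimately show False
      using q(2) by simp
  qed
  have B'_L: "adjoin B B q \<in> L"
    using quadratic_adjoin_L[OF B q(1), of \<zero>] B q(3) by simp
  have B_B': "B \<subseteq> adjoin B B q"
    using adjoin_base[OF B B q(1)] .
  have sub: "sub_ideal (adjoin I B q) (adjoin B B q)"
    unfolding sub_ideal_def
  proof (intro conjI ballI)
    show "adjoin I B q \<subseteq> adjoin B B q"
      using I(2) unfolding adjoin_def by blast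
    show "\<zero> \<in> adjoin I B q"
      using I(1) B by (intro adjoinI[of \<zero> I \<zero>]) simp_all
    fix y assume y: "y \<in> adjoin I B q"
    show "y \<oplus> z \<in> adjoin I B q" if "z \<in> adjoin I B q" for z
      by (rule adjoin_add[OF _ _ q(1) _ _ y that]) (use Ic Bc I(3) B in auto)
    obtain x \<beta> where x: "x \<in> I" "\<beta> \<in> B" "y = x \<oplus> \<beta> \<otimes> q"
      using y by (rule adjoinE)
    fix b assume "b \<in> adjoin B B q"
    then obtain a c where b: "a \<in> B" "c \<in> B" "b = a \<oplus> c \<otimes> q"
      by (rule adjoinE)
    show "b \<otimes> y \<in> adjoin I B q"
    proof (rule adjoinI)
      show "b \<otimes> y = (a \<otimes> x \<oplus> (c \<otimes> \<beta>) \<otimes> (q \<otimes> q)) \<oplus> (a \<otimes> \<beta> \<oplus> c \<otimes> x) \<otimes> q"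
        unfolding b(3) x(3) using Bc[OF b(1)] Bc[OF b(2)] Ic[OF x(1)] Bc[OF x(2)] by - (rule poly_eqI[of "[a,c,x,\<beta>,q]"], (rule poly_reify)+, simp_all add: poly_simps)
      show "a \<otimes> x \<oplus> (c \<otimes> \<beta>) \<otimes> (q \<otimes> q) \<in> I"
        using I(3)[OF I(6)[OF b(1) x(1)] I(6)[OF _ qq]] b x B by simp
      show "a \<otimes> \<beta> \<oplus> c \<otimes> x \<in> B"
        using b x I(2) B by simp
    qed
  qed
  have I_le: "I \<subseteq> adjoin I B q"
  proof
    fix x assume "x \<in> I"
    then show "x \<in> adjoin I B q"
      using B Ic by (intro adjoinI[of x I \<zero>]) simp_all
  qed
  have square: "y \<otimes> y \<in> I" if y: "y \<in> adjoin I B q" for y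
  proof -
    obtain x \<beta> where x: "x \<in> I" "\<beta> \<in> B" "y = x \<oplus> \<beta> \<otimes> q"
      using y by (rule adjoinE)
    have "y \<otimes> y = x \<otimes> x \<oplus> ((\<beta> \<oplus> \<beta>) \<otimes> (x \<otimes> q) \<oplus> (\<beta> \<otimes> \<beta>) \<otimes> (q \<otimes> q))"
      unfolding x(3) using Ic[OF x(1)] Bc[OF x(2)] by - (rule poly_eqI[of "[x,\<beta>,q]"], (rule poly_reify)+, simp_all add: poly_simps)
    also have "\<dots> \<in> I"
      using x(2) B I(3)[OF I(6)[OF I(2)[OF x(1)] x(1)] I(3)[OF I(6)[OF _ Iq'[OF x(1)]] I(6)[OF _ qq]]] by simp
    finally show ?thesis .
  qed
  have yc: "y \<in> carrier S" if "y \<in> adjoin I B q" for y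
    using L_carrier[OF B'_L] sub that unfolding sub_ideal_def by blast
  show ?thesis
    unfolding resid_def
  proof (intro conjI ballI B'_L sub)
    show "m \<subseteq> adjoin I B q"
      using resid_facts(3)[OF r] I_le by blast
    show "\<one> \<notin> adjoin I B q"
      using square[of \<one>] resid_facts(4)[OF r] by auto
    show "\<exists>t \<in> R. b \<ominus> t \<in> adjoin I B q" if bB: "b \<in> adjoin B B q" for b
    proof -
      obtain a c where b: "a \<in> B" "c \<in> B" "b = a \<oplus> c \<otimes> q"
        using bB by (rule adjoinE)
      obtain t where t: "t \<in> R" "a \<ominus> t \<in> I"
        using resid_facts(5)[OF r b(1)] by blast
      have "b \<ominus> t = (a \<ominus> t) \<oplus> c \<otimes> q"
        unfolding b(3) using Bc[OF b(1)] Bc[OF b(2)] L_carrier[OF R_L t(1)] by - (rule poly_eqI[of "[a,c,t,q]"], (rule poly_reify)+, simp_all add: poly_simps)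
      then have "b \<ominus> t \<in> adjoin I B q"
        by (rule adjoinI[OF t(2) b(2)])
      then show ?thesis
        using t(1) by blast
    qed
    show "\<exists>k::nat. y [^] (2 ^ k :: nat) \<in> m" if y: "y \<in> adjoin I B q" for y
    proof -
      obtain k where k: "(y \<otimes> y) [^] (2 ^ k :: nat) \<in> m"
        using resid_facts(6)[OF r square[OF y]] by blast
      have "(y \<otimes> y) [^] (2 ^ k :: nat) = y [^] (2 ^ Suc k :: nat)"
        using yc[OF y] by (simp add: nat_pow_distrib nat_pow_mult mult_2)
      then show ?thesis
        using k by metis
    qed
  qed
qed

text \<open>
  A maximal subring of \<open>N\<close> with the property \<open>resid\<close> is seminormal in \<open>S\<close>, because otherwise a shrunk
  witness would extend it; so it is \<open>N\<close>.
\<close>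
lemma resid_N: "resid N n"
proof -
  let ?Q = "{B \<in> L. B \<subseteq> N \<and> (\<exists>I. resid B I)}"
  have sub: "?Q \<subseteq> L" and ne: "R \<in> ?Q"
    using resid_R R_le[OF N_L] by auto
  show ?thesis
  proof (rule obtain_maximal[OF sub ne])
    fix B assume B': "B \<in> ?Q" and max: "\<And>Z. Z \<in> ?Q \<Longrightarrow> B \<subseteq> Z \<Longrightarrow> Z = B"
    obtain I where r: "resid B I"
      using B' by blast
    have B: "B \<in> L" "B \<subseteq> N"
      using B' by auto
    have "B = N"
    proof (rule ccontr)
      assume "B \<noteq> N"
      then have "\<not> seminormal S B"
        using N_Least B by blast
      then obtain b0 where b0: "b0 \<in> carrier S" "b0 \<notin> B" "b0 \<otimes> b0 \<in> B" "b0 \<otimes> b0 \<otimes> b0 \<in> B"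
        unfolding seminormal_iff by blast
      let ?P = "{b \<in> carrier S. b \<notin> B \<and> b \<otimes> b \<in> B \<and> b \<otimes> b \<otimes> b \<in> B}"
      obtain q where q: "q \<in> ?P" "\<And>a. a \<in> I \<Longrightarrow> a \<otimes> q \<in> B"
      proof (rule shrink[OF B(1) resid_facts(2)[OF r], of ?P b0])
        show "?P \<subseteq> carrier S" "b0 \<in> ?P"
          using b0 by auto
        fix q assume q: "q \<in> ?P"
        then have [simp]: "q \<in> carrier S"
          by simp
        show "adjoin B B q \<in> L"
          using quadratic_adjoin_L[OF B(1), of q \<zero>] q B(1) by simp
        show "q \<notin> B"
          using q by simp
        fix a assume a: "a \<in> I"
        have aB: "a \<in> B" and [simp]: "a \<in> carrier S"
          using sub_ideal_closed(2)[OF resid_facts(2,1)[OF r] a] L_carrier[OF B(1)] by auto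
        show "q \<in> B" if "(\<one> \<ominus> a) \<otimes> q \<in> B"
          using divide_ring[OF resid_local_at[OF r], of q "\<one> \<ominus> a" B] P_sum_one[OF resid_local_at[OF r] a]
            that B(1) by auto
        have "a \<otimes> q \<otimes> (a \<otimes> q) = a \<otimes> a \<otimes> (q \<otimes> q)" "a \<otimes> q \<otimes> (a \<otimes> q) \<otimes> (a \<otimes> q) = a \<otimes> a \<otimes> a \<otimes> (q \<otimes> q \<otimes> q)"
          subgoal by - (rule poly_eqI[of "[a,q]"], (rule poly_reify)+, simp_all add: poly_simps)
          subgoal by - (rule poly_eqI[of "[a,q]"], (rule poly_reify)+, simp_all add: poly_simps)
          done
        moreover have "a \<otimes> a \<otimes> (q \<otimes> q) \<in> B" "a \<otimes> a \<otimes> a \<otimes> (q \<otimes> q \<otimes> q) \<in> B"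
          using aB q B(1) by simp_all
        ultimately show "a \<otimes> q \<in> ?P" if "a \<otimes> q \<notin> B"
          using that by simp
      qed blast
      have q': "q \<in> carrier S" "q \<notin> B" "q \<otimes> q \<in> B" "q \<otimes> q \<otimes> q \<in> B"
        using q(1) by auto
      have r': "resid (adjoin B B q) (adjoin I B q)"
        using resid_extend[OF r q' q(2)] .
      have qN: "q \<in> N"
        using N_closed[of q] q' B(2) by blast
      have "adjoin B B q \<subseteq> N"
        using adjoin_least[OF N_L B(2) B(2) qN] .
      then have "adjoin B B q = B"
        using max[of "adjoin B B q"] r' resid_facts(1)[OF r'] adjoin_base[OF B(1) B(1) q'(1)] by blast
      then show False
        using adjoin_gen[OF B(1) B(1) q'(1)] q'(2) by simp
    qed
    then have "resid N I"
      using r by simp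
    then show "resid N n"
      using resid_ideal_eq[of N I] by (simp add: n_def)
  qed
qed

lemmas n_closed = sub_ideal_closed[OF resid_facts(2,1)[OF resid_N]]

lemma N_decompose: "x \<in> N \<Longrightarrow> \<exists>r \<in> R. x \<ominus> r \<in> n"
  using resid_facts(5)[OF resid_N] .

lemma n_carrier: "x \<in> n \<Longrightarrow> x \<in> carrier S"
  using n_closed(2) L_carrier[OF N_L] by blast

lemma n_nilpotent: "x \<in> n \<Longrightarrow> \<exists>k::nat. x [^] (2 ^ k :: nat) \<in> m"
  using resid_facts(6)[OF resid_N] .

lemma one_n: "\<one> \<notin> n"
  using resid_facts(4)[OF resid_N] .

lemma m_n: "m \<subseteq> n"
  using resid_facts(3)[OF resid_N] .

section \<open>Rings inside the seminormalization\<close>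

lemma n_unit: "x \<in> N \<Longrightarrow> x \<notin> n \<Longrightarrow> \<exists>u \<in> N. x \<otimes> u = \<one>"
  using resid_unit[OF resid_N] .

lemma sub_N_resid: "A \<in> L \<Longrightarrow> A \<subseteq> N \<Longrightarrow> resid A (A \<inter> n)"
  using resid_sub[OF resid_N] .

text \<open>
  All powers of \<open>e\<close> agree modulo \<open>A \<inter> n\<close>, and one of them is in \<open>m\<close>.
\<close>
lemma nilpotent_idempotent_mem:
  assumes A: "A \<in> L" "A \<subseteq> N" and e: "e \<in> n" and ee: "e \<otimes> e \<ominus> e \<in> A \<inter> n"
    and Pe: "\<And>p. p \<in> A \<inter> n \<Longrightarrow> p \<otimes> e \<in> A \<inter> n"
  shows "e \<in> A"
proof -
  note c = sub_ideal_closed[OF resid_facts(2,1)[OF sub_N_resid[OF A]]]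
  have [simp]: "e \<in> carrier S"
    using n_carrier[OF e] .
  have pow: "e [^] Suc k \<ominus> e \<in> A \<inter> n" for k
  proof (induction k)
    case 0
    then show ?case
      using c(1) by (simp add: a_minus_def r_neg)
  next
    case (Suc k)
    define g where "g = e [^] Suc k"
    have [simp]: "g \<in> carrier S"
      by (simp add: g_def)
    have "g \<otimes> e \<ominus> e = (g \<ominus> e) \<otimes> e \<oplus> (e \<otimes> e \<ominus> e)"
      by - (rule poly_eqI[of "[g,e]"], (rule poly_reify)+, simp_all add: poly_simps)
    also have "\<dots> \<in> A \<inter> n"
      using c(3)[OF Pe[OF Suc] ee] by (simp only: g_def)
    finally show ?case
      by (simp add: g_def)
  qed
  obtain k where k: "e [^] (2 ^ k :: nat) \<in> m"
    using n_nilpotent[OF e] by blast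
  define g where "g = e [^] (2 ^ k :: nat)"
  have gA: "g \<in> A" and [simp]: "g \<in> carrier S"
    using k L_R[OF A(1)] m_closed(2) by (simp_all add: g_def)
  have "g \<ominus> e \<in> A \<inter> n"
    using pow[of "2 ^ k - 1"] by (simp add: g_def)
  moreover have "e = g \<ominus> (g \<ominus> e)"
    by - (rule poly_eqI[of "[g,e]"], (rule poly_reify)+, simp_all add: poly_simps)
  ultimately show ?thesis
    using L_closed(6)[OF A(1) gA, of "g \<ominus> e"] by simp
qed

text \<open>
  Inside \<open>N\<close> minimal extensions are ramified: they are not inert because all residue fields agree,
  and not decomposed because \<open>N\<close> is local.
\<close>
lemma subintegral_step:
  assumes A: "A \<in> L" and Y: "Y \<in> L" "A \<subset> Y" "Y \<subseteq> N"
  obtains x where "x \<in> Y" "x \<notin> A" "x \<otimes> x \<in> A \<inter> n" "\<And>p. p \<in> A \<inter> n \<Longrightarrow> p \<otimes> x \<in> A \<inter> n"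
proof -
  let ?P = "A \<inter> n"
  have AN: "A \<subseteq> N"
    using Y by blast
  note r = sub_N_resid[OF A AN]
  note la = resid_local_at[OF r] and laN = resid_local_at[OF resid_N]
  show thesis
  proof (rule obtain_cover[OF Y(1,2)])
    fix C assume cov: "covers C A" and CY: "C \<subseteq> Y"
    have C: "C \<in> L" "C \<subseteq> carrier S" "A \<subseteq> C" "C \<noteq> A"
      using cov le_S unfolding covers_def by auto
    have CN: "C \<subseteq> N"
      using CY Y(3) by blast
    note cond = cover_conductor[OF la cov C(2)]
    from la cov C(2) show thesis
    proof (cases rule: cover_trichotomy)
      case (ramified x)
      show thesis
        by (rule that[of x]) (use ramified CY cond in auto)
    next
      case (decomposed e)
      have [simp]: "e \<in> carrier S"
        using decomposed C by blast
      have eN: "e \<in> N"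
        using decomposed CN by blast
      have Pe: "p \<otimes> e \<in> ?P" if "p \<in> ?P" for p
        using cond[OF that decomposed(1)] .
      have "e \<in> n \<or> \<one> \<ominus> e \<in> n"
        using P_prime_idem[OF laN eN] decomposed(3) by blast
      then show thesis
      proof
        assume "e \<in> n"
        then show thesis
          using nilpotent_idempotent_mem[OF A AN _ decomposed(3) Pe] decomposed(2) by blast
      next
        assume e': "\<one> \<ominus> e \<in> n"
        have "(\<one> \<ominus> e) \<otimes> (\<one> \<ominus> e) \<ominus> (\<one> \<ominus> e) = e \<otimes> e \<ominus> e"
          by - (rule poly_eqI[of "[e]"], (rule poly_reify)+, simp_all add: poly_simps)
        then have 1: "(\<one> \<ominus> e) \<otimes> (\<one> \<ominus> e) \<ominus> (\<one> \<ominus> e) \<in> ?P"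
          using decomposed(3) by simp
        have 2: "p \<otimes> (\<one> \<ominus> e) \<in> ?P" if p: "p \<in> ?P" for p
        proof -
          have "p \<otimes> (\<one> \<ominus> e) = p \<ominus> p \<otimes> e"
            using P_carrier[OF la p] by - (rule poly_eqI[of "[p,e]"], (rule poly_reify)+, simp_all add: poly_simps)
          then show ?thesis
            using P_closed(4)[OF la p Pe[OF p]] by simp
        qed
        have "\<one> \<ominus> e \<in> A"
          by (rule nilpotent_idempotent_mem[OF A AN e' 1 2])
        then have "\<one> \<ominus> (\<one> \<ominus> e) \<in> A"
          using A by simp
        moreover have "\<one> \<ominus> (\<one> \<ominus> e) = e"
          by - (rule poly_eqI[of "[e]"], (rule poly_reify)+, simp_all add: poly_simps)
        ultimately show thesis
          using decomposed(2) by simp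
      qed
    next
      case inert
      obtain x where x: "x \<in> C" "x \<notin> A"
        using C by blast
      obtain t where t: "t \<in> R" "x \<ominus> t \<in> n"
        using N_decompose x CN by blast
      have [simp]: "x \<in> carrier S" "t \<in> carrier S"
        using x C t L_carrier[OF R_L] by auto
      have "x \<ominus> t \<notin> A"
      proof
        assume "x \<ominus> t \<in> A"
        then have "(x \<ominus> t) \<oplus> t \<in> A"
          using L_R[OF A t(1)] A by simp
        moreover have "(x \<ominus> t) \<oplus> t = x"
          by - (rule poly_eqI[of "[x,t]"], (rule poly_reify)+, simp_all add: poly_simps)
        ultimately show False
          using x by simp
      qed
      then obtain z where z: "z \<in> C" "(x \<ominus> t) \<otimes> z \<ominus> \<one> \<in> ?P"
        using inert[of "x \<ominus> t"] x(1) L_R[OF C(1) t(1)] C(1) by auto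
      have [simp]: "z \<in> carrier S"
        using z C by blast
      have zN: "z \<in> N"
        using z CN by blast
      have "(x \<ominus> t) \<otimes> z \<ominus> ((x \<ominus> t) \<otimes> z \<ominus> \<one>) \<in> n"
        using n_closed(4)[OF n_closed(7)[OF zN t(2)]] z(2) by blast
      moreover have "(x \<ominus> t) \<otimes> z \<ominus> ((x \<ominus> t) \<otimes> z \<ominus> \<one>) = \<one>"
        by - (rule poly_eqI[of "[x,t,z]"], (rule poly_reify)+, simp_all add: poly_simps)
      ultimately show thesis
        using one_n by simp
    qed
  qed
qed

text \<open>
  The squares of \<open>x\<close>, \<open>y\<close> and \<open>x + y\<close> are in \<open>P\<close>, so the rings that \<open>no_independent_pair\<close>
  needs exist.
\<close>
lemma no_ramified_pair:
  assumes r: "resid A P" and x: "x \<in> carrier S" "x \<otimes> x \<in> P" "\<And>p. p \<in> P \<Longrightarrow> p \<otimes> x \<in> P"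
    and y: "y \<in> carrier S" "y \<otimes> y \<in> P" "\<And>p. p \<in> P \<Longrightarrow> p \<otimes> y \<in> P"
    and xy: "x \<otimes> y \<in> P"
    and indep: "\<And>b c. b \<in> A \<Longrightarrow> c \<in> A \<Longrightarrow> b \<otimes> x \<oplus> c \<otimes> y \<in> A \<Longrightarrow> b \<in> P \<and> c \<in> P"
  shows False
proof -
  note A = resid_facts(1)[OF r] and P = sub_ideal_closed[OF resid_facts(2,1)[OF r]]
  note [simp] = x(1) y(1)
  have ring: "adjoin A A z \<in> L" if z: "z \<in> carrier S" "z \<otimes> z \<in> P" for z
  proof (rule quadratic_adjoin_L[OF A z(1), of \<zero>])
    show "z \<otimes> z \<ominus> \<zero> \<otimes> z \<in> A"
      using z A P(2) by simp
  qed (use A in simp)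
  show False
  proof (rule no_independent_pair[OF A x(1) y(1), of P])
    show "adjoin A A x \<in> L" "adjoin A A y \<in> L"
      using ring x y by auto
    have "(x \<oplus> y) \<otimes> (x \<oplus> y) = x \<otimes> x \<oplus> (x \<otimes> y \<oplus> x \<otimes> y) \<oplus> y \<otimes> y"
      by - (rule poly_eqI[of "[x,y]"], (rule poly_reify)+, simp_all add: poly_simps)
    then have "(x \<oplus> y) \<otimes> (x \<oplus> y) \<in> P"
      using P(3)[OF P(3)[OF x(2) P(3)[OF xy xy]] y(2)] by simp
    then show "adjoin A A (x \<oplus> y) \<in> L"
      using ring[of "x \<oplus> y"] by simp
    show "p \<otimes> x \<in> A" "p \<otimes> y \<in> A" if "p \<in> P" for p
      using x(3) y(3) that P(2) by blast+
    show "\<one> \<notin> P"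
      using resid_facts(4)[OF r] .
  qed (rule indep)
qed

text \<open>
  For incomparable \<open>H\<close> and \<open>Y\<close> take ramified steps \<open>x \<in> H\<close> and \<open>y \<in> Y\<close> over \<open>A = H \<inter> Y\<close>; they are
  independent modulo \<open>P = A \<inter> n\<close>. If \<open>z = x y\<close> is in \<open>A\<close>, the pair \<open>x\<close>, \<open>y\<close> is forbidden. Otherwise
  \<open>x\<close> and \<open>z\<close> are also independent, \<open>x z\<close> and \<open>z\<^sup>2\<close> are in \<open>P\<close>, and the pair \<open>x\<close>, \<open>z\<close> is forbidden.
\<close>
lemma N_chain:
  assumes H: "H \<in> L" "H \<subseteq> N" and Y: "Y \<in> L" "Y \<subseteq> N"
  shows "H \<subseteq> Y \<or> Y \<subseteq> H"
proof (rule ccontr)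
  assume n: "\<not> ?thesis"
  let ?A = "H \<inter> Y"
  let ?P = "?A \<inter> n"
  have A: "?A \<in> L" "?A \<subseteq> N"
    using H Y by auto
  have ps: "?A \<subset> H" "?A \<subset> Y"
    using n by auto
  obtain x where x: "x \<in> H" "x \<notin> ?A" "x \<otimes> x \<in> ?P" "\<And>p. p \<in> ?P \<Longrightarrow> p \<otimes> x \<in> ?P"
    by (rule subintegral_step[OF A(1) H(1) ps(1) H(2)]) (rule that; assumption)
  obtain y where y: "y \<in> Y" "y \<notin> ?A" "y \<otimes> y \<in> ?P" "\<And>p. p \<in> ?P \<Longrightarrow> p \<otimes> y \<in> ?P"
    by (rule subintegral_step[OF A(1) Y(1) ps(2) Y(2)]) (rule that; assumption)
  note r = sub_N_resid[OF A]
  note P = sub_ideal_closed[OF resid_facts(2,1)[OF r]] and Ac = L_carrier[OF A(1)]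
  have AH: "a \<in> ?A \<Longrightarrow> a \<in> H" and AY: "a \<in> ?A \<Longrightarrow> a \<in> Y" for a
    by auto
  have [simp]: "x \<in> carrier S" "y \<in> carrier S"
    using x(1) y(1) H(1) Y(1) L_carrier by auto
  have scale: "b \<in> ?P" if b: "b \<in> ?A" "b \<otimes> w \<in> ?A" and w: "w \<in> carrier S" "w \<notin> ?A" for b w
  proof (rule ccontr)
    assume "b \<notin> ?P"
    then obtain u where u: "u \<in> ?A" "b \<otimes> u = \<one>"
      using resid_unit[OF r b(1)] by blast
    have "u \<otimes> (b \<otimes> w) = b \<otimes> u \<otimes> w"
      using Ac[OF b(1)] Ac[OF u(1)] w(1) by - (rule poly_eqI[of "[u,b,w]"], (rule poly_reify)+, simp_all add: poly_simps)
    then have "u \<otimes> (b \<otimes> w) = w"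
      unfolding u(2) using w(1) by simp
    then show False
      using L_closed(5)[OF A(1) u(1) b(2)] w(2) by simp
  qed
  define z where "z = x \<otimes> y"
  have [simp]: "z \<in> carrier S"
    by (simp add: z_def)
  have xz: "x \<otimes> z \<in> ?P"
  proof -
    have "x \<otimes> z = x \<otimes> x \<otimes> y"
      unfolding z_def by - (rule poly_eqI[of "[x,y]"], (rule poly_reify)+, simp_all add: poly_simps)
    then show ?thesis
      using y(4)[OF x(3)] by simp
  qed
  have yz: "y \<otimes> z \<in> ?P"
  proof -
    have "y \<otimes> z = y \<otimes> y \<otimes> x"
      unfolding z_def by - (rule poly_eqI[of "[x,y]"], (rule poly_reify)+, simp_all add: poly_simps)
    then show ?thesis
      using x(4)[OF y(3)] by simp
  qed
  have zz: "z \<otimes> z \<in> ?P"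
  proof -
    have "z \<otimes> z = x \<otimes> x \<otimes> (y \<otimes> y)"
      unfolding z_def by - (rule poly_eqI[of "[x,y]"], (rule poly_reify)+, simp_all add: poly_simps)
    then show ?thesis
      using P(6)[OF P(2)[OF x(3)] y(3)] by simp
  qed
  have Pz: "p \<otimes> z \<in> ?P" if p: "p \<in> ?P" for p
  proof -
    have "p \<otimes> z = p \<otimes> x \<otimes> y"
      unfolding z_def using Ac[OF P(2)[OF p]] by - (rule poly_eqI[of "[p,x,y]"], (rule poly_reify)+, simp_all add: poly_simps)
    then show ?thesis
      using y(4)[OF x(4)[OF p]] by simp
  qed
  show False
  proof (cases "z \<in> ?A")
    case True
    have zP: "z \<in> ?P"
      using scale[OF True, of x] xz P(2) x(2) by (simp add: m_comm)
    show False
    proof (rule no_ramified_pair[OF r _ x(3,4) _ y(3,4)])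
      show "x \<otimes> y \<in> ?P"
        using zP by (simp add: z_def)
      fix b c assume bc: "b \<in> ?A" "c \<in> ?A" "b \<otimes> x \<oplus> c \<otimes> y \<in> ?A"
      have [simp]: "b \<in> carrier S" "c \<in> carrier S"
        using bc Ac by auto
      have "(b \<otimes> x \<oplus> c \<otimes> y) \<ominus> c \<otimes> y = b \<otimes> x"
        by - (rule poly_eqI[of "[b,c,x,y]"], (rule poly_reify)+, simp_all add: poly_simps)
      moreover have "(b \<otimes> x \<oplus> c \<otimes> y) \<ominus> c \<otimes> y \<in> Y"
        using L_closed(6)[OF Y(1) AY[OF bc(3)] L_closed(5)[OF Y(1) AY[OF bc(2)] y(1)]] .
      moreover have "b \<otimes> x \<in> H"
        using L_closed(5)[OF H(1) AH[OF bc(1)] x(1)] .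
      ultimately have bx: "b \<otimes> x \<in> ?A"
        by simp
      have "(b \<otimes> x \<oplus> c \<otimes> y) \<ominus> b \<otimes> x = c \<otimes> y"
        by - (rule poly_eqI[of "[b,c,x,y]"], (rule poly_reify)+, simp_all add: poly_simps)
      then have cy: "c \<otimes> y \<in> ?A"
        using L_closed(6)[OF A(1) bc(3) bx] by (simp only:)
      show "b \<in> ?P \<and> c \<in> ?P"
        using scale[OF bc(1) bx _ x(2)] scale[OF bc(2) cy _ y(2)] by simp
    qed simp_all
  next
    case False
    show False
    proof (rule no_ramified_pair[OF r _ x(3,4) _ zz Pz xz])
      fix b c assume bc: "b \<in> ?A" "c \<in> ?A" "b \<otimes> x \<oplus> c \<otimes> z \<in> ?A"
      have [simp]: "b \<in> carrier S" "c \<in> carrier S"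
        using bc Ac by auto
      \<comment> \<open>A relation with \<open>c\<close> invertible reads \<open>z = \<alpha> + \<beta> x\<close>. Then \<open>\<alpha> \<in> P\<close> since \<open>x z\<close>, \<open>x\<^sup>2 \<in> P\<close>; and \<open>\<beta>\<close> is invertible since \<open>z \<notin> A\<close>, so \<open>x y = (y z - \<alpha> y) / \<beta> \<in> A\<close>.\<close>
      have c: "c \<in> ?P"
      proof (rule ccontr)
        assume "c \<notin> ?P"
        then obtain u where u: "u \<in> ?A" "c \<otimes> u = \<one>"
          using resid_unit[OF r bc(2)] by blast
        define a where "a = b \<otimes> x \<oplus> c \<otimes> z"
        define \<alpha> where "\<alpha> = u \<otimes> a"
        define \<beta> where "\<beta> = \<ominus> (u \<otimes> b)"
        have mem: "\<alpha> \<in> ?A" "\<beta> \<in> ?A"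
          using u(1) bc A(1) unfolding \<alpha>_def \<beta>_def a_def by (metis L_closed(3,5))+
        have [simp]: "\<alpha> \<in> carrier S" "\<beta> \<in> carrier S" "u \<in> carrier S"
          using mem Ac u by auto
        have "\<alpha> \<oplus> \<beta> \<otimes> x = c \<otimes> u \<otimes> z"
          unfolding \<alpha>_def \<beta>_def a_def by - (rule poly_eqI[of "[u,b,x,c,z]"], (rule poly_reify)+, simp_all add: poly_simps)
        then have z_eq: "z = \<alpha> \<oplus> \<beta> \<otimes> x"
          unfolding u(2) by simp
        have "\<alpha> \<otimes> x = (\<alpha> \<oplus> \<beta> \<otimes> x) \<otimes> x \<ominus> \<beta> \<otimes> (x \<otimes> x)"
          by - (rule poly_eqI[of "[\<alpha>,\<beta>,x]"], (rule poly_reify)+, simp_all add: poly_simps)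
        also have "\<dots> = x \<otimes> z \<ominus> \<beta> \<otimes> (x \<otimes> x)"
          by (simp only: z_eq[symmetric]) (simp add: m_comm)
        also have "\<dots> \<in> ?P"
          by (rule P(4)[OF xz P(6)[OF mem(2) x(3)]])
        finally have \<alpha>P: "\<alpha> \<in> ?P"
          using scale[OF mem(1) _ _ x(2)] P(2) by simp
        have "\<beta> \<notin> ?P"
        proof
          assume "\<beta> \<in> ?P"
          then have "\<alpha> \<oplus> \<beta> \<otimes> x \<in> ?A"
            using P(2)[OF P(3)[OF \<alpha>P x(4)]] by blast
          then show False
            using False z_eq by simp
        qed
        then obtain v where v: "v \<in> ?A" "\<beta> \<otimes> v = \<one>"
          using resid_unit[OF r mem(2)] by blast
        have [simp]: "v \<in> carrier S"
          using v Ac by blast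
        have "v \<otimes> (y \<otimes> (\<alpha> \<oplus> \<beta> \<otimes> x) \<ominus> \<alpha> \<otimes> y) = \<beta> \<otimes> v \<otimes> (x \<otimes> y)"
          by - (rule poly_eqI[of "[v,y,\<alpha>,\<beta>,x]"], (rule poly_reify)+, simp_all add: poly_simps)
        then have "v \<otimes> (y \<otimes> z \<ominus> \<alpha> \<otimes> y) = z"
          unfolding v(2) z_eq[symmetric] by (simp add: z_def)
        moreover have "v \<otimes> (y \<otimes> z \<ominus> \<alpha> \<otimes> y) \<in> ?A"
          by (rule P(2)[OF P(6)[OF v(1) P(4)[OF yz y(4)[OF \<alpha>P]]]])
        ultimately show False
          using False by simp
      qed
      have "(b \<otimes> x \<oplus> c \<otimes> z) \<ominus> c \<otimes> z = b \<otimes> x"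
        by - (rule poly_eqI[of "[b,c,x,z]"], (rule poly_reify)+, simp_all add: poly_simps)
      then have "b \<otimes> x \<in> ?A"
        using L_closed(6)[OF A(1) bc(3) P(2)[OF Pz[OF c]]] by (simp only:)
      then show "b \<in> ?P \<and> c \<in> ?P"
        using scale[OF bc(1) _ _ x(2)] c by simp
    qed simp_all
  qed
qed

section \<open>The t-closure over the seminormalization\<close>

text \<open>
  This is applied to the semilocal ring \<open>N + N e\<close>, with \<open>I\<close> inside its Jacobson radical.
\<close>
lemma t_step_shrink:
  assumes B: "B \<in> L" and I: "sub_ideal I B" and b: "t_step B b"
    and unit: "\<And>a. a \<in> I \<Longrightarrow> \<exists>u \<in> B. (\<one> \<ominus> a) \<otimes> u = \<one>"
  obtains q where "t_step B q" "\<And>a. a \<in> I \<Longrightarrow> a \<otimes> q \<in> B"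
proof -
  have sub: "Collect (t_step B) \<subseteq> carrier S" and mem: "b \<in> Collect (t_step B)"
    using b by (auto simp: t_step_def)
  have ring: "adjoin B B q \<in> L" if "q \<in> Collect (t_step B)" for q
    using that quadratic_adjoin_L[OF B] by (auto simp: t_step_def)
  have new: "q \<notin> B" if "q \<in> Collect (t_step B)" for q
    using that by (simp add: t_step_def)
  have scale: "a \<otimes> q \<in> Collect (t_step B)" if "a \<in> I" "q \<in> Collect (t_step B)" "a \<otimes> q \<notin> B" for a q
    using t_step_scale[OF B sub_ideal_closed(2)[OF I B that(1)] _ that(3)] that(2) by simp
  have div: "q \<in> B" if a: "a \<in> I" and q: "q \<in> Collect (t_step B)" and aq: "(\<one> \<ominus> a) \<otimes> q \<in> B" for a q
  proof -
    obtain u where u: "u \<in> B" "(\<one> \<ominus> a) \<otimes> u = \<one>"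
      using unit[OF a] by blast
    have [simp]: "a \<in> carrier S" "u \<in> carrier S" "q \<in> carrier S"
      using L_carrier[OF B] sub_ideal_closed(2)[OF I B a] u(1) q sub by auto
    have "u \<otimes> ((\<one> \<ominus> a) \<otimes> q) = (\<one> \<ominus> a) \<otimes> u \<otimes> q"
      by - (rule poly_eqI[of "[u,a,q]"], (rule poly_reify)+, simp_all add: poly_simps)
    then have "u \<otimes> ((\<one> \<ominus> a) \<otimes> q) = q"
      unfolding u(2) by simp
    then show ?thesis
      using L_closed(5)[OF B u(1) aq] by simp
  qed
  show thesis
  proof (rule shrink[OF B I sub mem ring new scale div])
    fix q assume "q \<in> Collect (t_step B)" "\<And>a. a \<in> I \<Longrightarrow> a \<otimes> q \<in> B"
    then show thesis
      using that by simp
  qed assumption+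
qed

lemma n_one_minus_unit:
  assumes "B \<in> L" "x \<in> B" "x \<in> n"
  shows "\<exists>u \<in> B. (\<one> \<ominus> x) \<otimes> u = \<one>"
  using n_nilpotent[OF assms(3)] nilpotent_unit[OF assms(1,2)] by blast

text \<open>
  Idempotent modulo \<open>n\<close>, and not one of the two trivial idempotents of \<open>N / n\<close>.
\<close>
definition idem_mod :: "'a \<Rightarrow> bool" where
  "idem_mod e \<longleftrightarrow> e \<in> carrier S \<and> e \<notin> N \<and> e \<otimes> e \<ominus> e \<in> n \<and> (\<forall>p \<in> n. p \<otimes> e \<in> n)"

lemma idem_mod_complement:
  assumes e: "idem_mod e"
  shows "idem_mod (\<one> \<ominus> e)" "adjoin N N (\<one> \<ominus> e) = adjoin N N e"
proof -
  have [simp]: "e \<in> carrier S"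
    using e by (simp add: idem_mod_def)
  have *: "adjoin N N (\<one> \<ominus> d) \<subseteq> adjoin N N d" if [simp]: "d \<in> carrier S" for d
  proof
    fix u assume "u \<in> adjoin N N (\<one> \<ominus> d)"
    then obtain a b where ab: "a \<in> N" "b \<in> N" "u = a \<oplus> b \<otimes> (\<one> \<ominus> d)"
      by (rule adjoinE)
    show "u \<in> adjoin N N d"
    proof (rule adjoinI)
      show "u = (a \<oplus> b) \<oplus> (\<ominus> b) \<otimes> d"
        unfolding ab(3) using L_carrier[OF N_L ab(1)] L_carrier[OF N_L ab(2)] by - (rule poly_eqI[of "[a,b,d]"], (rule poly_reify)+, simp_all add: poly_simps)
    qed (use ab in simp_all)
  qed
  have e1: "\<one> \<ominus> (\<one> \<ominus> e) = e"
    by - (rule poly_eqI[of "[e]"], (rule poly_reify)+, simp_all add: poly_simps)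
  show "adjoin N N (\<one> \<ominus> e) = adjoin N N e"
    using *[of e] *[of "\<one> \<ominus> e"] by (simp add: e1)
  have "\<one> \<ominus> e \<notin> N"
  proof
    assume "\<one> \<ominus> e \<in> N"
    then have "\<one> \<ominus> (\<one> \<ominus> e) \<in> N"
      by simp
    then show False
      using e by (simp add: e1 idem_mod_def)
  qed
  moreover have "(\<one> \<ominus> e) \<otimes> (\<one> \<ominus> e) \<ominus> (\<one> \<ominus> e) = e \<otimes> e \<ominus> e"
    by - (rule poly_eqI[of "[e]"], (rule poly_reify)+, simp_all add: poly_simps)
  moreover have "p \<otimes> (\<one> \<ominus> e) \<in> n" if p: "p \<in> n" for p
  proof -
    have "p \<otimes> (\<one> \<ominus> e) = p \<ominus> p \<otimes> e"
      using n_carrier[OF p] by - (rule poly_eqI[of "[p,e]"], (rule poly_reify)+, simp_all add: poly_simps)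
    then show ?thesis
      using n_closed(4)[OF p, of "p \<otimes> e"] e p by (simp add: idem_mod_def)
  qed
  ultimately show "idem_mod (\<one> \<ominus> e)"
    using e by (simp add: idem_mod_def)
qed

context
  fixes e
  assumes e: "idem_mod e"
begin

lemma e_facts: shows e_carrier [simp]: "e \<in> carrier S" and e_N: "e \<notin> N" and e_idem: "e \<otimes> e \<ominus> e \<in> n"
  and n_e: "p \<in> n \<Longrightarrow> p \<otimes> e \<in> n"
  using e by (simp_all add: idem_mod_def)

lemma Ne_L: "adjoin N N e \<in> L"
  using quadratic_adjoin_L[OF N_L e_carrier, of \<one>] n_closed(2)[OF e_idem] by simp

lemma n_Ne: "sub_ideal n (adjoin N N e)"
  unfolding sub_ideal_def
proof (intro conjI ballI)
  show "n \<subseteq> adjoin N N e"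
    using n_closed(2) adjoin_base[OF N_L N_L e_carrier] by blast
  fix b p assume b: "b \<in> adjoin N N e" and p: "p \<in> n"
  obtain \<alpha> \<beta> where ab: "\<alpha> \<in> N" "\<beta> \<in> N" "b = \<alpha> \<oplus> \<beta> \<otimes> e"
    using b by (rule adjoinE)
  have "b \<otimes> p = \<alpha> \<otimes> p \<oplus> \<beta> \<otimes> (p \<otimes> e)"
    unfolding ab(3) using L_carrier[OF N_L ab(1)] L_carrier[OF N_L ab(2)] n_carrier[OF p] by - (rule poly_eqI[of "[\<alpha>,\<beta>,p,e]"], (rule poly_reify)+, simp_all add: poly_simps)
  then show "b \<otimes> p \<in> n"
    using n_closed(3)[OF n_closed(6)[OF ab(1) p] n_closed(6)[OF ab(2) n_e[OF p]]] by simp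
qed (use n_closed in auto)

lemmas Ne_n_closed = sub_ideal_closed[OF n_Ne Ne_L]

lemma e_scalar_N: "b \<in> N \<Longrightarrow> b \<otimes> e \<in> N \<Longrightarrow> b \<in> n"
proof (rule ccontr)
  assume b: "b \<in> N" "b \<otimes> e \<in> N" "b \<notin> n"
  then obtain u where u: "u \<in> N" "b \<otimes> u = \<one>"
    using n_unit by blast
  have "u \<otimes> (b \<otimes> e) = b \<otimes> u \<otimes> e"
    using L_carrier[OF N_L b(1)] L_carrier[OF N_L u(1)] by - (rule poly_eqI[of "[u,b,e]"], (rule poly_reify)+, simp_all add: poly_simps)
  then have "u \<otimes> (b \<otimes> e) = e"
    unfolding u(2) by simp
  then show False
    using L_closed(5)[OF N_L u(1) b(2)] e_N by simp
qed

text \<open>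
  The quotient of \<open>N + N e\<close> by \<open>n\<close> is the product of two copies of the residue field; \<open>\<rho>\<close> represents
  the component of \<open>u\<close> that belongs to \<open>e\<close>.
\<close>
lemma e_component:
  assumes u: "u \<in> adjoin N N e"
  obtains \<rho> where "\<rho> \<in> N" "e \<otimes> u \<ominus> \<rho> \<otimes> e \<in> n"
proof -
  obtain \<alpha> \<beta> where ab: "\<alpha> \<in> N" "\<beta> \<in> N" "u = \<alpha> \<oplus> \<beta> \<otimes> e"
    using u by (rule adjoinE)
  have "e \<otimes> u \<ominus> (\<alpha> \<oplus> \<beta>) \<otimes> e = \<beta> \<otimes> (e \<otimes> e \<ominus> e)"
    unfolding ab(3) using L_carrier[OF N_L ab(1)] L_carrier[OF N_L ab(2)] by - (rule poly_eqI[of "[\<alpha>,\<beta>,e]"], (rule poly_reify)+, simp_all add: poly_simps)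
  then show thesis
    using that[of "\<alpha> \<oplus> \<beta>"] ab(1,2) n_closed(6)[OF ab(2) e_idem] by simp
qed

text \<open>
  Modulo \<open>n\<close>, the element \<open>g\<close> would be an idempotent with \<open>e g = g\<close> and \<open>g\<close> different from \<open>0\<close> and \<open>e\<close>;
  then \<open>g\<close> and \<open>e - g\<close>, whose sum is \<open>e\<close>, are an independent pair.
\<close>
lemma no_third_idempotent:
  assumes g: "g \<in> carrier S" "g \<notin> adjoin N N e" "g \<otimes> g \<ominus> g \<in> n" "e \<otimes> g \<ominus> g \<in> n"
    and ng: "\<And>p. p \<in> n \<Longrightarrow> p \<otimes> g \<in> n"
  shows False
proof -
  note [simp] = g(1)
  let ?h = "e \<ominus> g"
  note nN = n_closed(2)
  show False
  proof (rule no_independent_pair[OF N_L g(1), of ?h n])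
    show "adjoin N N g \<in> L"
      using quadratic_adjoin_L[OF N_L g(1), of \<one>] nN[OF g(3)] by simp
    have "?h \<otimes> ?h \<ominus> \<one> \<otimes> ?h = ((e \<otimes> e \<ominus> e) \<ominus> ((e \<otimes> g \<ominus> g) \<oplus> (e \<otimes> g \<ominus> g))) \<oplus> (g \<otimes> g \<ominus> g)"
      by - (rule poly_eqI[of "[e,g]"], (rule poly_reify)+, simp_all add: poly_simps)
    also have "\<dots> \<in> n"
      by (rule n_closed(3)[OF n_closed(4)[OF e_idem n_closed(3)[OF g(4,4)]] g(3)])
    finally show "adjoin N N ?h \<in> L"
      using nN by (intro quadratic_adjoin_L[OF N_L, of _ \<one>]) simp_all
    have "g \<oplus> ?h = e"
      by - (rule poly_eqI[of "[e,g]"], (rule poly_reify)+, simp_all add: poly_simps)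
    then show "adjoin N N (g \<oplus> ?h) \<in> L"
      using Ne_L by simp
    show "p \<otimes> g \<in> N" "p \<otimes> ?h \<in> N" if p: "p \<in> n" for p
    proof -
      show "p \<otimes> g \<in> N"
        using ng[OF p] nN by blast
      have "p \<otimes> ?h = p \<otimes> e \<ominus> p \<otimes> g"
        using n_carrier[OF p] by - (rule poly_eqI[of "[p,e,g]"], (rule poly_reify)+, simp_all add: poly_simps)
      then show "p \<otimes> ?h \<in> N"
        using n_closed(4)[OF n_e[OF p] ng[OF p]] nN by simp
    qed
    show "\<one> \<notin> n"
      by (rule one_n)
    fix \<beta> \<gamma> assume bc: "\<beta> \<in> N" "\<gamma> \<in> N" "\<beta> \<otimes> g \<oplus> \<gamma> \<otimes> ?h \<in> N"
    have [simp]: "\<beta> \<in> carrier S" "\<gamma> \<in> carrier S"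
      using bc L_carrier[OF N_L] by auto
    define a where "a = \<beta> \<otimes> g \<oplus> \<gamma> \<otimes> ?h"
    have aN: "a \<in> N" and [simp]: "a \<in> carrier S"
      using bc by (simp_all add: a_def)
    have d: "\<beta> \<ominus> \<gamma> \<in> n"
    proof (rule ccontr)
      assume "\<beta> \<ominus> \<gamma> \<notin> n"
      then obtain u where u: "u \<in> N" "(\<beta> \<ominus> \<gamma>) \<otimes> u = \<one>"
        using n_unit[of "\<beta> \<ominus> \<gamma>"] bc by auto
      have [simp]: "u \<in> carrier S"
        using u L_carrier[OF N_L] by blast
      have "u \<otimes> a \<oplus> (\<ominus> (u \<otimes> \<gamma>)) \<otimes> e = (\<beta> \<ominus> \<gamma>) \<otimes> u \<otimes> g"
        unfolding a_def by - (rule poly_eqI[of "[u,\<gamma>,\<beta>,e,g]"], (rule poly_reify)+, simp_all add: poly_simps)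
      then have "g = u \<otimes> a \<oplus> (\<ominus> (u \<otimes> \<gamma>)) \<otimes> e"
        unfolding u(2) by simp
      then have "g \<in> adjoin N N e"
        using u(1) aN bc(2) by (intro adjoinI[of "u \<otimes> a" N "\<ominus> (u \<otimes> \<gamma>)"]) simp_all
      then show False
        using g(2) by simp
    qed
    have "a \<ominus> (\<beta> \<ominus> \<gamma>) \<otimes> g = \<gamma> \<otimes> e"
      unfolding a_def by - (rule poly_eqI[of "[\<gamma>,\<beta>,e,g]"], (rule poly_reify)+, simp_all add: poly_simps)
    then have "\<gamma> \<otimes> e \<in> N"
      using L_closed(6)[OF N_L aN nN[OF ng[OF d]]] by simp
    then have c: "\<gamma> \<in> n"
      by (rule e_scalar_N[OF bc(2)])
    have "(\<beta> \<ominus> \<gamma>) \<oplus> \<gamma> = \<beta>"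
      by - (rule poly_eqI[of "[\<gamma>,\<beta>]"], (rule poly_reify)+, simp_all add: poly_simps)
    then show "\<beta> \<in> n \<and> \<gamma> \<in> n"
      using n_closed(3)[OF d c] c by simp
  qed simp
qed

text \<open>
  Otherwise the conductor of \<open>q\<close> in \<open>N + N e\<close> vanishes at \<open>e\<close> (\<open>conductor\<close>). Hence \<open>b = e\<^sup>2 q\<close>
  satisfies \<open>n b \<subseteq> n\<close>, \<open>e b = b\<close> and \<open>b\<^sup>2 = \<rho> b\<close> modulo \<open>n\<close>. If \<open>\<rho> \<in> n\<close>, seminormality gives \<open>b \<in> N\<close>;
  otherwise \<open>b / \<rho>\<close> is a third idempotent.
\<close>
lemma Ne_no_step:
  assumes q: "t_step (adjoin N N e) q" and nq: "\<And>a. a \<in> n \<Longrightarrow> a \<otimes> q \<in> adjoin N N e"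
  shows "e \<otimes> q \<in> adjoin N N e"
proof (rule ccontr)
  let ?B = "adjoin N N e"
  assume eq: "e \<otimes> q \<notin> ?B"
  note B = Ne_L and nB = Ne_n_closed
  note Bc = L_carrier[OF B]
  have eB: "e \<in> ?B"
    using adjoin_gen[OF N_L N_L e_carrier] .
  have NB: "x \<in> N \<Longrightarrow> x \<in> ?B" for x
    using adjoin_base[OF N_L N_L e_carrier] by blast
  obtain r where r: "r \<in> ?B" "q \<otimes> q \<ominus> r \<otimes> q \<in> ?B" "(q \<otimes> q \<ominus> r \<otimes> q) \<otimes> q \<in> ?B" and [simp]: "q \<in> carrier S"
    using q by (auto simp: t_step_def)
  define c where "c = q \<otimes> q \<ominus> r \<otimes> q"
  have c: "c \<in> ?B" "c \<otimes> q \<in> ?B"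
    using r by (simp_all add: c_def)
  have [simp]: "r \<in> carrier S" "c \<in> carrier S"
    using r c Bc by auto
  have conductor: "e \<otimes> u \<in> n" if u: "u \<in> ?B" "u \<otimes> q \<in> ?B" for u
  proof (rule e_component[OF u(1)])
    fix \<rho> assume \<rho>: "\<rho> \<in> N" "e \<otimes> u \<ominus> \<rho> \<otimes> e \<in> n"
    have [simp]: "u \<in> carrier S" "\<rho> \<in> carrier S"
      using u \<rho> Bc L_carrier[OF N_L] by auto
    have "\<rho> \<in> n"
    proof (rule ccontr)
      assume "\<rho> \<notin> n"
      then obtain v where v: "v \<in> N" "\<rho> \<otimes> v = \<one>"
        using n_unit \<rho>(1) by blast
      have [simp]: "v \<in> carrier S"
        using v L_carrier[OF N_L] by blast
      have "v \<otimes> (e \<otimes> (u \<otimes> q)) \<ominus> v \<otimes> ((e \<otimes> u \<ominus> \<rho> \<otimes> e) \<otimes> q) = \<rho> \<otimes> v \<otimes> (e \<otimes> q)"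
        by - (rule poly_eqI[of "[v,e,u,q,\<rho>]"], (rule poly_reify)+, simp_all add: poly_simps)
      then have "v \<otimes> (e \<otimes> (u \<otimes> q)) \<ominus> v \<otimes> ((e \<otimes> u \<ominus> \<rho> \<otimes> e) \<otimes> q) = e \<otimes> q"
        unfolding v(2) by simp
      moreover have "v \<otimes> (e \<otimes> (u \<otimes> q)) \<ominus> v \<otimes> ((e \<otimes> u \<ominus> \<rho> \<otimes> e) \<otimes> q) \<in> ?B"
        using L_closed(6)[OF B L_closed(5)[OF B NB[OF v(1)] L_closed(5)[OF B eB u(2)]]
            L_closed(5)[OF B NB[OF v(1)] nq[OF \<rho>(2)]]] .
      ultimately show False
        using eq by simp
    qed
    then have "(e \<otimes> u \<ominus> \<rho> \<otimes> e) \<oplus> \<rho> \<otimes> e \<in> n"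
      using n_closed(3)[OF \<rho>(2) n_e] by blast
    moreover have "(e \<otimes> u \<ominus> \<rho> \<otimes> e) \<oplus> \<rho> \<otimes> e = e \<otimes> u"
      by - (rule poly_eqI[of "[e,u,\<rho>]"], (rule poly_reify)+, simp_all add: poly_simps)
    ultimately show "e \<otimes> u \<in> n"
      by simp
  qed
  have enq: "e \<otimes> (a \<otimes> q) \<in> n" if a: "a \<in> n" for a
  proof (rule conductor[OF nq[OF a]])
    have [simp]: "a \<in> carrier S"
      using n_carrier[OF a] .
    have "a \<otimes> q \<otimes> q = r \<otimes> (a \<otimes> q) \<oplus> a \<otimes> c"
      unfolding c_def by - (rule poly_eqI[of "[a,q,r]"], (rule poly_reify)+, simp_all add: poly_simps)
    then show "a \<otimes> q \<otimes> q \<in> ?B"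
      using L_closed(4)[OF B L_closed(5)[OF B r(1) nq[OF a]] L_closed(5)[OF B nB(2)[OF a] c(1)]] by simp
  qed
  define b where "b = e \<otimes> e \<otimes> q"
  define f where "f = e \<otimes> e \<ominus> e"
  have f: "f \<in> n" and [simp]: "f \<in> carrier S" and bc [simp]: "b \<in> carrier S"
    using e_idem by (simp_all add: f_def b_def)
  have bB: "b \<notin> ?B"
  proof
    assume "b \<in> ?B"
    then have "b \<ominus> f \<otimes> q \<in> ?B"
      using L_closed(6)[OF B _ nq[OF f]] by blast
    moreover have "b \<ominus> f \<otimes> q = e \<otimes> q"
      unfolding b_def f_def by - (rule poly_eqI[of "[e,q]"], (rule poly_reify)+, simp_all add: poly_simps)
    ultimately show False
      using eq by simp
  qed
  have nb: "a \<otimes> b \<in> n" if a: "a \<in> n" for a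
  proof -
    have "a \<otimes> b = e \<otimes> (e \<otimes> (a \<otimes> q))"
      unfolding b_def using n_carrier[OF a] by - (rule poly_eqI[of "[a,e,q]"], (rule poly_reify)+, simp_all add: poly_simps)
    then show ?thesis
      using nB(6)[OF eB enq[OF a]] by simp
  qed
  have eb: "e \<otimes> b \<ominus> b \<in> n"
  proof -
    have "e \<otimes> b \<ominus> b = e \<otimes> (f \<otimes> q)"
      unfolding b_def f_def by - (rule poly_eqI[of "[e,q]"], (rule poly_reify)+, simp_all add: poly_simps)
    then show ?thesis
      using enq[OF f] by simp
  qed
  have ec: "e \<otimes> c \<in> n"
    using conductor[OF c] .
  obtain \<rho> where \<rho>: "\<rho> \<in> N" "e \<otimes> r \<ominus> \<rho> \<otimes> e \<in> n"
    using e_component[OF r(1)] by blast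
  have [simp]: "\<rho> \<in> carrier S"
    using \<rho> L_carrier[OF N_L] by blast
  have quad: "b \<otimes> b \<ominus> \<rho> \<otimes> b \<in> n"
  proof -
    have "b \<otimes> b \<ominus> \<rho> \<otimes> b = e \<otimes> e \<otimes> e \<otimes> (e \<otimes> c) \<oplus> (e \<otimes> ((e \<otimes> r \<ominus> \<rho> \<otimes> e) \<otimes> b)
        \<oplus> \<rho> \<otimes> (e \<otimes> (e \<otimes> b \<ominus> b) \<oplus> (e \<otimes> b \<ominus> b)))"
      unfolding b_def c_def by - (rule poly_eqI[of "[e,q,r,\<rho>]"], (rule poly_reify)+, simp_all add: poly_simps)
    also have "\<dots> \<in> n"
      by (rule n_closed(3)[OF nB(6)[OF _ ec] n_closed(3)[OF nB(6)[OF eB nb[OF \<rho>(2)]]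
            n_closed(6)[OF \<rho>(1) n_closed(3)[OF nB(6)[OF eB eb] eb]]]])
        (use eB B in simp)
    finally show ?thesis .
  qed
  show False
  proof (cases "\<rho> \<in> n")
    case True
    have "(b \<otimes> b \<ominus> \<rho> \<otimes> b) \<oplus> \<rho> \<otimes> b = b \<otimes> b"
      by - (rule poly_eqI[of "[b,\<rho>]"], (rule poly_reify)+, simp_all add: poly_simps)
    then have bb: "b \<otimes> b \<in> n"
      using n_closed(3)[OF quad nb[OF True]] by simp
    have "b \<in> N"
      using N_closed[OF bc n_closed(2)[OF bb] n_closed(2)[OF nb[OF bb]]] .
    then show False
      using bB NB by blast
  next
    case False
    then obtain v where v: "v \<in> N" "\<rho> \<otimes> v = \<one>"
      using n_unit \<rho>(1) by blast
    have [simp]: "v \<in> carrier S"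
      using v L_carrier[OF N_L] by blast
    define g where "g = v \<otimes> b"
    have "\<rho> \<otimes> g = \<rho> \<otimes> v \<otimes> b"
      unfolding g_def by - (rule poly_eqI[of "[\<rho>,v,b]"], (rule poly_reify)+, simp_all add: poly_simps)
    then have \<rho>g: "\<rho> \<otimes> g = b"
      unfolding v(2) by simp
    show False
    proof (rule no_third_idempotent[of g])
      show "g \<in> carrier S"
        by (simp add: g_def)
      show "g \<notin> ?B"
        using L_closed(5)[OF B NB[OF \<rho>(1)], of g] \<rho>g bB by auto
      have "g \<otimes> g \<ominus> (\<rho> \<otimes> v) \<otimes> g = v \<otimes> v \<otimes> (b \<otimes> b \<ominus> \<rho> \<otimes> b)"
        unfolding g_def by - (rule poly_eqI[of "[v,b,\<rho>]"], (rule poly_reify)+, simp_all add: poly_simps)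
      then show "g \<otimes> g \<ominus> g \<in> n"
        unfolding v(2) using n_closed(6)[OF _ quad, of "v \<otimes> v"] v(1) by (simp add: g_def)
      have "e \<otimes> g \<ominus> g = v \<otimes> (e \<otimes> b \<ominus> b)"
        unfolding g_def by - (rule poly_eqI[of "[v,b,e]"], (rule poly_reify)+, simp_all add: poly_simps)
      then show "e \<otimes> g \<ominus> g \<in> n"
        using n_closed(6)[OF v(1) eb] by simp
      fix p assume p: "p \<in> n"
      have "p \<otimes> g = v \<otimes> (p \<otimes> b)"
        unfolding g_def using n_carrier[OF p] by - (rule poly_eqI[of "[v,b,p]"], (rule poly_reify)+, simp_all add: poly_simps)
      then show "p \<otimes> g \<in> n"
        using n_closed(6)[OF v(1) nb[OF p]] by simp
    qed
  qed
qed

end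

text \<open>
  \<open>N + N e\<close> is t-closed: a shrunk step \<open>q\<close> would have both \<open>e q\<close> and \<open>(1 - e) q\<close> in \<open>N + N e\<close>.
\<close>
lemma T_eq_Ne:
  assumes e: "idem_mod e"
  shows "T = adjoin N N e"
proof -
  let ?B = "adjoin N N e"
  note e' = idem_mod_complement[OF e]
  have B: "?B \<in> L"
    using Ne_L[OF e] .
  have [simp]: "e \<in> carrier S"
    using e by (simp add: idem_mod_def)
  have eT: "e \<in> T"
  proof (rule T_closed[of e \<one>])
    have n: "e \<otimes> e \<ominus> e \<in> n"
      using e_idem[OF e] .
    then show "e \<otimes> e \<ominus> \<one> \<otimes> e \<in> T" "(e \<otimes> e \<ominus> \<one> \<otimes> e) \<otimes> e \<in> T"
      using n_closed(2)[OF n] n_closed(2)[OF n_e[OF e n]] N_T by auto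
  qed simp_all
  have BT: "?B \<subseteq> T"
    using adjoin_least[OF T_L N_T N_T eT] .
  show ?thesis
  proof (rule ccontr)
    assume "T \<noteq> ?B"
    then obtain b where "t_step ?B b"
      using T_reach[OF B BT] by blast
    then obtain q where q: "t_step ?B q" "\<And>a. a \<in> n \<Longrightarrow> a \<otimes> q \<in> ?B"
    proof (rule t_step_shrink[OF B n_Ne[OF e]])
      show "\<exists>u \<in> ?B. (\<one> \<ominus> a) \<otimes> u = \<one>" if "a \<in> n" for a
        using n_one_minus_unit[OF B Ne_n_closed(2)[OF e that] that] .
    qed blast
    have [simp]: "q \<in> carrier S" and qB: "q \<notin> ?B"
      using q(1) by (auto simp: t_step_def)
    have "e \<otimes> q \<in> ?B"
      using Ne_no_step[OF e q] .
    moreover have "(\<one> \<ominus> e) \<otimes> q \<in> ?B"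
      using Ne_no_step[OF e'(1)] q unfolding e'(2) by blast
    ultimately have "e \<otimes> q \<oplus> (\<one> \<ominus> e) \<otimes> q \<in> ?B"
      using B by simp
    moreover have "e \<otimes> q \<oplus> (\<one> \<ominus> e) \<otimes> q = q"
      by - (rule poly_eqI[of "[e,q]"], (rule poly_reify)+, simp_all add: poly_simps)
    ultimately show False
      using qB by simp
  qed
qed

text \<open>
  A step over \<open>N\<close> is not ramified, because \<open>N\<close> is seminormal.
\<close>
lemma idem_mod_exists:
  assumes "N \<noteq> T"
  obtains e where "idem_mod e"
proof -
  obtain b0 where b0: "b0 \<in> T" "t_step N b0"
    using T_reach[OF N_L N_T assms] by blast
  have "b0 \<in> carrier S"
    using b0 by (simp add: t_step_def)
  show thesis
  proof (rule t_step_types[OF resid_local_at[OF resid_N] \<open>b0 \<in> carrier S\<close> b0(2)])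
    fix b assume b: "b \<in> carrier S" "b \<notin> N" "\<And>p. p \<in> n \<Longrightarrow> p \<otimes> b \<in> n" "b \<otimes> b \<in> n \<or> b \<otimes> b \<ominus> b \<in> n"
    have "b \<otimes> b \<notin> n"
      using N_closed[OF b(1) n_closed(2) n_closed(2)[OF b(3)]] b(2) by blast
    then show thesis
      using that[of b] b by (simp add: idem_mod_def)
  qed
qed

section \<open>The case of a local t-closure\<close>

lemma R_n: "r \<in> R \<Longrightarrow> r \<in> n \<Longrightarrow> r \<in> m"
  using n_nilpotent resid_ideal_eq[OF resid_R] by blast

text \<open>
  \<open>1 - b\<close> is invertible in \<open>R + R b\<close>, and \<open>b = - (b\<^sup>2 - b) (1 - b)\<^sup>-\<^sup>1\<close>, while \<open>b\<^sup>2 - b\<close> multiplies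
  \<open>R + R b\<close> into \<open>R\<close>.
\<close>
lemma u_step_mem:
  assumes b: "b \<in> carrier S" "b \<otimes> b \<ominus> b \<in> R" "(b \<otimes> b \<ominus> b) \<otimes> b \<in> R" and bn: "b \<in> n"
  shows "b \<in> R"
proof -
  note [simp] = b(1)
  let ?A = "adjoin R R b"
  have A: "?A \<in> L"
    using quadratic_adjoin_L[OF R_L b(1), of \<one>] b(2) by simp
  have "b \<in> ?A"
    using adjoin_gen[OF R_L R_L b(1)] .
  then obtain u where u: "u \<in> ?A" "(\<one> \<ominus> b) \<otimes> u = \<one>"
    using n_one_minus_unit[OF A _ bn] by blast
  obtain \<alpha> \<beta> where ab: "\<alpha> \<in> R" "\<beta> \<in> R" "u = \<alpha> \<oplus> \<beta> \<otimes> b"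
    using u(1) by (rule adjoinE)
  have [simp]: "\<alpha> \<in> carrier S" "\<beta> \<in> carrier S"
    using ab L_carrier[OF R_L] by auto
  have "\<ominus> ((b \<otimes> b \<ominus> b) \<otimes> \<alpha> \<oplus> \<beta> \<otimes> ((b \<otimes> b \<ominus> b) \<otimes> b)) = b \<otimes> ((\<one> \<ominus> b) \<otimes> u)"
    unfolding ab(3) by - (rule poly_eqI[of "[b,\<alpha>,\<beta>]"], (rule poly_reify)+, simp_all add: poly_simps)
  also have "\<dots> = b"
    unfolding u(2) by simp
  finally have eq: "\<ominus> ((b \<otimes> b \<ominus> b) \<otimes> \<alpha> \<oplus> \<beta> \<otimes> ((b \<otimes> b \<ominus> b) \<otimes> b)) = b" .
  have "\<ominus> ((b \<otimes> b \<ominus> b) \<otimes> \<alpha> \<oplus> \<beta> \<otimes> ((b \<otimes> b \<ominus> b) \<otimes> b)) \<in> R"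
    using L_closed(3)[OF R_L L_closed(4)[OF R_L L_closed(5)[OF R_L b(2) ab(1)] L_closed(5)[OF R_L ab(2) b(3)]]] .
  then show ?thesis
    unfolding eq .
qed

lemma U_closed:
  "b \<in> carrier S \<Longrightarrow> b \<otimes> b \<ominus> b \<in> U \<Longrightarrow> (b \<otimes> b \<ominus> b) \<otimes> b \<in> U \<Longrightarrow> b \<in> U"
  using U_Least u_closed_iff by blast

text \<open>
  An element that violates u-closedness of \<open>R\<close> lies in the local ring \<open>T = N\<close>, so it or its complement is
  in \<open>n\<close>.
\<close>
lemma U_eq_R:
  assumes NT: "N = T"
  shows "U = R"
proof -
  have "u_closed S R"
    unfolding u_closed_iff
  proof (intro ballI impI, rule ccontr)
    fix b assume b: "b \<in> carrier S" "b \<otimes> b \<ominus> b \<in> R" "(b \<otimes> b \<ominus> b) \<otimes> b \<in> R" and bR: "b \<notin> R"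
    note [simp] = b(1)
    have "b \<in> T"
      using T_closed[of b \<one>] b L_R[OF T_L] by simp
    then have bN: "b \<in> N"
      using NT by simp
    have "b \<otimes> b \<ominus> b \<in> m"
    proof (rule ccontr)
      assume "b \<otimes> b \<ominus> b \<notin> m"
      then obtain z where z: "z \<in> R" "(b \<otimes> b \<ominus> b) \<otimes> z = \<one>"
        using R_unit b(2) by blast
      have "z \<otimes> ((b \<otimes> b \<ominus> b) \<otimes> b) = (b \<otimes> b \<ominus> b) \<otimes> z \<otimes> b"
        using L_carrier[OF R_L z(1)] by - (rule poly_eqI[of "[z,b]"], (rule poly_reify)+, simp_all add: poly_simps)
      then have "z \<otimes> ((b \<otimes> b \<ominus> b) \<otimes> b) = b"
        unfolding z(2) by simp
      then show False
        using L_closed(5)[OF R_L z(1) b(3)] bR by simp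
    qed
    then have "b \<otimes> b \<ominus> b \<in> n"
      using m_n by blast
    then have "b \<in> n \<or> \<one> \<ominus> b \<in> n"
      using P_prime_idem[OF resid_local_at[OF resid_N] bN] by blast
    then show False
    proof
      assume "b \<in> n"
      then show False
        using u_step_mem[OF b] bR by blast
    next
      assume bn: "\<one> \<ominus> b \<in> n"
      have e1: "(\<one> \<ominus> b) \<otimes> (\<one> \<ominus> b) \<ominus> (\<one> \<ominus> b) = b \<otimes> b \<ominus> b"
        by - (rule poly_eqI[of "[b]"], (rule poly_reify)+, simp_all add: poly_simps)
      have "(b \<otimes> b \<ominus> b) \<otimes> (\<one> \<ominus> b) = (b \<otimes> b \<ominus> b) \<ominus> (b \<otimes> b \<ominus> b) \<otimes> b"
        by - (rule poly_eqI[of "[b]"], (rule poly_reify)+, simp_all add: poly_simps)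
      then have 2: "((\<one> \<ominus> b) \<otimes> (\<one> \<ominus> b) \<ominus> (\<one> \<ominus> b)) \<otimes> (\<one> \<ominus> b) \<in> R"
        unfolding e1 using L_closed(6)[OF R_L b(2,3)] by simp
      have 1: "(\<one> \<ominus> b) \<otimes> (\<one> \<ominus> b) \<ominus> (\<one> \<ominus> b) \<in> R"
        unfolding e1 by (rule b(2))
      have "\<one> \<ominus> b \<in> R"
        by (rule u_step_mem[OF _ 1 2 bn]) simp
      then have "\<one> \<ominus> (\<one> \<ominus> b) \<in> R"
        by simp
      moreover have "\<one> \<ominus> (\<one> \<ominus> b) = b"
        by - (rule poly_eqI[of "[b]"], (rule poly_reify)+, simp_all add: poly_simps)
      ultimately show False
        using bR by simp
    qed
  qed
  then show ?thesis
    using U_Least R_le[OF U_L] by (meson R_L subset_antisym)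
qed

lemma comparable_T_local:
  assumes H: "H \<in> L" "H \<inter> T \<subseteq> N"
  shows "H \<subseteq> T \<or> T \<subseteq> H"
proof -
  have A: "H \<inter> T \<in> L"
    using H by simp
  show ?thesis
  proof (rule comparable[OF resid_local_at[OF sub_N_resid[OF A H(2)]] H(1) le_S[OF H(1)] T_L le_S[OF T_L] refl])
    show "\<exists>b \<in> T. t_step (H \<inter> T) b" if "H \<inter> T \<noteq> T"
      by (rule T_reach[OF A inf_le2 that])
  qed (rule T_closed)
qed

section \<open>Lifting the idempotent\<close>

text \<open>
  These are the elements that have to be in \<open>U\<close> by its definition; \<open>split_idem_exists\<close> shows that the
  idempotent modulo \<open>n\<close> can be chosen of this kind.
\<close>
definition split_idem :: "'a \<Rightarrow> bool" where
  "split_idem e \<longleftrightarrow> idem_mod e \<and> e \<otimes> e \<ominus> e \<in> R \<and> (e \<otimes> e \<ominus> e) \<otimes> e \<in> R"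

lemma n_T:
  assumes e: "idem_mod e"
  shows "sub_ideal n T"
  using n_Ne[OF e] T_eq_Ne[OF e] by simp

lemma idem_mod_T: "idem_mod e \<Longrightarrow> e \<in> T"
  using T_eq_Ne adjoin_gen[OF N_L N_L] e_carrier by metis

text \<open>
  The classical lifting \<open>e \<mapsto> 3 e\<^sup>2 - 2 e\<^sup>3\<close>: it squares the defect \<open>e\<^sup>2 - e\<close> up to a factor, and changes \<open>e\<close>
  by a multiple of the defect.
\<close>
lemma refine_idempotent:
  assumes C: "C \<in> L" and e: "e \<in> C"
  defines "f \<equiv> e \<otimes> e \<ominus> e"
  shows "\<exists>e' \<in> C. \<exists>w \<in> C. \<exists>w' \<in> C. e' \<otimes> e' \<ominus> e' = f [^] (2 ^ i :: nat) \<otimes> w \<and> e' \<ominus> e = f \<otimes> w'"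
proof (induction i)
  case 0
  have "e \<in> carrier S"
    using L_carrier[OF C e] .
  then show ?case
    using C e by (intro bexI[of _ e] bexI[of _ \<one>] bexI[of _ \<zero>]) (simp_all add: f_def a_minus_def r_neg)
next
  case (Suc i)
  obtain e' w w' where IH: "e' \<in> C" "w \<in> C" "w' \<in> C" "e' \<otimes> e' \<ominus> e' = f [^] (2 ^ i :: nat) \<otimes> w" "e' \<ominus> e = f \<otimes> w'"
    using Suc by blast
  have f: "f \<in> C"
    using C e by (simp add: f_def)
  define h where "h = f [^] (2 ^ i - 1 :: nat)"
  define g where "g = f [^] (2 ^ i :: nat)"
  have hC: "h \<in> C"
    using f C by (simp add: h_def)
  have [simp]: "e \<in> carrier S" "f \<in> carrier S" "e' \<in> carrier S" "w \<in> carrier S" "w' \<in> carrier S" "h \<in> carrier S"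
    using e f IH hC L_carrier[OF C] by auto
  have "g = f [^] Suc (2 ^ i - 1)"
    by (simp add: g_def)
  also have "\<dots> = h \<otimes> f"
    by (simp only: nat_pow_Suc h_def)
  finally have g: "g = h \<otimes> f" .
  have gg: "f [^] (2 ^ Suc i :: nat) = g \<otimes> g"
    by (simp add: g_def nat_pow_mult mult_2)
  define d where "d = e' \<otimes> e' \<ominus> e'"
  have d: "d = g \<otimes> w" and [simp]: "g \<in> carrier S"
    using IH(4) by (simp_all add: d_def g_def)
  define e2 where "e2 = (e' \<otimes> e' \<oplus> e' \<otimes> e' \<oplus> e' \<otimes> e') \<ominus> (e' \<otimes> e' \<otimes> e' \<oplus> e' \<otimes> e' \<otimes> e')"
  define c where "c = \<ominus> ((\<one> \<oplus> \<one> \<oplus> \<one> \<ominus> (e' \<oplus> e')) \<otimes> (\<one> \<oplus> (e' \<oplus> e')))"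
  define c' where "c' = \<one> \<ominus> (e' \<oplus> e')"
  have cC: "c \<in> C" "c' \<in> C" "e2 \<in> C"
    using IH C by (simp_all add: c_def c'_def e2_def)
  have [simp]: "c \<in> carrier S" "c' \<in> carrier S" "e2 \<in> carrier S"
    using cC L_carrier[OF C] by auto
  have "e2 \<otimes> e2 \<ominus> e2 = d \<otimes> d \<otimes> c"
    unfolding e2_def d_def c_def by - (rule poly_eqI[of "[e']"], (rule poly_reify)+, simp_all add: poly_simps)
  also have "\<dots> = (g \<otimes> g) \<otimes> (w \<otimes> w \<otimes> c)"
    unfolding d by - (rule poly_eqI[of "[g,w,c]"], (rule poly_reify)+, simp_all add: poly_simps)
  finally have 1: "e2 \<otimes> e2 \<ominus> e2 = f [^] (2 ^ Suc i :: nat) \<otimes> (w \<otimes> w \<otimes> c)"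
    unfolding gg .
  have "e2 \<ominus> e = d \<otimes> c' \<oplus> (e' \<ominus> e)"
    unfolding e2_def d_def c'_def by - (rule poly_eqI[of "[e,e']"], (rule poly_reify)+, simp_all add: poly_simps)
  also have "\<dots> = f \<otimes> (h \<otimes> w \<otimes> c' \<oplus> w')"
    unfolding IH(5) d g by - (rule poly_eqI[of "[h,f,w,c',w']"], (rule poly_reify)+, simp_all add: poly_simps)
  finally have 2: "e2 \<ominus> e = f \<otimes> (h \<otimes> w \<otimes> c' \<oplus> w')" .
  have "w \<otimes> w \<otimes> c \<in> C" "h \<otimes> w \<otimes> c' \<oplus> w' \<in> C"
    using IH cC hC C by simp_all
  then show ?case
    using 1 2 cC by blast
qed

text \<open>
  Some power \<open>h\<close> of \<open>f = e\<^sup>2 - e\<close> is in \<open>m\<close>, so a power \<open>h\<^sup>j\<close> multiplies \<open>R[e]\<close> into \<open>R\<close>. After \<open>i\<close> refinements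
  the defect is a multiple of \<open>f\<close> to the power \<open>2\<^sup>i\<close>, hence of \<open>h\<^sup>j\<close> if \<open>i\<close> is large.
\<close>
lemma split_idem_exists:
  assumes NT: "N \<noteq> T"
  obtains e where "split_idem e"
proof -
  obtain e where e: "idem_mod e"
    using idem_mod_exists[OF NT] by blast
  have [simp]: "e \<in> carrier S"
    using e_carrier[OF e] .
  define f where "f = e \<otimes> e \<ominus> e"
  have fn: "f \<in> n"
    using e_idem[OF e] by (simp add: f_def)
  have [simp]: "f \<in> carrier S"
    by (simp add: f_def)
  obtain k where k: "f [^] (2 ^ k :: nat) \<in> m"
    using n_nilpotent[OF fn] by blast
  define h where "h = f [^] (2 ^ k :: nat)"
  have hm: "h \<in> m" and [simp]: "h \<in> carrier S"
    using k by (simp_all add: h_def)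
  obtain C j where C: "C \<in> L" "e \<in> C" "\<And>c. c \<in> C \<Longrightarrow> c \<otimes> h [^] (j::nat) \<in> R"
    by (rule power_conducts[OF resid_local_at[OF resid_R] hm \<open>e \<in> carrier S\<close>]) (rule that; assumption)
  \<comment> \<open>Intersecting with \<open>T\<close> makes the changes \<open>f w\<close> stay in \<open>n\<close>, which is an ideal of \<open>T\<close>.\<close>
  let ?C = "C \<inter> T"
  have C': "?C \<in> L" and eC': "e \<in> ?C"
    using C idem_mod_T[OF e] by auto
  define i where "i = k + j"
  have "2 ^ k * j \<le> (2 ^ i :: nat)"
    unfolding i_def power_add using less_exp[of j] by simp
  then obtain l where l: "(2 ^ i :: nat) = 2 ^ k * j + l"
    using le_Suc_ex by blast
  have f_eq: "f [^] (2 ^ i :: nat) = h [^] j \<otimes> f [^] l"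
    unfolding l h_def by (simp add: nat_pow_mult[symmetric] nat_pow_pow)
  obtain e' w w' where e': "e' \<in> ?C" "w \<in> ?C" "w' \<in> ?C" "e' \<otimes> e' \<ominus> e' = f [^] (2 ^ i :: nat) \<otimes> w" "e' \<ominus> e = f \<otimes> w'"
    using refine_idempotent[OF C' eC', of i] unfolding f_def by blast
  have [simp]: "e' \<in> carrier S" "w \<in> carrier S" "w' \<in> carrier S"
    using e' L_carrier[OF C'] by auto
  note nT = sub_ideal_closed[OF n_T[OF e] T_L]
  have fC: "f \<in> C"
    using C(1,2) by (simp add: f_def)
  have diff: "e' \<ominus> e \<in> n"
    unfolding e'(5) using nT(7)[of w' f] e'(3) fn by blast
  define d where "d = e' \<otimes> e' \<ominus> e'"
  define x where "x = h [^] j"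
  define y where "y = f [^] l"
  have [simp]: "d \<in> carrier S" "x \<in> carrier S" "y \<in> carrier S"
    by (simp_all add: d_def x_def y_def)
  have yC: "y \<in> C"
    using fC C(1) by (simp add: y_def)
  have d_eq: "d = x \<otimes> y \<otimes> w"
    using e'(4) f_eq by (simp add: d_def x_def y_def)
  have "d = (y \<otimes> w) \<otimes> x"
    unfolding d_eq by - (rule poly_eqI[of "[x,y,w]"], (rule poly_reify)+, simp_all add: poly_simps)
  moreover have "y \<otimes> w \<in> C"
    using yC e'(2) C(1) by simp
  ultimately have dR: "d \<in> R"
    using C(3)[of "y \<otimes> w"] by (simp add: x_def)
  have "d \<otimes> e' = (y \<otimes> w \<otimes> e') \<otimes> x"
    unfolding d_eq by - (rule poly_eqI[of "[x,y,w,e']"], (rule poly_reify)+, simp_all add: poly_simps)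
  moreover have "y \<otimes> w \<otimes> e' \<in> C"
    using yC e'(1,2) C(1) by simp
  ultimately have deR: "d \<otimes> e' \<in> R"
    using C(3)[of "y \<otimes> w \<otimes> e'"] by (simp add: x_def)
  have e'N: "e' \<notin> N"
  proof
    assume "e' \<in> N"
    then have "e' \<ominus> (e' \<ominus> e) \<in> N"
      using n_closed(2)[OF diff] by simp
    moreover have "e' \<ominus> (e' \<ominus> e) = e"
      by - (rule poly_eqI[of "[e,e']"], (rule poly_reify)+, simp_all add: poly_simps)
    ultimately show False
      using e_N[OF e] by simp
  qed
  have dn: "d \<in> n"
  proof -
    define \<nu> where "\<nu> = e' \<ominus> e"
    have \<nu>: "\<nu> \<in> n" and [simp]: "\<nu> \<in> carrier S"
      using diff by (simp_all add: \<nu>_def)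
    have "d = f \<oplus> \<nu> \<otimes> (e' \<oplus> e \<ominus> \<one>)"
      unfolding d_def f_def \<nu>_def by - (rule poly_eqI[of "[e,e']"], (rule poly_reify)+, simp_all add: poly_simps)
    moreover have "e' \<oplus> e \<ominus> \<one> \<in> T"
      using e'(1) eC' by simp
    ultimately show ?thesis
      using n_closed(3)[OF fn nT(7)[OF _ \<nu>]] by simp
  qed
  have "idem_mod e'"
    unfolding idem_mod_def using e'N dn nT(7)[of e'] e'(1) by (simp add: d_def)
  then have "split_idem e'"
    unfolding split_idem_def using dR deR by (simp add: d_def)
  then show thesis
    by (rule that)
qed

lemma split_idem_complement:
  assumes e: "split_idem e"
  shows "split_idem (\<one> \<ominus> e)"
proof -
  have i: "idem_mod e" and R: "e \<otimes> e \<ominus> e \<in> R" "(e \<otimes> e \<ominus> e) \<otimes> e \<in> R"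
    using e by (simp_all add: split_idem_def)
  have [simp]: "e \<in> carrier S"
    using e_carrier[OF i] .
  have e1: "(\<one> \<ominus> e) \<otimes> (\<one> \<ominus> e) \<ominus> (\<one> \<ominus> e) = e \<otimes> e \<ominus> e"
    by - (rule poly_eqI[of "[e]"], (rule poly_reify)+, simp_all add: poly_simps)
  have "(e \<otimes> e \<ominus> e) \<otimes> (\<one> \<ominus> e) = (e \<otimes> e \<ominus> e) \<ominus> (e \<otimes> e \<ominus> e) \<otimes> e"
    by - (rule poly_eqI[of "[e]"], (rule poly_reify)+, simp_all add: poly_simps)
  then show ?thesis
    unfolding split_idem_def e1 using idem_mod_complement(1)[OF i] R L_closed(6)[OF R_L R] by simp
qed

context
  fixes e
  assumes split: "split_idem e"
begin

lemma split_facts: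
  shows split_mod: "idem_mod e" and f_R: "e \<otimes> e \<ominus> e \<in> R" and fe_R: "(e \<otimes> e \<ominus> e) \<otimes> e \<in> R"
    and split_carrier [simp]: "e \<in> carrier S"
  using split e_carrier by (auto simp: split_idem_def)

lemma nT_closed:
  "p \<in> n \<Longrightarrow> p \<in> T" "b \<in> T \<Longrightarrow> p \<in> n \<Longrightarrow> b \<otimes> p \<in> n" "b \<in> T \<Longrightarrow> p \<in> n \<Longrightarrow> p \<otimes> b \<in> n"
  using sub_ideal_closed[OF n_T[OF split_mod] T_L] by auto

lemma eT: "e \<in> T"
  using idem_mod_T[OF split_mod] .

lemma f_n: "e \<otimes> e \<ominus> e \<in> n"
  using e_idem[OF split_mod] .

lemma f_m: "e \<otimes> e \<ominus> e \<in> m"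
  using R_n f_R f_n by blast

lemma e_notin_n: "e \<notin> n"
  using e_N[OF split_mod] n_closed(2) by blast

text \<open>
  As \<open>e_component\<close>, with the representative chosen in \<open>R\<close>.
\<close>
lemma component_R:
  assumes u: "u \<in> T"
  obtains \<rho> where "\<rho> \<in> R" "e \<otimes> u \<ominus> \<rho> \<otimes> e \<in> n" "\<rho> \<in> m \<longleftrightarrow> e \<otimes> u \<in> n"
proof -
  have "u \<in> adjoin N N e"
    using u T_eq_Ne[OF split_mod] by simp
  then obtain \<sigma> where \<sigma>: "\<sigma> \<in> N" "e \<otimes> u \<ominus> \<sigma> \<otimes> e \<in> n"
    by (rule e_component[OF split_mod])
  obtain \<rho> where \<rho>: "\<rho> \<in> R" "\<sigma> \<ominus> \<rho> \<in> n"
    using N_decompose[OF \<sigma>(1)] by blast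
  have [simp]: "u \<in> carrier S" "\<sigma> \<in> carrier S" "\<rho> \<in> carrier S"
    using u \<sigma>(1) \<rho>(1) L_carrier[OF T_L] L_carrier[OF N_L] L_carrier[OF R_L] by auto
  have "e \<otimes> u \<ominus> \<rho> \<otimes> e = (e \<otimes> u \<ominus> \<sigma> \<otimes> e) \<oplus> (\<sigma> \<ominus> \<rho>) \<otimes> e"
    by - (rule poly_eqI[of "[e,u,\<rho>,\<sigma>]"], (rule poly_reify)+, simp_all add: poly_simps)
  then have 1: "e \<otimes> u \<ominus> \<rho> \<otimes> e \<in> n"
    using n_closed(3)[OF \<sigma>(2) nT_closed(3)[OF eT \<rho>(2)]] by simp
  have 2: "\<rho> \<in> m \<longleftrightarrow> e \<otimes> u \<in> n"
  proof
    assume "\<rho> \<in> m"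
    then have "\<rho> \<otimes> e \<in> n"
      using m_n nT_closed(3)[OF eT] by blast
    then have "(e \<otimes> u \<ominus> \<rho> \<otimes> e) \<oplus> \<rho> \<otimes> e \<in> n"
      using n_closed(3)[OF 1] by blast
    moreover have "(e \<otimes> u \<ominus> \<rho> \<otimes> e) \<oplus> \<rho> \<otimes> e = e \<otimes> u"
      by - (rule poly_eqI[of "[e,u,\<rho>]"], (rule poly_reify)+, simp_all add: poly_simps)
    ultimately show "e \<otimes> u \<in> n"
      by simp
  next
    assume "e \<otimes> u \<in> n"
    then have "e \<otimes> u \<ominus> (e \<otimes> u \<ominus> \<rho> \<otimes> e) \<in> n"
      using n_closed(4)[OF _ 1] by blast
    moreover have "e \<otimes> u \<ominus> (e \<otimes> u \<ominus> \<rho> \<otimes> e) = \<rho> \<otimes> e"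
      by - (rule poly_eqI[of "[e,u,\<rho>]"], (rule poly_reify)+, simp_all add: poly_simps)
    ultimately have "\<rho> \<otimes> e \<in> N"
      using n_closed(2) by simp
    then show "\<rho> \<in> m"
      using e_scalar_N[OF split_mod L_R[OF N_L \<rho>(1)]] R_n[OF \<rho>(1)] by blast
  qed
  show thesis
    by (rule that[OF \<rho>(1) 1 2])
qed

lemma T_decompose:
  assumes x: "x \<in> T"
  obtains \<rho> \<sigma> \<nu> where "\<rho> \<in> R" "\<sigma> \<in> R" "\<nu> \<in> n" "x = \<rho> \<oplus> \<sigma> \<otimes> e \<oplus> \<nu>"
proof -
  have "x \<in> adjoin N N e"
    using x T_eq_Ne[OF split_mod] by simp
  then obtain a b where ab: "a \<in> N" "b \<in> N" "x = a \<oplus> b \<otimes> e"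
    by (rule adjoinE)
  obtain \<rho> \<sigma> where rs: "\<rho> \<in> R" "a \<ominus> \<rho> \<in> n" "\<sigma> \<in> R" "b \<ominus> \<sigma> \<in> n"
    using N_decompose[OF ab(1)] N_decompose[OF ab(2)] by blast
  have [simp]: "a \<in> carrier S" "b \<in> carrier S" "\<rho> \<in> carrier S" "\<sigma> \<in> carrier S"
    using ab rs L_carrier[OF N_L] L_carrier[OF R_L] by auto
  have "x = \<rho> \<oplus> \<sigma> \<otimes> e \<oplus> ((a \<ominus> \<rho>) \<oplus> (b \<ominus> \<sigma>) \<otimes> e)"
    unfolding ab(3) by - (rule poly_eqI[of "[a,b,\<rho>,\<sigma>,e]"], (rule poly_reify)+, simp_all add: poly_simps)
  then show thesis
    using that[OF rs(1,3) n_closed(3)[OF rs(2) nT_closed(3)[OF eT rs(4)]]] by blast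
qed

text \<open>
  The coefficient \<open>\<sigma>\<close> of \<open>e\<close> in \<open>x = \<rho> + \<sigma> e + \<nu>\<close> is a unit of \<open>R\<close> because \<open>x \<notin> N\<close>.
\<close>
lemma e_in_ring:
  assumes H: "H \<in> L" and x: "x \<in> H" "x \<in> T" "x \<notin> N" and nH: "n \<subseteq> H \<or> x \<in> adjoin R R e"
  shows "e \<in> H"
proof -
  obtain \<rho> \<sigma> \<nu> where d: "\<rho> \<in> R" "\<sigma> \<in> R" "\<nu> \<in> n" "\<nu> \<in> H" "x = \<rho> \<oplus> \<sigma> \<otimes> e \<oplus> \<nu>"
  proof (cases "n \<subseteq> H")
    case True
    show thesis
    proof (rule T_decompose[OF x(2)])
      fix \<rho> \<sigma> \<nu> assume "\<rho> \<in> R" "\<sigma> \<in> R" "\<nu> \<in> n" "x = \<rho> \<oplus> \<sigma> \<otimes> e \<oplus> \<nu>"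
      then show thesis
        using that[of \<rho> \<sigma> \<nu>] True by (simp add: subset_iff)
    qed
  next
    case False
    then have "x \<in> adjoin R R e"
      using nH by simp
    then obtain a b where ab: "a \<in> R" "b \<in> R" "x = a \<oplus> b \<otimes> e"
      by (rule adjoinE)
    then have "x = a \<oplus> b \<otimes> e \<oplus> \<zero>"
      using L_carrier[OF R_L] by simp
    then show thesis
      using that[OF ab(1,2) n_closed(1)] H by simp
  qed
  have [simp]: "\<rho> \<in> carrier S" "\<sigma> \<in> carrier S" "\<nu> \<in> carrier S"
    using d n_carrier L_carrier[OF R_L] by auto
  have "\<sigma> \<notin> m"
  proof
    assume "\<sigma> \<in> m"
    then have "\<sigma> \<otimes> e \<in> N"
      using m_n nT_closed(3)[OF eT] n_closed(2) by blast
    then have "x \<in> N"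
      unfolding d(5) using L_R[OF N_L d(1)] n_closed(2)[OF d(3)] by simp
    then show False
      using x(3) by simp
  qed
  then obtain z where z: "z \<in> R" "\<sigma> \<otimes> z = \<one>"
    using R_unit d(2) by blast
  have [simp]: "z \<in> carrier S"
    using z L_carrier[OF R_L] by blast
  have "z \<otimes> (x \<ominus> \<rho> \<ominus> \<nu>) = \<sigma> \<otimes> z \<otimes> e"
    unfolding d(5) by - (rule poly_eqI[of "[z,\<sigma>,e,\<rho>,\<nu>]"], (rule poly_reify)+, simp_all add: poly_simps)
  then have "z \<otimes> (x \<ominus> \<rho> \<ominus> \<nu>) = e"
    unfolding z(2) by simp
  moreover have "z \<otimes> (x \<ominus> \<rho> \<ominus> \<nu>) \<in> H"
    using H x(1) d(4) L_R[OF H d(1)] L_R[OF H z(1)] by simp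
  ultimately show ?thesis
    by simp
qed

lemma Re_L: "adjoin R R e \<in> L"
  using quadratic_adjoin_L[OF R_L split_carrier, of \<one>] f_R by simp

lemma e_Re: "e \<in> adjoin R R e"
  using adjoin_gen[OF R_L R_L split_carrier] .

lemma Re_T: "adjoin R R e \<subseteq> T"
  using adjoin_least[OF T_L R_le[OF T_L] R_le[OF T_L] eT] .

lemma Re_least: "H \<in> L \<Longrightarrow> e \<in> H \<Longrightarrow> adjoin R R e \<subseteq> H"
  using adjoin_least[of H R R e] R_le by blast

text \<open>
  Let \<open>K = H \<inter> T\<close>. The compositum of \<open>N\<close> and \<open>K\<close> contains \<open>e\<close>, hence the ring \<open>E = R + R e\<close>. If
  \<open>E \<inter> K\<close> were contained in \<open>N\<close>, then \<open>E\<close> would be contained in \<open>N\<close> by distributivity. So \<open>E \<inter> K\<close> has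
  an element outside \<open>N\<close>, and such an element of \<open>E\<close> generates \<open>E\<close>.
\<close>
lemma nonlocal_contains:
  assumes H: "H \<in> L" and nl: "\<not> H \<inter> T \<subseteq> N"
  shows "adjoin R R e \<subseteq> H"
proof -
  let ?K = "H \<inter> T" and ?E = "adjoin R R e"
  have K: "?K \<in> L"
    using H by simp
  obtain x where x: "x \<in> ?K" "x \<notin> N"
    using nl by blast
  have NK: "N \<subseteq> compositum S N ?K" "?K \<subseteq> compositum S N ?K"
    using compositum_upper[OF N_L K] by auto
  have "e \<in> compositum S N ?K"
  proof (rule e_in_ring)
    show "compositum S N ?K \<in> L"
      using N_L K by simp
    show "x \<in> compositum S N ?K"
      using x NK by blast
    show "n \<subseteq> compositum S N ?K \<or> x \<in> ?E"
      using NK n_closed(2) by blast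
  qed (use x in auto)
  then have le: "?E \<subseteq> compositum S N ?K"
    using N_L K by (intro Re_least) simp_all
  have "\<not> ?E \<inter> ?K \<subseteq> N"
  proof
    assume "?E \<inter> ?K \<subseteq> N"
    then have "?E \<subseteq> N"
      using pairwise_trivial_meet[OF N_L N_L Re_L K le] by blast
    then show False
      using e_Re e_N[OF split_mod] by blast
  qed
  then obtain y where y: "y \<in> ?E" "y \<in> ?K" "y \<notin> N"
    by blast
  have "e \<in> ?K"
    using e_in_ring[OF K y(2) _ y(3)] y by blast
  then show ?thesis
    using Re_least[OF H] by blast
qed

end

text \<open>
  An element of a ring between \<open>R + R e\<close> and \<open>T\<close> is a unit if it is nonzero in both residue fields.
\<close>
lemma two_component_unit:
  assumes e: "split_idem e" and B: "B \<in> L" "e \<in> B" "B \<subseteq> T"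
    and u: "u \<in> B" "e \<otimes> u \<notin> n" "(\<one> \<ominus> e) \<otimes> u \<notin> n"
  shows "\<exists>v \<in> B. u \<otimes> v = \<one>"
proof -
  have uT: "u \<in> T"
    using u B by blast
  obtain \<rho> where \<rho>: "\<rho> \<in> R" "e \<otimes> u \<ominus> \<rho> \<otimes> e \<in> n" "\<rho> \<notin> m"
    using component_R[OF e uT] u(2) by metis
  have e': "split_idem (\<one> \<ominus> e)"
    using split_idem_complement[OF e] .
  obtain \<sigma> where \<sigma>: "\<sigma> \<in> R" "(\<one> \<ominus> e) \<otimes> u \<ominus> \<sigma> \<otimes> (\<one> \<ominus> e) \<in> n" "\<sigma> \<notin> m"
    using component_R[OF e' uT] u(3) by metis
  obtain \<rho>' where i1: "\<rho>' \<in> R" "\<rho> \<otimes> \<rho>' = \<one>"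
    using R_unit \<rho> by blast
  obtain \<sigma>' where i2: "\<sigma>' \<in> R" "\<sigma> \<otimes> \<sigma>' = \<one>"
    using R_unit \<sigma> by blast
  have [simp]: "u \<in> carrier S" "\<rho> \<in> carrier S" "\<sigma> \<in> carrier S" "\<rho>' \<in> carrier S" "\<sigma>' \<in> carrier S" "e \<in> carrier S"
    using L_carrier[OF T_L uT] \<rho> \<sigma> i1 i2 L_carrier[OF R_L] split_carrier[OF e] by auto
  define v where "v = \<rho>' \<otimes> e \<oplus> \<sigma>' \<otimes> (\<one> \<ominus> e)"
  have vB: "v \<in> B" and [simp]: "v \<in> carrier S"
    using i1 i2 L_R[OF B(1)] B by (simp_all add: v_def)
  define x where "x = \<one> \<ominus> u \<otimes> v"
  have "\<rho> \<otimes> \<rho>' \<otimes> e \<oplus> \<sigma> \<otimes> \<sigma>' \<otimes> (\<one> \<ominus> e) \<ominus> u \<otimes> v =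
      \<ominus> (\<rho>' \<otimes> (e \<otimes> u \<ominus> \<rho> \<otimes> e) \<oplus> \<sigma>' \<otimes> ((\<one> \<ominus> e) \<otimes> u \<ominus> \<sigma> \<otimes> (\<one> \<ominus> e)))"
    unfolding v_def by - (rule poly_eqI[of "[e,u,\<rho>,\<sigma>,\<rho>',\<sigma>']"], (rule poly_reify)+, simp_all add: poly_simps)
  moreover have "\<ominus> (\<rho>' \<otimes> (e \<otimes> u \<ominus> \<rho> \<otimes> e) \<oplus> \<sigma>' \<otimes> ((\<one> \<ominus> e) \<otimes> u \<ominus> \<sigma> \<otimes> (\<one> \<ominus> e))) \<in> n"
    by (rule n_closed(5)[OF n_closed(3)[OF n_closed(6)[OF L_R[OF N_L i1(1)] \<rho>(2)]
          n_closed(6)[OF L_R[OF N_L i2(1)] \<sigma>(2)]]])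
  ultimately have "\<one> \<otimes> e \<oplus> \<one> \<otimes> (\<one> \<ominus> e) \<ominus> u \<otimes> v \<in> n"
    unfolding i1(2) i2(2) by (simp only:)
  moreover have "\<one> \<otimes> e \<oplus> \<one> \<otimes> (\<one> \<ominus> e) \<ominus> u \<otimes> v = x"
    unfolding x_def by - (rule poly_eqI[of "[e,u,v]"], (rule poly_reify)+, simp_all add: poly_simps)
  ultimately have xn: "x \<in> n"
    by (simp only:)
  have "x \<in> B"
    unfolding x_def using B(1) u(1) vB by simp
  then obtain w where w: "w \<in> B" "(\<one> \<ominus> x) \<otimes> w = \<one>"
    using n_one_minus_unit[OF B(1) _ xn] by blast
  have [simp]: "w \<in> carrier S"
    using L_carrier[OF B(1) w(1)] .
  have "u \<otimes> (v \<otimes> w) = (\<one> \<ominus> x) \<otimes> w"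
    unfolding x_def by - (rule poly_eqI[of "[u,v,w]"], (rule poly_reify)+, simp_all add: poly_simps)
  then show ?thesis
    using w vB B(1) by (intro bexI[of _ "v \<otimes> w"]) simp_all
qed

text \<open>
  \<open>e u\<^sub>1 + (1 - e) u\<^sub>2\<close> is nonzero in both residue fields.
\<close>
lemma comaximal:
  assumes e: "split_idem e" and B: "B \<in> L" "e \<in> B" "B \<subseteq> T"
    and u: "u1 \<in> B" "u2 \<in> B" "e \<otimes> u1 \<notin> n" "(\<one> \<ominus> e) \<otimes> u2 \<notin> n"
  shows "\<exists>p \<in> B. \<exists>q \<in> B. \<one> = p \<otimes> u1 \<oplus> q \<otimes> u2"
proof -
  have [simp]: "e \<in> carrier S" "u1 \<in> carrier S" "u2 \<in> carrier S"
    using split_carrier[OF e] u L_carrier[OF B(1)] by auto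
  define f where "f = e \<otimes> e \<ominus> e"
  have fn: "f \<in> n" and [simp]: "f \<in> carrier S"
    using f_n[OF e] by (simp_all add: f_def)
  note nT = nT_closed[OF e]
  have BT: "x \<in> B \<Longrightarrow> x \<in> T" for x
    using B by blast
  define u where "u = e \<otimes> u1 \<oplus> (\<one> \<ominus> e) \<otimes> u2"
  have uB: "u \<in> B" and [simp]: "u \<in> carrier S"
    using u B by (simp_all add: u_def)
  have 1: "e \<otimes> u \<notin> n"
  proof
    assume "e \<otimes> u \<in> n"
    then have "e \<otimes> u \<ominus> f \<otimes> (u1 \<ominus> u2) \<in> n"
      using n_closed(4) nT(3)[OF _ fn, of "u1 \<ominus> u2"] BT u(1,2) B(1) by simp
    moreover have "e \<otimes> u \<ominus> f \<otimes> (u1 \<ominus> u2) = e \<otimes> u1"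
      unfolding u_def f_def by - (rule poly_eqI[of "[e,u1,u2]"], (rule poly_reify)+, simp_all add: poly_simps)
    ultimately show False
      using u(3) by simp
  qed
  have 2: "(\<one> \<ominus> e) \<otimes> u \<notin> n"
  proof
    assume "(\<one> \<ominus> e) \<otimes> u \<in> n"
    then have "(\<one> \<ominus> e) \<otimes> u \<ominus> f \<otimes> (u2 \<ominus> u1) \<in> n"
      using n_closed(4) nT(3)[OF _ fn, of "u2 \<ominus> u1"] BT u(1,2) B(1) by simp
    moreover have "(\<one> \<ominus> e) \<otimes> u \<ominus> f \<otimes> (u2 \<ominus> u1) = (\<one> \<ominus> e) \<otimes> u2"
      unfolding u_def f_def by - (rule poly_eqI[of "[e,u1,u2]"], (rule poly_reify)+, simp_all add: poly_simps)
    ultimately show False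
      using u(4) by simp
  qed
  obtain v where v: "v \<in> B" "u \<otimes> v = \<one>"
    using two_component_unit[OF e B uB 1 2] by blast
  have [simp]: "v \<in> carrier S"
    using L_carrier[OF B(1) v(1)] .
  define p where "p = v \<otimes> e"
  define q where "q = v \<otimes> (\<one> \<ominus> e)"
  have pq: "p \<in> B" "q \<in> B" and [simp]: "p \<in> carrier S" "q \<in> carrier S"
    using v B by (simp_all add: p_def q_def)
  have "p \<otimes> u1 \<oplus> q \<otimes> u2 = u \<otimes> v"
    unfolding p_def q_def u_def by - (rule poly_eqI[of "[v,e,u1,u2]"], (rule poly_reify)+, simp_all add: poly_simps)
  then have one: "\<one> = p \<otimes> u1 \<oplus> q \<otimes> u2"
    unfolding v(2) by simp
  then show ?thesis
    using pq by blast
qed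

lemma comaximal_mem:
  assumes e: "split_idem e" and B: "B \<in> L" "e \<in> B" "B \<subseteq> T" and D: "D \<in> L" "B \<subseteq> D"
    and u: "u1 \<in> B" "u2 \<in> B" "e \<otimes> u1 \<notin> n" "(\<one> \<ominus> e) \<otimes> u2 \<notin> n"
    and b: "b \<in> carrier S" "u1 \<otimes> b \<in> D" "u2 \<otimes> b \<in> D"
  shows "b \<in> D"
proof -
  obtain p q where pq: "p \<in> B" "q \<in> B" and one: "\<one> = p \<otimes> u1 \<oplus> q \<otimes> u2"
    using comaximal[OF e B u] by blast
  have [simp]: "p \<in> carrier S" "q \<in> carrier S" "u1 \<in> carrier S" "u2 \<in> carrier S" "b \<in> carrier S"
    using pq u L_carrier[OF B(1)] b by auto
  have "p \<otimes> (u1 \<otimes> b) \<oplus> q \<otimes> (u2 \<otimes> b) = (p \<otimes> u1 \<oplus> q \<otimes> u2) \<otimes> b"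
    by - (rule poly_eqI[of "[p,u1,b,q,u2]"], (rule poly_reify)+, simp_all add: poly_simps)
  also have "\<dots> = b"
    unfolding one[symmetric] by simp
  finally have "p \<otimes> (u1 \<otimes> b) \<oplus> q \<otimes> (u2 \<otimes> b) = b" .
  moreover have "p \<otimes> (u1 \<otimes> b) \<oplus> q \<otimes> (u2 \<otimes> b) \<in> D"
    using D(1) subsetD[OF D(2) pq(1)] subsetD[OF D(2) pq(2)] b(2,3) by simp
  ultimately show "b \<in> D"
    by simp
qed

lemma e_power_mod:
  assumes e: "split_idem e"
  shows "e [^] Suc k \<ominus> e \<in> n"
proof (induction k)
  have [simp]: "e \<in> carrier S"
    using split_carrier[OF e] .
  {
    case 0
    then show ?case
      using n_closed(1) by (simp add: a_minus_def r_neg)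
  next
    case (Suc k)
    define g where "g = e [^] Suc k"
    have [simp]: "g \<in> carrier S"
      by (simp add: g_def)
    have "g \<otimes> e \<ominus> e = (g \<ominus> e) \<otimes> e \<oplus> (e \<otimes> e \<ominus> e)"
      by - (rule poly_eqI[of "[g,e]"], (rule poly_reify)+, simp_all add: poly_simps)
    also have "\<dots> \<in> n"
      using n_closed(3)[OF nT_closed(3)[OF e eT[OF e] Suc] f_n[OF e]] by (simp only: g_def)
    finally show ?case
      by (simp add: g_def)
  }
qed

lemma e_power_notin:
  assumes e: "split_idem e"
  shows "e \<otimes> e [^] (k::nat) \<notin> n"
proof
  have [simp]: "e \<in> carrier S"
    using split_carrier[OF e] .
  assume "e \<otimes> e [^] k \<in> n"
  then have "e [^] Suc k \<in> n"
    by (simp add: m_comm)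
  then have "e [^] Suc k \<ominus> (e [^] Suc k \<ominus> e) \<in> n"
    using n_closed(4)[OF _ e_power_mod[OF e]] by blast
  moreover have "x \<ominus> (x \<ominus> e) = e" if "x \<in> carrier S" for x
    using that by - (rule poly_eqI[of "[x,e]"], (rule poly_reify)+, simp_all add: poly_simps)
  ultimately show False
    using e_notin_n[OF e] by (metis \<open>e \<in> carrier S\<close> nat_pow_closed)
qed

section \<open>The u-closure\<close>

text \<open>
  With \<open>g = b\<^sup>2 - b\<close>, all \<open>g b\<^sup>i\<close> are in \<open>B\<close>, hence the powers of \<open>b\<close> agree modulo \<open>B\<close>. A power of \<open>e b\<close>
  lies in \<open>m\<close>, and it is \<open>e\<^sup>k b\<^sup>k\<close>, which agrees with \<open>e\<^sup>k b\<close> modulo \<open>B\<close>.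
\<close>
lemma u_step_component:
  assumes e: "split_idem e" and B: "B \<in> L" "e \<in> B"
    and b: "b \<in> T" "b \<otimes> b \<ominus> b \<in> B" "(b \<otimes> b \<ominus> b) \<otimes> b \<in> B" and g: "e \<otimes> (b \<otimes> b \<ominus> b) \<in> n" and ebn: "e \<otimes> b \<in> n"
  shows "\<exists>k::nat. e [^] k \<otimes> b \<in> B"
proof -
  have [simp]: "e \<in> carrier S" "b \<in> carrier S"
    using split_carrier[OF e] L_carrier[OF T_L b(1)] by auto
  define g where "g = b \<otimes> b \<ominus> b"
  have gB: "g \<in> B" "g \<otimes> b \<in> B" and [simp]: "g \<in> carrier S"
    using b by (simp_all add: g_def)
  have gpow: "g \<otimes> b [^] (i::nat) \<in> B \<and> g \<otimes> b [^] Suc i \<in> B" for i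
  proof (induction i)
    case 0
    then show ?case
      using gB by simp
  next
    case (Suc i)
    define c where "c = b [^] i"
    have [simp]: "c \<in> carrier S"
      by (simp add: c_def)
    have "g \<otimes> (c \<otimes> b \<otimes> b) = g \<otimes> (c \<otimes> b) \<oplus> g \<otimes> (g \<otimes> c)"
      unfolding g_def by - (rule poly_eqI[of "[b,c]"], (rule poly_reify)+, simp_all add: poly_simps)
    also have "\<dots> \<in> B"
      using Suc gB(1) B(1) by (simp add: c_def)
    finally show ?case
      using Suc by (simp add: c_def)
  qed
  have bpow: "b [^] Suc i \<ominus> b \<in> B" for i
  proof (induction i)
    case 0
    then show ?case
      using B(1) by (simp add: a_minus_def r_neg)
  next
    case (Suc i)
    define c where "c = b [^] i"
    have [simp]: "c \<in> carrier S"
      by (simp add: c_def)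
    have "c \<otimes> b \<otimes> b \<ominus> b = g \<otimes> c \<oplus> (c \<otimes> b \<ominus> b)"
      unfolding g_def by - (rule poly_eqI[of "[b,c]"], (rule poly_reify)+, simp_all add: poly_simps)
    also have "\<dots> \<in> B"
      using Suc gpow[of i] B(1) by (simp add: c_def)
    finally show ?case
      by (simp add: c_def)
  qed
  obtain k where k: "(e \<otimes> b) [^] (2 ^ k :: nat) \<in> m"
    using n_nilpotent[OF ebn] by blast
  define x where "x = e [^] (2 ^ k :: nat)"
  define y where "y = b [^] (2 ^ k :: nat)"
  have [simp]: "x \<in> carrier S" "y \<in> carrier S"
    by (simp_all add: x_def y_def)
  have xB: "x \<in> B"
    using B by (simp add: x_def)
  have "x \<otimes> y \<in> m"
    using k by (simp add: x_def y_def nat_pow_distrib)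
  then have xy: "x \<otimes> y \<in> B"
    using L_R[OF B(1)] m_closed(2) by blast
  have "b [^] Suc (2 ^ k - 1) \<ominus> b \<in> B"
    by (rule bpow)
  then have yb: "y \<ominus> b \<in> B"
    by (simp add: y_def)
  have "x \<otimes> y \<ominus> x \<otimes> (y \<ominus> b) = x \<otimes> b"
    by - (rule poly_eqI[of "[x,y,b]"], (rule poly_reify)+, simp_all add: poly_simps)
  moreover have "x \<otimes> y \<ominus> x \<otimes> (y \<ominus> b) \<in> B"
    using L_closed(6)[OF B(1) xy L_closed(5)[OF B(1) xB yb]] .
  ultimately show ?thesis
    unfolding x_def by metis
qed

text \<open>
  The component \<open>\<rho>\<close> of \<open>b\<close> at \<open>e\<close> is \<open>0\<close> or \<open>1\<close>; in the second case the previous lemma applies to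
  \<open>1 - b\<close>.
\<close>
lemma u_step_component':
  assumes e: "split_idem e" and B: "B \<in> L" "e \<in> B"
    and b: "b \<in> T" "b \<otimes> b \<ominus> b \<in> B" "(b \<otimes> b \<ominus> b) \<otimes> b \<in> B" and g: "e \<otimes> (b \<otimes> b \<ominus> b) \<in> n"
  shows "\<exists>k::nat. e [^] k \<otimes> b \<in> B"
proof -
  have [simp]: "e \<in> carrier S" "b \<in> carrier S"
    using split_carrier[OF e] L_carrier[OF T_L b(1)] by auto
  note nT = nT_closed[OF e]
  obtain \<rho> where \<rho>: "\<rho> \<in> R" "e \<otimes> b \<ominus> \<rho> \<otimes> e \<in> n" "\<rho> \<in> m \<longleftrightarrow> e \<otimes> b \<in> n"
    using component_R[OF e b(1)] by blast
  have \<rho>N: "\<rho> \<in> N" and [simp]: "\<rho> \<in> carrier S"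
    using \<rho>(1) L_R[OF N_L] L_carrier[OF R_L] by auto
  have "(\<rho> \<otimes> \<rho> \<ominus> \<rho>) \<otimes> e = e \<otimes> (b \<otimes> b \<ominus> b) \<ominus> ((b \<oplus> \<rho> \<ominus> \<one>) \<otimes> (e \<otimes> b \<ominus> \<rho> \<otimes> e))"
    by - (rule poly_eqI[of "[\<rho>,e,b]"], (rule poly_reify)+, simp_all add: poly_simps)
  also have "\<dots> \<in> n"
    using n_closed(4)[OF g nT(2)[OF _ \<rho>(2)]] b(1) L_R[OF T_L \<rho>(1)] by simp
  finally have "(\<rho> \<otimes> \<rho> \<ominus> \<rho>) \<otimes> e \<in> N"
    using n_closed(2) by blast
  then have "\<rho> \<otimes> \<rho> \<ominus> \<rho> \<in> n"
    using e_scalar_N[OF split_mod[OF e], of "\<rho> \<otimes> \<rho> \<ominus> \<rho>"] \<rho>N by simp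
  then consider "\<rho> \<in> n" | "\<one> \<ominus> \<rho> \<in> n"
    using P_prime_idem[OF resid_local_at[OF resid_N] \<rho>N] by blast
  then show ?thesis
  proof cases
    case 1
    then have "e \<otimes> b \<in> n"
      using \<rho>(3) R_n[OF \<rho>(1)] by blast
    then show ?thesis
      by (rule u_step_component[OF e B b g])
  next
    case 2
    let ?b = "\<one> \<ominus> b"
    have e1: "?b \<otimes> ?b \<ominus> ?b = b \<otimes> b \<ominus> b"
      by - (rule poly_eqI[of "[b]"], (rule poly_reify)+, simp_all add: poly_simps)
    have "(b \<otimes> b \<ominus> b) \<otimes> ?b = (b \<otimes> b \<ominus> b) \<ominus> (b \<otimes> b \<ominus> b) \<otimes> b"
      by - (rule poly_eqI[of "[b]"], (rule poly_reify)+, simp_all add: poly_simps)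
    then have 3: "(?b \<otimes> ?b \<ominus> ?b) \<otimes> ?b \<in> B"
      unfolding e1 using L_closed(6)[OF B(1) b(2,3)] by simp
    have "e \<otimes> ?b = (\<one> \<ominus> \<rho>) \<otimes> e \<ominus> (e \<otimes> b \<ominus> \<rho> \<otimes> e)"
      by - (rule poly_eqI[of "[e,b,\<rho>]"], (rule poly_reify)+, simp_all add: poly_simps)
    then have 4: "e \<otimes> ?b \<in> n"
      using n_closed(4)[OF nT(3)[OF eT[OF e] 2] \<rho>(2)] by simp
    have 5: "?b \<otimes> ?b \<ominus> ?b \<in> B" "e \<otimes> (?b \<otimes> ?b \<ominus> ?b) \<in> n" "?b \<in> T"
      unfolding e1 using b g by simp_all
    obtain k where k: "e [^] (k::nat) \<otimes> ?b \<in> B"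
      using u_step_component[OF e B 5(3,1) 3 5(2) 4] by blast
    define x where "x = e [^] k"
    have xB: "x \<in> B" and [simp]: "x \<in> carrier S"
      using B by (simp_all add: x_def)
    have "x \<ominus> x \<otimes> ?b = x \<otimes> b"
      by - (rule poly_eqI[of "[x,b]"], (rule poly_reify)+, simp_all add: poly_simps)
    moreover have "x \<ominus> x \<otimes> ?b \<in> B"
      using L_closed(6)[OF B(1) xB] k by (simp add: x_def)
    ultimately show ?thesis
      unfolding x_def by metis
  qed
qed

text \<open>
  To see that \<open>R + R e\<close> is u-closed, it suffices by \<open>comaximal_mem\<close> to find for \<open>d = e\<close> and for \<open>d = 1 - e\<close> an element
  of the conductor of \<open>b\<close> that does not vanish at \<open>d\<close>: either \<open>b\<^sup>2 - b\<close> or a power of \<open>d\<close>.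
\<close>
lemma U_eq_Re:
  assumes e: "split_idem e"
  shows "U = adjoin R R e"
proof
  let ?B = "adjoin R R e"
  note B = Re_L[OF e] and eB = e_Re[OF e] and BT = Re_T[OF e]
  have [simp]: "e \<in> carrier S"
    using split_carrier[OF e] .
  have e': "split_idem (\<one> \<ominus> e)"
    using split_idem_complement[OF e] .
  have e'B: "\<one> \<ominus> e \<in> ?B"
    using B eB by simp
  have "e \<in> U"
    by (rule U_closed[OF _ L_R[OF U_L f_R[OF e]] L_R[OF U_L fe_R[OF e]]]) simp
  then show "?B \<subseteq> U"
    using Re_least[OF e U_L] by blast
  have "u_closed S ?B"
    unfolding u_closed_iff
  proof (intro ballI impI)
    fix b assume b: "b \<in> carrier S" "b \<otimes> b \<ominus> b \<in> ?B" "(b \<otimes> b \<ominus> b) \<otimes> b \<in> ?B"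
    have bT: "b \<in> T"
      using T_closed[of b \<one>] b BT by auto
    have find: "\<exists>u \<in> ?B. d \<otimes> u \<notin> n \<and> u \<otimes> b \<in> ?B" if d: "split_idem d" "d \<in> ?B" for d
    proof (cases "d \<otimes> (b \<otimes> b \<ominus> b) \<in> n")
      case True
      obtain k where "d [^] (k::nat) \<otimes> b \<in> ?B"
        using u_step_component'[OF d(1) B d(2) bT b(2,3) True] by blast
      then show ?thesis
        using e_power_notin[OF d(1), of k] L_pow[OF B d(2), of k] by blast
    next
      case False
      then show ?thesis
        using b(2,3) by blast
    qed
    obtain u1 where u1: "u1 \<in> ?B" "e \<otimes> u1 \<notin> n" "u1 \<otimes> b \<in> ?B"
      using find[OF e eB] by blast
    obtain u2 where u2: "u2 \<in> ?B" "(\<one> \<ominus> e) \<otimes> u2 \<notin> n" "u2 \<otimes> b \<in> ?B"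
      using find[OF e' e'B] by blast
    show "b \<in> ?B"
      using comaximal_mem[OF e B eB BT B order_refl u1(1) u2(1) u1(2) u2(2) b(1) u1(3) u2(3)] .
  qed
  then show "U \<subseteq> ?B"
    using U_Least B by blast
qed

section \<open>The two components of S over U\<close>

lemma component_inverse:
  assumes e: "split_idem e" and s: "s \<in> T" "e \<otimes> s \<notin> n"
  obtains z where "z \<in> R" "e \<otimes> (s \<otimes> z \<ominus> \<one>) \<in> n"
proof -
  obtain \<rho> where \<rho>: "\<rho> \<in> R" "e \<otimes> s \<ominus> \<rho> \<otimes> e \<in> n" "\<rho> \<notin> m"
    using component_R[OF e s(1)] s(2) by metis
  obtain z where z: "z \<in> R" "\<rho> \<otimes> z = \<one>"
    using R_unit \<rho> by blast
  have [simp]: "e \<in> carrier S" "s \<in> carrier S" "\<rho> \<in> carrier S" "z \<in> carrier S"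
    using split_carrier[OF e] s \<rho> z L_carrier[OF T_L] L_carrier[OF R_L] by auto
  have "z \<otimes> (e \<otimes> s \<ominus> \<rho> \<otimes> e) = e \<otimes> (s \<otimes> z) \<ominus> \<rho> \<otimes> z \<otimes> e"
    by - (rule poly_eqI[of "[z,e,s,\<rho>]"], (rule poly_reify)+, simp_all add: poly_simps)
  also have "\<dots> = e \<otimes> (s \<otimes> z \<ominus> \<one>)"
    unfolding z(2) by - (rule poly_eqI[of "[e,s,z]"], (rule poly_reify)+, simp_all add: poly_simps)
  finally show thesis
    using that[OF z(1)] n_closed(6)[OF L_R[OF N_L z(1)] \<rho>(2)] by simp
qed

text \<open>
  The component at \<open>e\<close> takes values in a field.
\<close>
lemma component_prime:
  assumes e: "split_idem e" and s: "s \<in> T" "e \<otimes> s \<notin> n" and t: "t \<in> T" "e \<otimes> t \<notin> n"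
  shows "e \<otimes> (s \<otimes> t) \<notin> n"
proof
  assume st: "e \<otimes> (s \<otimes> t) \<in> n"
  obtain z where z: "z \<in> R" "e \<otimes> (s \<otimes> z \<ominus> \<one>) \<in> n"
    by (rule component_inverse[OF e s])
  have [simp]: "e \<in> carrier S" "s \<in> carrier S" "t \<in> carrier S" "z \<in> carrier S"
    using split_carrier[OF e] s t z L_carrier[OF T_L] L_carrier[OF R_L] by auto
  have "z \<otimes> (e \<otimes> (s \<otimes> t)) \<ominus> e \<otimes> (s \<otimes> z \<ominus> \<one>) \<otimes> t \<in> n"
    by (rule n_closed(4)[OF n_closed(6)[OF L_R[OF N_L z(1)] st] nT_closed(3)[OF e t(1) z(2)]])
  moreover have "z \<otimes> (e \<otimes> (s \<otimes> t)) \<ominus> e \<otimes> (s \<otimes> z \<ominus> \<one>) \<otimes> t = e \<otimes> t"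
    by - (rule poly_eqI[of "[z,e,s,t]"], (rule poly_reify)+, simp_all add: poly_simps)
  ultimately show False
    using t(2) by simp
qed

text \<open>
  The elements of \<open>S\<close> that lie in \<open>U\<close> after localization at the maximal ideal \<open>M d\<close> of \<open>U\<close>, for \<open>d = e\<close>
  or \<open>d = 1 - e\<close>.
\<close>
definition V :: "'a \<Rightarrow> 'a set" where
  "V d = {x \<in> carrier S. \<exists>s \<in> U. d \<otimes> s \<notin> n \<and> s \<otimes> x \<in> U}"

lemma UT: "x \<in> U \<Longrightarrow> x \<in> T"
  using U_T by blast

lemma U_carrier: "x \<in> U \<Longrightarrow> x \<in> carrier S"
  using L_carrier[OF U_L] .

lemma e_U: "split_idem e \<Longrightarrow> e \<in> U"
  using U_eq_Re e_Re by simp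

lemma U_V:
  assumes e: "split_idem e"
  shows "U \<subseteq> V e"
proof
  fix x assume x: "x \<in> U"
  have "e \<otimes> \<one> \<notin> n"
    using e_notin_n[OF e] split_carrier[OF e] by simp
  moreover have "\<one> \<otimes> x \<in> U"
    using x U_carrier by simp
  ultimately show "x \<in> V e"
    unfolding V_def using x U_carrier L_closed(2)[OF U_L] by blast
qed

lemma V_L:
  assumes e: "split_idem e"
  shows "V e \<in> L"
proof (rule L_I)
  show "R \<subseteq> V e"
    using U_V[OF e] R_le[OF U_L] by blast
  show "V e \<subseteq> carrier S"
    by (auto simp: V_def)
  fix x y assume "x \<in> V e" "y \<in> V e"
  then obtain s t where s: "s \<in> U" "e \<otimes> s \<notin> n" "s \<otimes> x \<in> U" and t: "t \<in> U" "e \<otimes> t \<notin> n" "t \<otimes> y \<in> U"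
    and [simp]: "x \<in> carrier S" "y \<in> carrier S"
    by (auto simp: V_def)
  have [simp]: "s \<in> carrier S" "t \<in> carrier S"
    using s t U_carrier by auto
  have st: "e \<otimes> (s \<otimes> t) \<notin> n" "s \<otimes> t \<in> U"
    using component_prime[OF e UT[OF s(1)] s(2) UT[OF t(1)] t(2)] s t by simp_all
  have "s \<otimes> t \<otimes> (x \<oplus> y) = t \<otimes> (s \<otimes> x) \<oplus> s \<otimes> (t \<otimes> y)"
    by - (rule poly_eqI[of "[s,t,x,y]"], (rule poly_reify)+, simp_all add: poly_simps)
  then have "s \<otimes> t \<otimes> (x \<oplus> y) \<in> U"
    using s t by simp
  then show "x \<oplus> y \<in> V e"
    unfolding V_def using st by auto
  have "s \<otimes> t \<otimes> (x \<otimes> y) = (s \<otimes> x) \<otimes> (t \<otimes> y)"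
    by - (rule poly_eqI[of "[s,t,x,y]"], (rule poly_reify)+, simp_all add: poly_simps)
  then have "s \<otimes> t \<otimes> (x \<otimes> y) \<in> U"
    using s t by simp
  then show "x \<otimes> y \<in> V e"
    unfolding V_def using st by auto
qed

text \<open>
  The denominators of \<open>x\<close> at the two maximal ideals are comaximal.
\<close>
lemma V_inter:
  assumes e: "split_idem e"
  shows "V e \<inter> V (\<one> \<ominus> e) = U"
proof
  note e' = split_idem_complement[OF e]
  show "U \<subseteq> V e \<inter> V (\<one> \<ominus> e)"
    using U_V[OF e] U_V[OF e'] by blast
  show "V e \<inter> V (\<one> \<ominus> e) \<subseteq> U"
  proof
    fix x assume "x \<in> V e \<inter> V (\<one> \<ominus> e)"
    then obtain s t where s: "s \<in> U" "e \<otimes> s \<notin> n" "s \<otimes> x \<in> U"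
      and t: "t \<in> U" "(\<one> \<ominus> e) \<otimes> t \<notin> n" "t \<otimes> x \<in> U" and x: "x \<in> carrier S"
      by (auto simp: V_def)
    show "x \<in> U"
      using comaximal_mem[OF e U_L e_U[OF e] U_T U_L order_refl s(1) t(1) s(2) t(2) x s(3) t(3)] .
  qed
qed

text \<open>
  A power of \<open>e (1 - e) \<in> m\<close> multiplies \<open>x\<close> into \<open>R\<close>.
\<close>
lemma power_in_V:
  assumes e: "split_idem e" and x: "x \<in> carrier S"
  shows "\<exists>j::nat. (\<one> \<ominus> e) [^] j \<otimes> x \<in> V e"
proof -
  have [simp]: "e \<in> carrier S" "x \<in> carrier S"
    using split_carrier[OF e] x by auto
  define f where "f = e \<otimes> (\<one> \<ominus> e)"
  have "f = \<ominus> (e \<otimes> e \<ominus> e)"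
    unfolding f_def by - (rule poly_eqI[of "[e]"], (rule poly_reify)+, simp_all add: poly_simps)
  then have fm: "f \<in> m"
    using f_m[OF e] by simp
  obtain C j where C: "C \<in> L" "x \<in> C" "\<And>c. c \<in> C \<Longrightarrow> c \<otimes> f [^] (j::nat) \<in> R"
    by (rule power_conducts[OF resid_local_at[OF resid_R] fm x]) (rule that; assumption)
  define a where "a = e [^] j"
  define b where "b = (\<one> \<ominus> e) [^] j"
  have [simp]: "a \<in> carrier S" "b \<in> carrier S"
    by (simp_all add: a_def b_def)
  have "f [^] j = a \<otimes> b"
    by (simp add: f_def a_def b_def nat_pow_distrib)
  then have "x \<otimes> (a \<otimes> b) \<in> U"
    using C(3)[OF C(2)] L_R[OF U_L] by simp
  moreover have "x \<otimes> (a \<otimes> b) = a \<otimes> (b \<otimes> x)"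
    by - (rule poly_eqI[of "[x,a,b]"], (rule poly_reify)+, simp_all add: poly_simps)
  ultimately have "a \<otimes> (b \<otimes> x) \<in> U"
    by simp
  moreover have "a \<in> U" "e \<otimes> a \<notin> n"
    using e_U[OF e] e_power_notin[OF e] by (simp_all add: a_def)
  ultimately show ?thesis
    unfolding V_def b_def by auto
qed

lemma complement_twice: "e \<in> carrier S \<Longrightarrow> \<one> \<ominus> (\<one> \<ominus> e) = e"
  by - (rule poly_eqI[of "[e]"], (rule poly_reify)+, simp_all add: poly_simps)

text \<open>
  High powers of \<open>e\<close> and \<open>1 - e\<close> send \<open>x\<close> to \<open>V (1 - e)\<close> and \<open>V e\<close>, and they are comaximal in \<open>U\<close>.
\<close>
lemma V_join:
  assumes e: "split_idem e"
  shows "compositum S (V e) (V (\<one> \<ominus> e)) = carrier S"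
proof
  note e' = split_idem_complement[OF e]
  let ?W = "compositum S (V e) (V (\<one> \<ominus> e))"
  have W: "?W \<in> L" and up: "V e \<subseteq> ?W" "V (\<one> \<ominus> e) \<subseteq> ?W"
    using V_L[OF e] V_L[OF e'] compositum_upper by auto
  show "?W \<subseteq> carrier S"
    using le_S[OF W] .
  show "carrier S \<subseteq> ?W"
  proof
    fix x assume x: "x \<in> carrier S"
    obtain i where i: "(\<one> \<ominus> e) [^] (i::nat) \<otimes> x \<in> V e"
      using power_in_V[OF e x] by blast
    obtain j where j: "e [^] (j::nat) \<otimes> x \<in> V (\<one> \<ominus> e)"
      using power_in_V[OF e' x] complement_twice[OF split_carrier[OF e]] by auto
    have UW: "U \<subseteq> ?W"
      using U_V[OF e] up by blast
    show "x \<in> ?W"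
      by (rule comaximal_mem[OF e U_L e_U[OF e] U_T W UW L_pow[OF U_L e_U[OF e]]
            L_pow[OF U_L e_U[OF e']] e_power_notin[OF e] e_power_notin[OF e'] x subsetD[OF up(2) j] subsetD[OF up(1) i]])
  qed
qed

lemma T_eq_U_plus_n:
  assumes e: "split_idem e" and x: "x \<in> T"
  obtains y where "y \<in> U" "x \<ominus> y \<in> n" "x = y \<oplus> (x \<ominus> y)"
proof (rule T_decompose[OF e x])
  fix \<rho> \<sigma> \<nu> assume d: "\<rho> \<in> R" "\<sigma> \<in> R" "\<nu> \<in> n" "x = \<rho> \<oplus> \<sigma> \<otimes> e \<oplus> \<nu>"
  have [simp]: "\<rho> \<in> carrier S" "\<sigma> \<in> carrier S" "\<nu> \<in> carrier S" "e \<in> carrier S"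
    using d n_carrier L_carrier[OF R_L] split_carrier[OF e] by auto
  have "x \<ominus> (\<rho> \<oplus> \<sigma> \<otimes> e) = \<nu>"
    unfolding d(4) by - (rule poly_eqI[of "[\<rho>,\<sigma>,e,\<nu>]"], (rule poly_reify)+, simp_all add: poly_simps)
  moreover have "\<rho> \<oplus> \<sigma> \<otimes> e \<in> U"
    using L_R[OF U_L] d e_U[OF e] by simp
  ultimately show thesis
    using that[of "\<rho> \<oplus> \<sigma> \<otimes> e"] d(3,4) by simp
qed

lemma T_inter_V:
  assumes e: "split_idem e" and le: "N \<inter> V e \<subseteq> U"
  shows "T \<inter> V e = U"
proof
  show "U \<subseteq> T \<inter> V e"
    using U_T U_V[OF e] by blast
  show "T \<inter> V e \<subseteq> U"
  proof
    fix x assume x: "x \<in> T \<inter> V e"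
    then have "x \<in> T" by simp
    then obtain y where y: "y \<in> U" "x \<ominus> y \<in> n" "x = y \<oplus> (x \<ominus> y)"
      by (rule T_eq_U_plus_n[OF e])
    have "x \<ominus> y \<in> V e"
      using L_closed(6)[OF V_L[OF e] _ subsetD[OF U_V[OF e] y(1)]] x by blast
    then have "x \<ominus> y \<in> U"
      using le n_closed(2)[OF y(2)] by blast
    then show "x \<in> U"
      using L_closed(4)[OF U_L y(1)] y(3) by metis
  qed
qed

text \<open>
  The intersections of \<open>V e\<close> and \<open>V (1 - e)\<close> with \<open>N\<close> are comparable, so the smaller one is contained
  in \<open>V e \<inter> V (1 - e) = U\<close>.
\<close>
lemma one_sided:
  assumes e: "split_idem e"
  shows "T \<inter> V e = U \<or> T \<inter> V (\<one> \<ominus> e) = U"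
proof -
  note e' = split_idem_complement[OF e]
  have "N \<inter> V e \<subseteq> N \<inter> V (\<one> \<ominus> e) \<or> N \<inter> V (\<one> \<ominus> e) \<subseteq> N \<inter> V e"
    using V_L[OF e] V_L[OF e'] by (intro N_chain) auto
  then have "N \<inter> V e \<subseteq> U \<or> N \<inter> V (\<one> \<ominus> e) \<subseteq> U"
    using V_inter[OF e] by blast
  then show ?thesis
    using T_inter_V[OF e] T_inter_V[OF e'] by blast
qed

lemma T_le_V:
  assumes e: "split_idem e" and TV: "T \<inter> V e = U"
  shows "T \<subseteq> V (\<one> \<ominus> e)"
proof -
  note e' = split_idem_complement[OF e]
  have "T = T \<inter> compositum S (V e) (V (\<one> \<ominus> e))"
    using V_join[OF e] le_S[OF T_L] by auto
  also have "\<dots> = compositum S U (T \<inter> V (\<one> \<ominus> e))"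
    using distrib_inf_sup[OF T_L V_L[OF e] V_L[OF e']] TV by simp
  also have "\<dots> \<subseteq> V (\<one> \<ominus> e)"
    using compositum_least[OF V_L[OF e'] U_V[OF e']] by auto
  finally show ?thesis .
qed

text \<open>
  The lemma \<open>comparable\<close> at the maximal ideal of \<open>H \<inter> T\<close> that corresponds to \<open>e\<close>. Elements of
  \<open>V (1 - e)\<close> have denominators outside the other maximal ideal, which gives the last clause of
  \<open>local_at\<close>.
\<close>
lemma comparable_V:
  assumes e: "split_idem e" and TV: "T \<subseteq> V (\<one> \<ominus> e)"
    and H: "H \<in> L" "U \<subseteq> H" "H \<subseteq> V (\<one> \<ominus> e)"
  shows "H \<subseteq> T \<or> T \<subseteq> H"
proof -
  note e' = split_idem_complement[OF e]
  let ?B = "H \<inter> T"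
  let ?P = "{u \<in> ?B. e \<otimes> u \<in> n}"
  have B: "?B \<in> L" "U \<subseteq> ?B" "?B \<subseteq> T"
    using H U_T by auto
  have eB: "e \<in> ?B"
    using e_U[OF e] B(2) by blast
  have [simp]: "e \<in> carrier S"
    using split_carrier[OF e] .
  note Bc = L_carrier[OF B(1)] and nT = nT_closed[OF e]
  have P: "sub_ideal ?P ?B"
    unfolding sub_ideal_def
  proof (intro conjI ballI)
    show "\<zero> \<in> ?P"
      using L_closed(1)[OF B(1)] n_closed(1) by simp
    fix p assume p: "p \<in> ?P"
    show "p \<oplus> q \<in> ?P" if q: "q \<in> ?P" for q
    proof -
      have "e \<otimes> (p \<oplus> q) = e \<otimes> p \<oplus> e \<otimes> q"
        using p q Bc by (intro r_distr) auto
      then show ?thesis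
        using p q L_closed(4)[OF B(1)] n_closed(3) by auto
    qed
    show "b \<otimes> p \<in> ?P" if b: "b \<in> ?B" for b
    proof -
      have "e \<otimes> (b \<otimes> p) = b \<otimes> (e \<otimes> p)"
        using p Bc[OF b] Bc[of p] by (simp add: m_ac)
      moreover have "b \<otimes> (e \<otimes> p) \<in> n"
        using nT(2)[of b] b p by blast
      ultimately show ?thesis
        using p L_closed(5)[OF B(1) b] by auto
    qed
  qed auto
  have la: "local_at ?B ?P (V (\<one> \<ominus> e))"
    unfolding local_at_def
  proof (intro conjI ballI)
    show "?B \<in> L" "V (\<one> \<ominus> e) \<in> L" "?B \<subseteq> V (\<one> \<ominus> e)" "sub_ideal ?P ?B"
      using B V_L[OF e'] H P by auto
    show "\<one> \<notin> ?P"
      using e_notin_n[OF e] by simp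
    fix s assume s: "s \<in> ?B - ?P"
    have sB: "s \<in> ?B" "s \<in> T" and es: "e \<otimes> s \<notin> n" and [simp]: "s \<in> carrier S"
      using s Bc by auto
    obtain z where z: "z \<in> R" "e \<otimes> (s \<otimes> z \<ominus> \<one>) \<in> n"
      by (rule component_inverse[OF e sB(2) es])
    note z(2)
    moreover have zB: "z \<in> ?B"
      using L_R[OF B(1) z(1)] .
    moreover have "s \<otimes> z \<ominus> \<one> \<in> ?B"
      by (rule L_closed(6)[OF B(1) L_closed(5)[OF B(1) sB(1) zB] L_closed(2)[OF B(1)]])
    ultimately show "\<exists>z \<in> ?B. s \<otimes> z \<ominus> \<one> \<in> ?P"
      by (intro bexI[OF _ zB]) simp
    fix x assume "x \<in> V (\<one> \<ominus> e)"
    then obtain t where t: "t \<in> U" "(\<one> \<ominus> e) \<otimes> t \<notin> n" "t \<otimes> x \<in> U" and [simp]: "x \<in> carrier S"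
      by (auto simp: V_def)
    have tB: "t \<in> ?B" and [simp]: "t \<in> carrier S"
      using t(1) B(2) U_carrier by auto
    obtain p q where pq: "p \<in> ?B" "q \<in> ?B" "\<one> = p \<otimes> s \<oplus> q \<otimes> t"
      using comaximal[OF e B(1) eB B(3) sB(1) tB es t(2)] by blast
    have [simp]: "q \<in> carrier S"
      using Bc[OF pq(2)] .
    have qt: "q \<otimes> t \<in> ?B"
      by (rule L_closed(5)[OF B(1) pq(2) tB])
    have "q \<otimes> t \<otimes> x = q \<otimes> (t \<otimes> x)"
      by (simp add: m_assoc)
    moreover have "q \<otimes> (t \<otimes> x) \<in> ?B"
      by (rule L_closed(5)[OF B(1) pq(2) subsetD[OF B(2) t(3)]])
    ultimately have "q \<otimes> t \<otimes> x \<in> ?B"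
      by (simp only:)
    then show "\<exists>p \<in> ?B. \<exists>q \<in> ?B. \<one> = p \<otimes> s \<oplus> q \<and> q \<otimes> x \<in> ?B"
      using pq(1,3) qt by blast
  qed
  show ?thesis
  proof (rule comparable[OF la H(1,3) T_L TV refl])
    show "\<exists>b \<in> T. t_step ?B b" if "?B \<noteq> T"
      by (rule T_reach[OF B(1,3) that])
  qed (rule T_closed)
qed

text \<open>
  The rings between \<open>U\<close> and \<open>T = U + n\<close> are determined by their intersections with \<open>N\<close>.
\<close>
lemma U_T_chain:
  assumes e: "split_idem e" and H: "H \<in> L" "U \<subseteq> H" "H \<subseteq> T" and Y: "Y \<in> L" "U \<subseteq> Y" "Y \<subseteq> T"
  shows "H \<subseteq> Y \<or> Y \<subseteq> H"
proof -
  have *: "H \<subseteq> Y" if H: "H \<in> L" "U \<subseteq> H" "H \<subseteq> T" and Y: "Y \<in> L" "U \<subseteq> Y" "Y \<subseteq> T"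
    and le: "H \<inter> N \<subseteq> Y" for H Y
  proof
    fix x assume x: "x \<in> H"
    then have "x \<in> T" using H by blast
    then obtain y where y: "y \<in> U" "x \<ominus> y \<in> n" "x = y \<oplus> (x \<ominus> y)"
      by (rule T_eq_U_plus_n[OF e])
    have "x \<ominus> y \<in> H"
      using L_closed(6)[OF H(1) x subsetD[OF H(2) y(1)]] .
    then have "x \<ominus> y \<in> Y"
      using le n_closed(2)[OF y(2)] by blast
    then show "x \<in> Y"
      using L_closed(4)[OF Y(1) subsetD[OF Y(2) y(1)]] y(3) by metis
  qed
  have "H \<inter> N \<subseteq> Y \<inter> N \<or> Y \<inter> N \<subseteq> H \<inter> N"
    using H Y by (intro N_chain) auto
  then show ?thesis
    using *[OF H Y] *[OF Y H] by blast
qed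

text \<open>
  The two alternatives exclude each other since \<open>e \<in> U - N\<close>.
\<close>
lemma dichotomy:
  assumes e: "split_idem e" and H: "H \<in> L"
  shows "H \<subseteq> N \<or> U \<subseteq> H"
proof (cases "H \<inter> T \<subseteq> N")
  case True
  moreover have "\<not> T \<subseteq> H"
    using True eT[OF e] e_N[OF split_mod[OF e]] by blast
  ultimately show ?thesis
    using comparable_T_local[OF H] by blast
next
  case False
  then show ?thesis
    using nonlocal_contains[OF e H] U_eq_Re[OF e] by simp
qed

section \<open>Counting\<close>

text \<open>
  The same set as \<open>intermediate_rings S A B\<close> for \<open>A \<in> L\<close>. Rewriting membership in the latter by membership
  in \<open>L\<close> would not terminate, as \<open>L\<close> is a set of intermediate rings itself.
\<close>
definition between :: "'a set \<Rightarrow> 'a set \<Rightarrow> 'a set set" where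
  "between A B = {C \<in> L. A \<subseteq> C \<and> C \<subseteq> B}"

lemma intermediate_rings_between:
  assumes "A \<in> L"
  shows "intermediate_rings S A B = between A B"
  unfolding between_def intermediate_rings_def using R_le[OF assms] subringE(1) by blast

lemma between_iff: "C \<in> between A B \<longleftrightarrow> C \<in> L \<and> A \<subseteq> C \<and> C \<subseteq> B"
  by (simp add: between_def)

end

lemma ecard_Un_disjoint: "A \<inter> B = {} \<Longrightarrow> ecard (A \<union> B) = ecard A + ecard B"
  by (simp add: ecard_def card_Un_disjoint)

lemma ecard_empty [simp]: "ecard {} = 0"
  by (simp add: ecard_def zero_enat_def)

lemma ecard_sing [simp]: "ecard {a} = 1" and ecard_pair: "a \<noteq> b \<Longrightarrow> ecard {a, b} = 2"
  by (simp_all add: ecard_def one_enat_def numeral_eq_enat)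

lemma one_noteq_two: "(1::enat) \<noteq> 2" "(0::enat) \<noteq> 1" "(0::enat) \<noteq> 2"
  by (simp_all add: one_enat_def numeral_eq_enat zero_enat_def)

lemma ecard_Times: "ecard (A \<times> B) = ecard A * ecard B"
proof (cases "A = {} \<or> B = {}")
  case True
  then show ?thesis
    by auto
next
  case False
  then have "ecard A \<noteq> 0" "ecard B \<noteq> 0"
    by (auto simp: ecard_def zero_enat_def)
  then show ?thesis
    using False by (auto simp: ecard_def finite_cartesian_product_iff card_cartesian_product
        imult_is_infinity zero_enat_def)
qed

lemma ecard_bij_betw: "bij_betw f A B \<Longrightarrow> ecard A = ecard B"
  using bij_betw_finite[of f A B] bij_betw_same_card[of f A B] by (simp add: ecard_def)

lemma finite_chain_enumeration:
  assumes "finite Q" "card Q = Suc k" "\<And>A B. A \<in> Q \<Longrightarrow> B \<in> Q \<Longrightarrow> A \<subseteq> B \<or> B \<subseteq> A"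
  shows "\<exists>C :: nat \<Rightarrow> 'a set. (\<forall>i \<le> k. C i \<in> Q) \<and> (\<forall>i < k. C i \<subset> C (Suc i))"
  using assms
proof (induction k arbitrary: Q)
  case 0
  then obtain A where "A \<in> Q"
    by (metis card.empty ex_in_conv nat.distinct(1))
  then show ?case
    by (intro exI[of _ "\<lambda>_. A"]) simp
next
  case (Suc k)
  have "Q \<noteq> {}"
    using Suc.prems by auto
  then obtain Y where Y: "Y \<in> Q" "\<And>Z. Z \<in> Q \<Longrightarrow> Y \<subseteq> Z \<Longrightarrow> Y = Z"
    using finite_has_maximal[OF Suc.prems(1)] by metis
  have top: "Z \<subset> Y" if "Z \<in> Q - {Y}" for Z
    using that Suc.prems(3)[of Z Y] Y by blast
  have "card (Q - {Y}) = Suc k"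
    using Suc.prems Y(1) by simp
  moreover have "finite (Q - {Y})"
    using Suc.prems(1) by simp
  ultimately obtain C :: "nat \<Rightarrow> 'a set" where C: "\<forall>i \<le> k. C i \<in> Q - {Y}" "\<forall>i < k. C i \<subset> C (Suc i)"
    using Suc.IH[of "Q - {Y}"] Suc.prems(3) by auto
  define D where "D i = (if i \<le> k then C i else Y)" for i
  have "\<forall>i \<le> Suc k. D i \<in> Q"
    using C(1) Y(1) by (simp add: D_def)
  moreover have "D i \<subset> D (Suc i)" if "i < Suc k" for i
  proof (cases "i = k")
    case True
    then show ?thesis
      using top[of "C k"] C(1) by (simp add: D_def)
  next
    case False
    then show ?thesis
      using C(2) that by (simp add: D_def)
  qed
  ultimately show ?case
    by blast
qed

context distributive_local_extension
begin

lemma chain_length: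
  assumes A: "A \<in> L" and B: "B \<in> L" "A \<subseteq> B"
    and chain: "\<And>H Y. H \<in> between A B \<Longrightarrow> Y \<in> between A B \<Longrightarrow> H \<subseteq> Y \<or> Y \<subseteq> H"
  shows "ecard (between A B - {B}) = extension_length S A B" "ecard (between A B) = extension_length S A B + 1"
proof -
  let ?Q = "between A B"
  have "subset.chain L ?Q"
    using chain A by (auto simp: subset_chain_def between_iff)
  then have fin: "finite ?Q"
    using FCP by (auto simp: FCP_extension_def)
  have BQ: "B \<in> ?Q"
    using A B by (simp add: between_iff)
  then have "card ?Q \<noteq> 0"
    using fin by auto
  then obtain k where k: "card ?Q = Suc k"
    using not0_implies_Suc by blast
  let ?E = "{enat n |n. \<exists>C :: nat \<Rightarrow> 'a set. (\<forall>i \<le> n. C i \<in> ?Q) \<and> (\<forall>i < n. C i \<subset> C (Suc i))}"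
  have len: "extension_length S A B = enat k"
    unfolding extension_length_def intermediate_rings_between[OF A]
  proof (rule antisym)
    show "enat k \<le> Sup ?E"
      using finite_chain_enumeration[OF fin k chain] by (intro Sup_upper) blast
    show "Sup ?E \<le> enat k"
    proof (rule Sup_least)
      fix x assume "x \<in> ?E"
      then obtain n and C :: "nat \<Rightarrow> 'a set" where x: "x = enat n" and C: "\<forall>i \<le> n. C i \<in> ?Q" "\<forall>i < n. C i \<subset> C (Suc i)"
        by blast
      have less: "i < j \<Longrightarrow> j \<le> n \<Longrightarrow> C i \<subset> C j" for i j
      proof (induction j)
        case (Suc j)
        then have "C j \<subset> C (Suc j)"
          using C(2) by simp
        then show ?case
          using Suc by (cases "i = j") auto
      qed simp
      have "inj_on C {..n}"
        using less by (intro linorder_inj_onI) auto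
      then have "card {..n} \<le> card ?Q"
        using C(1) fin by (intro card_inj_on_le[of C]) auto
      then show "x \<le> enat k"
        using x k by simp
    qed
  qed
  show "ecard (?Q - {B}) = extension_length S A B"
    unfolding len ecard_def using fin BQ k by simp
  show "ecard ?Q = extension_length S A B + 1"
    unfolding len ecard_def using fin k by (simp add: one_enat_def)
qed

lemma count_local:
  assumes NT: "N = T"
  shows "ecard L = extension_length S R N + ecard (between T (carrier S))"
proof -
  have ch: "H \<subseteq> Y \<or> Y \<subseteq> H" if "H \<in> between R N" "Y \<in> between R N" for H Y
    using N_chain[of H Y] that by (simp add: between_iff)
  have "L = (between R N - {N}) \<union> between T (carrier S)"
  proof (intro equalityI subsetI)
    fix H assume H: "H \<in> L"
    then have "H \<subseteq> N \<or> N \<subseteq> H"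
      using comparable_T_local[of H] NT by blast
    then show "H \<in> (between R N - {N}) \<union> between T (carrier S)"
      using H NT R_le le_S by (auto simp: between_iff)
  next
    fix H assume "H \<in> (between R N - {N}) \<union> between T (carrier S)"
    then show "H \<in> L"
      by (auto simp: between_iff)
  qed
  moreover have "(between R N - {N}) \<inter> between T (carrier S) = {}"
    unfolding NT between_def by blast
  ultimately have "ecard L = ecard (between R N - {N}) + ecard (between T (carrier S))"
    using ecard_Un_disjoint by metis
  then show ?thesis
    using chain_length(1)[OF R_L N_L R_le[OF N_L] ch] by simp
qed

lemma count_nonlocal:
  assumes e: "split_idem e"
  shows "ecard L = extension_length S R N + 1 + ecard (between U (carrier S))"
proof -
  have ch: "H \<subseteq> Y \<or> Y \<subseteq> H" if "H \<in> between R N" "Y \<in> between R N" for H Y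
    using N_chain[of H Y] that by (simp add: between_iff)
  have "L = between R N \<union> between U (carrier S)"
  proof (intro equalityI subsetI)
    fix H assume H: "H \<in> L"
    then show "H \<in> between R N \<union> between U (carrier S)"
      using dichotomy[OF e H] R_le[OF H] le_S[OF H] by (auto simp: between_iff)
  next
    fix H assume "H \<in> between R N \<union> between U (carrier S)"
    then show "H \<in> L"
      by (auto simp: between_iff)
  qed
  moreover have "between R N \<inter> between U (carrier S) = {}"
    using e_U[OF e] e_N[OF split_mod[OF e]] unfolding between_def by blast
  ultimately have "ecard L = ecard (between R N) + ecard (between U (carrier S))"
    using ecard_Un_disjoint by metis
  then show ?thesis
    using chain_length(2)[OF R_L N_L R_le[OF N_L] ch] by simp
qed

text \<open>
  Distributivity twice: \<open>H\<close> is the join of its intersections with \<open>V e\<close> and \<open>V (1 - e)\<close>, and a join of \<open>H1\<close> and \<open>H2\<close>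
  meets \<open>V e\<close> in \<open>H1\<close> because \<open>V e\<close> meets \<open>H2\<close> in \<open>U\<close>.
\<close>
lemma component_bij:
  assumes e: "split_idem e"
  shows "bij_betw (\<lambda>H. (H \<inter> V e, H \<inter> V (\<one> \<ominus> e))) (between U (carrier S)) (between U (V e) \<times> between U (V (\<one> \<ominus> e)))"
proof (rule bij_betw_byWitness[where f' = "\<lambda>(H1, H2). compositum S H1 H2"])
  note e' = split_idem_complement[OF e]
  note V1 = V_L[OF e] and V2 = V_L[OF e']
  show "\<forall>H \<in> between U (carrier S). (\<lambda>(H1, H2). compositum S H1 H2) (H \<inter> V e, H \<inter> V (\<one> \<ominus> e)) = H"
  proof
    fix H assume "H \<in> between U (carrier S)"
    then have H: "H \<in> L"
      by (simp add: between_iff)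
    have "compositum S (H \<inter> V e) (H \<inter> V (\<one> \<ominus> e)) = H"
      using distrib_inf_sup[OF H V1 V2] V_join[OF e] le_S[OF H] by auto
    then show "(\<lambda>(H1, H2). compositum S H1 H2) (H \<inter> V e, H \<inter> V (\<one> \<ominus> e)) = H"
      by simp
  qed
  have half: "compositum S H1 H2 \<inter> V d = H1"
    if d: "split_idem d" and H1: "H1 \<in> L" "U \<subseteq> H1" "H1 \<subseteq> V d" and H2: "H2 \<in> L" "H2 \<inter> V d \<subseteq> U" for d H1 H2
  proof -
    have "V d \<inter> compositum S H1 H2 = compositum S (V d \<inter> H1) (V d \<inter> H2)"
      by (rule distrib_inf_sup[OF V_L[OF d] H1(1) H2(1)])
    also have "V d \<inter> H1 = H1"
      using H1(3) by blast
    also have "compositum S H1 (V d \<inter> H2) = H1"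
      using compositum_absorb[OF _ H1(1), of "V d \<inter> H2"] H1 H2 V_L[OF d] compositum_commute by auto
    finally show ?thesis
      by (simp only: Int_commute)
  qed
  show "\<forall>p \<in> between U (V e) \<times> between U (V (\<one> \<ominus> e)).
    (\<lambda>H. (H \<inter> V e, H \<inter> V (\<one> \<ominus> e))) ((\<lambda>(H1, H2). compositum S H1 H2) p) = p"
  proof
    fix p assume "p \<in> between U (V e) \<times> between U (V (\<one> \<ominus> e))"
    then obtain H1 H2 where p: "p = (H1, H2)" and H1: "H1 \<in> L" "U \<subseteq> H1" "H1 \<subseteq> V e"
      and H2: "H2 \<in> L" "U \<subseteq> H2" "H2 \<subseteq> V (\<one> \<ominus> e)"
      by (auto simp: between_iff)
    have "H2 \<inter> V e \<subseteq> U" "H1 \<inter> V (\<one> \<ominus> e) \<subseteq> U"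
      using V_inter[OF e] H1 H2 by blast+
    then have "compositum S H1 H2 \<inter> V e = H1" "compositum S H1 H2 \<inter> V (\<one> \<ominus> e) = H2"
      using half[OF e H1 H2(1)] half[OF e' H2 H1(1)] compositum_commute by auto
    then show "(\<lambda>H. (H \<inter> V e, H \<inter> V (\<one> \<ominus> e))) ((\<lambda>(H1, H2). compositum S H1 H2) p) = p"
      unfolding p by simp
  qed
  show "(\<lambda>H. (H \<inter> V e, H \<inter> V (\<one> \<ominus> e))) ` between U (carrier S) \<subseteq> between U (V e) \<times> between U (V (\<one> \<ominus> e))"
    using V1 V2 U_V[OF e] U_V[OF e'] by (auto simp: between_iff)
  show "(\<lambda>(H1, H2). compositum S H1 H2) ` (between U (V e) \<times> between U (V (\<one> \<ominus> e))) \<subseteq> between U (carrier S)"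
  proof
    fix H assume "H \<in> (\<lambda>(H1, H2). compositum S H1 H2) ` (between U (V e) \<times> between U (V (\<one> \<ominus> e)))"
    then obtain H1 H2 where H: "H = compositum S H1 H2" and H': "H1 \<in> L" "U \<subseteq> H1" "H2 \<in> L"
      by (auto simp: between_iff)
    have "U \<subseteq> H"
      unfolding H using H'(2) compositum_upper(1)[OF H'(1,3)] by blast
    moreover have "H \<in> L"
      unfolding H using H' by simp
    ultimately show "H \<in> between U (carrier S)"
      using le_S[of H] by (simp add: between_iff)
  qed
qed

text \<open>
  Under \<open>component_bij\<close> the rings above \<open>T\<close> correspond to the pairs whose second component is above \<open>T\<close>.
\<close>
lemma count_components:
  assumes e: "split_idem e" and TV: "T \<inter> V e = U"
  shows "ecard (between U (carrier S)) =
    extension_length S U T * ecard (between U (V e)) + ecard (between T (carrier S))"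
proof -
  note e' = split_idem_complement[OF e]
  note V1 = V_L[OF e] and V2 = V_L[OF e']
  let ?V1 = "V e" and ?V2 = "V (\<one> \<ominus> e)"
  let ?f = "\<lambda>H. (H \<inter> ?V1, H \<inter> ?V2)"
  have TV2: "T \<subseteq> ?V2"
    by (rule T_le_V[OF e TV])
  have ch: "H \<subseteq> Y \<or> Y \<subseteq> H" if "H \<in> between U T" "Y \<in> between U T" for H Y
    using U_T_chain[OF e, of H Y] that by (simp add: between_iff)
  have "between U ?V2 = (between U T - {T}) \<union> between T ?V2"
  proof (intro equalityI subsetI)
    fix H assume H: "H \<in> between U ?V2"
    then have "H \<subseteq> T \<or> T \<subseteq> H"
      using comparable_V[OF e TV2, of H] by (simp add: between_iff)
    then show "H \<in> (between U T - {T}) \<union> between T ?V2"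
      using H by (auto simp: between_iff)
  next
    fix H assume "H \<in> (between U T - {T}) \<union> between T ?V2"
    then show "H \<in> between U ?V2"
      using TV2 U_T by (auto simp: between_iff)
  qed
  moreover have "(between U T - {T}) \<inter> between T ?V2 = {}"
    by (auto simp: between_iff)
  ultimately have "ecard (between U ?V2) = ecard (between U T - {T}) + ecard (between T ?V2)"
    using ecard_Un_disjoint by metis
  also have "ecard (between U T - {T}) = extension_length S U T"
    by (rule chain_length(1)[OF U_L T_L U_T ch])
  finally have c2: "ecard (between U ?V2) = extension_length S U T + ecard (between T ?V2)" .
  have cU: "ecard (between U (carrier S)) = ecard (between U ?V1) * ecard (between U ?V2)"
    using ecard_bij_betw[OF component_bij[OF e]] by (simp add: ecard_Times)
  have img: "?f ` between T (carrier S) = between U ?V1 \<times> between T ?V2"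
  proof (intro equalityI subsetI)
    fix p assume "p \<in> ?f ` between T (carrier S)"
    then obtain H where "p = ?f H" "H \<in> between T (carrier S)"
      by (rule imageE)
    then have H: "p = ?f H" "H \<in> L" "T \<subseteq> H"
      by (simp_all add: between_iff)
    have "U \<subseteq> H \<inter> ?V1" "T \<subseteq> H \<inter> ?V2"
      using H(3) U_T U_V[OF e] TV2 by blast+
    then show "p \<in> between U ?V1 \<times> between T ?V2"
      unfolding H(1) using H(2) V1 V2 by (simp add: between_iff)
  next
    fix p assume p: "p \<in> between U ?V1 \<times> between T ?V2"
    have "between T ?V2 \<subseteq> between U ?V2"
      using U_T unfolding between_def by blast
    then have "p \<in> between U ?V1 \<times> between U ?V2"
      using p by (rule subsetD[OF Sigma_mono[OF order_refl]])
    then have "p \<in> ?f ` between U (carrier S)"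
      using bij_betw_imp_surj_on[OF component_bij[OF e]] by (simp only:)
    then obtain H where H: "p = ?f H" "H \<in> between U (carrier S)"
      by (rule imageE)
    have "T \<subseteq> H"
      using p unfolding H(1) between_def by simp
    then have "H \<in> between T (carrier S)"
      using H(2) by (simp add: between_iff)
    then show "p \<in> ?f ` between T (carrier S)"
      unfolding H(1) by (rule imageI)
  qed
  have "between T (carrier S) \<subseteq> between U (carrier S)"
    using U_T unfolding between_def by blast
  then have "inj_on ?f (between T (carrier S))"
    by (rule inj_on_subset[OF bij_betw_imp_inj_on[OF component_bij[OF e]]])
  then have "bij_betw ?f (between T (carrier S)) (between U ?V1 \<times> between T ?V2)"
    using img by (rule bij_betw_imageI)
  then have cT: "ecard (between T (carrier S)) = ecard (between U ?V1) * ecard (between T ?V2)"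
    using ecard_bij_betw[of ?f] by (simp only: ecard_Times)
  show ?thesis
    unfolding cU c2 cT by (simp only: distrib_left mult.commute)
qed

section \<open>Supports of quotients of rings\<close>

lemma coset_eq:
  assumes B: "B \<in> L" and x: "x \<in> carrier S" and y: "y \<in> carrier S"
  shows "B +> x = B +> y \<longleftrightarrow> x \<ominus> y \<in> B"
proof
  assume eq: "B +> x = B +> y"
  have "\<zero> \<oplus> x \<in> B +> x"
    using L_closed(1)[OF B] by (auto simp: a_r_coset_def')
  then have "x \<in> B +> y"
    unfolding eq using x by simp
  then obtain b where b: "b \<in> B" "x = b \<oplus> y"
    by (auto simp: a_r_coset_def')
  have "x \<ominus> y = b"
    unfolding b(2) using L_carrier[OF B b(1)] y by - (rule poly_eqI[of "[b,y]"], (rule poly_reify)+, simp_all add: poly_simps)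
  then show "x \<ominus> y \<in> B"
    using b(1) by simp
next
  have *: "B +> x \<subseteq> B +> y" if "x \<in> carrier S" "y \<in> carrier S" and d: "x \<ominus> y \<in> B" for x y
  proof
    fix z assume "z \<in> B +> x"
    then obtain b where b: "b \<in> B" "z = b \<oplus> x"
      by (auto simp: a_r_coset_def')
    have "z = (b \<oplus> (x \<ominus> y)) \<oplus> y"
      unfolding b(2) using L_carrier[OF B b(1)] that(1,2) by - (rule poly_eqI[of "[b,x,y]"], (rule poly_reify)+, simp_all add: poly_simps)
    then show "z \<in> B +> y"
      unfolding a_r_coset_def' using L_closed(4)[OF B b(1) d] by blast
  qed
  assume d: "x \<ominus> y \<in> B"
  have "y \<ominus> x = \<ominus> (x \<ominus> y)"
    using x y by - (rule poly_eqI[of "[x,y]"], (rule poly_reify)+, simp_all add: poly_simps)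
  then have "y \<ominus> x \<in> B"
    using L_closed(3)[OF B d] by simp
  then show "B +> x = B +> y"
    using *[OF x y d] *[OF y x] by blast
qed

lemma coset_zero: "B \<in> L \<Longrightarrow> B +> \<zero> = B"
proof -
  assume B: "B \<in> L"
  have "b \<oplus> \<zero> = b" if "b \<in> B" for b
    using L_carrier[OF B that] by simp
  then show ?thesis
    by (auto simp: a_r_coset_def')
qed

lemma coset_eq_self: "B \<in> L \<Longrightarrow> x \<in> carrier S \<Longrightarrow> B +> x = B \<longleftrightarrow> x \<in> B"
  using coset_eq[of B x \<zero>] coset_zero[of B] by (simp add: a_minus_def)

lemma quotient_module_sel:
  "carrier (quotient_module S C B) = (\<lambda>x. B +> x) ` C"
  "\<zero>\<^bsub>quotient_module S C B\<^esub> = B"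
  "a \<odot>\<^bsub>quotient_module S C B\<^esub> K = (\<Union>x \<in> K. B +> (a \<otimes> x))"
  by (auto simp: quotient_module_def A_RCOSETS_def' a_r_coset_def')

lemma quotient_smult:
  assumes B: "B \<in> L" and a: "a \<in> B" and x: "x \<in> carrier S"
  shows "a \<odot>\<^bsub>quotient_module S C B\<^esub> (B +> x) = B +> (a \<otimes> x)"
proof -
  have ac: "a \<in> carrier S"
    using L_carrier[OF B a] .
  have "B +> (a \<otimes> z) = B +> (a \<otimes> x)" if z: "z \<in> B +> x" for z
  proof -
    obtain b where b: "b \<in> B" "z = b \<oplus> x"
      using z by (auto simp: a_r_coset_def')
    have bc: "b \<in> carrier S"
      using L_carrier[OF B b(1)] .
    have "a \<otimes> z \<ominus> a \<otimes> x = a \<otimes> b"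
      unfolding b(2) using ac bc x by - (rule poly_eqI[of "[a,b,x]"], (rule poly_reify)+, simp_all add: poly_simps)
    then have "a \<otimes> z \<ominus> a \<otimes> x \<in> B"
      using L_closed(5)[OF B a b(1)] by simp
    then show ?thesis
      using coset_eq[OF B, of "a \<otimes> z" "a \<otimes> x"] ac bc x b(2) by simp
  qed
  moreover have "\<zero> \<oplus> x \<in> B +> x"
    using L_closed(1)[OF B] unfolding a_r_coset_def' by blast
  ultimately show ?thesis
    unfolding quotient_module_sel by blast
qed

text \<open>
  A prime supports \<open>C / B\<close> if and only if it contains the annihilator of some element. If every element
  is annihilated outside \<open>P\<close>, all fractions are equal; conversely, \<open>x / 1 = 0 / 1\<close> yields an annihilator of
  \<open>x\<close> outside \<open>P\<close>.
\<close>
lemma Supp_quot_iff: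
  assumes A: "A \<in> L" "A \<subseteq> B" and B: "B \<in> L" "B \<subseteq> C" and C: "C \<in> L"
  shows "P \<in> Supp_quot S A C B \<longleftrightarrow>
    primeideal P (S\<lparr>carrier := A\<rparr>) \<and> (\<exists>x \<in> C. \<forall>s \<in> A - P. s \<otimes> x \<notin> B)"
proof (cases "primeideal P (S\<lparr>carrier := A\<rparr>)")
  case False
  then show ?thesis
    by (simp add: Supp_quot_def Supp_def)
next
  case True
  then have P: "sub_ideal P A" "P \<noteq> A" "\<And>a b. a \<in> A \<Longrightarrow> b \<in> A \<Longrightarrow> a \<otimes> b \<in> P \<Longrightarrow> a \<in> P \<or> b \<in> P"
    unfolding primeideal_iff[OF A(1)] by blast+
  have oneP: "\<one> \<in> A - P"
    using sub_ideal_one[OF A(1) P(1)] P(2) A(1) by auto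
  let ?M = "quotient_module S C B"
  let ?A = "S\<lparr>carrier := A\<rparr>"
  let ?rel = "localization_rel ?A ?M P"
  let ?F = "carrier ?M \<times> (carrier ?A - P)"
  have Ac: "a \<in> A \<Longrightarrow> a \<in> carrier S" and AB: "a \<in> A \<Longrightarrow> a \<in> B" for a
    using L_carrier[OF A(1)] A(2) by auto
  have Cc: "x \<in> C \<Longrightarrow> x \<in> carrier S" for x
    using L_carrier[OF C] .
  have rel: "((B +> x, s), (B +> y, t)) \<in> ?rel \<longleftrightarrow>
      s \<in> A - P \<and> t \<in> A - P \<and> (\<exists>u \<in> A - P. B +> (u \<otimes> (t \<otimes> x)) = B +> (u \<otimes> (s \<otimes> y)))"
    if xy: "x \<in> C" "y \<in> C" for x y s t
  proof -
    have smult: "u \<odot>\<^bsub>?M\<^esub> (t \<odot>\<^bsub>?M\<^esub> (B +> x)) = B +> (u \<otimes> (t \<otimes> x))"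
      if "u \<in> A" "t \<in> A" "x \<in> C" for u t x
      using that quotient_smult[OF B(1) AB] Ac Cc by simp
    have "(\<exists>u \<in> A - P. u \<odot>\<^bsub>?M\<^esub> (t \<odot>\<^bsub>?M\<^esub> (B +> x)) = u \<odot>\<^bsub>?M\<^esub> (s \<odot>\<^bsub>?M\<^esub> (B +> y))) \<longleftrightarrow>
        (\<exists>u \<in> A - P. B +> (u \<otimes> (t \<otimes> x)) = B +> (u \<otimes> (s \<otimes> y)))" if "s \<in> A" "t \<in> A"
      by (rule bex_cong[OF refl]) (simp add: smult xy that)
    moreover have "B +> x \<in> carrier ?M" "B +> y \<in> carrier ?M"
      unfolding quotient_module_sel(1) using xy by blast+
    moreover have "((B +> x, s), (B +> y, t)) \<in> ?rel \<longleftrightarrow>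
        B +> x \<in> carrier ?M \<and> B +> y \<in> carrier ?M \<and> s \<in> A - P \<and> t \<in> A - P \<and>
        (\<exists>u \<in> A - P. u \<odot>\<^bsub>?M\<^esub> (t \<odot>\<^bsub>?M\<^esub> (B +> x)) = u \<odot>\<^bsub>?M\<^esub> (s \<odot>\<^bsub>?M\<^esub> (B +> y)))"
      by (simp add: localization_rel_def)
    ultimately show ?thesis
      by blast
  qed
  have zero: "B = B +> \<zero>" and zC: "\<zero> \<in> C"
    using coset_zero[OF B(1)] C by simp_all
  have self: "x \<in> carrier S \<Longrightarrow> B +> x = B \<longleftrightarrow> x \<in> B" for x
    using coset_eq_self[OF B(1)] .
  have loc: "localized_module ?A ?M P = {?rel `` {(\<zero>\<^bsub>?M\<^esub>, \<one>\<^bsub>?A\<^esub>)}} \<longleftrightarrow>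
      (\<forall>x \<in> C. \<exists>u \<in> A - P. u \<otimes> x \<in> B)"
  proof
    assume eq: "localized_module ?A ?M P = {?rel `` {(\<zero>\<^bsub>?M\<^esub>, \<one>\<^bsub>?A\<^esub>)}}"
    show "\<forall>x \<in> C. \<exists>u \<in> A - P. u \<otimes> x \<in> B"
    proof
      fix x assume x: "x \<in> C"
      have "(B +> x, \<one>) \<in> ?F"
        using x oneP unfolding quotient_module_sel(1) by simp
      then have "?rel `` {(B +> x, \<one>)} \<in> localized_module ?A ?M P"
        unfolding localized_module_def by (rule quotientI)
      then have "?rel `` {(B +> x, \<one>)} = ?rel `` {(B +> \<zero>, \<one>)}"
        unfolding eq quotient_module_sel(2) using zero by simp
      moreover have "((B +> x, \<one>), (B +> x, \<one>)) \<in> ?rel"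
        using rel[OF x x, of \<one> \<one>] oneP by auto
      ultimately have "((B +> \<zero>, \<one>), (B +> x, \<one>)) \<in> ?rel"
        by blast
      then obtain u where u: "u \<in> A - P" "B +> (u \<otimes> (\<one> \<otimes> \<zero>)) = B +> (u \<otimes> (\<one> \<otimes> x))"
        using rel[OF zC x, of \<one> \<one>] by blast
      have uc: "u \<in> carrier S"
        using u Ac by blast
      have "B +> (u \<otimes> x) = B"
        using u(2) uc Cc[OF x] zero by simp
      then have "u \<otimes> x \<in> B"
        using self[of "u \<otimes> x"] uc Cc[OF x] by simp
      then show "\<exists>u \<in> A - P. u \<otimes> x \<in> B"
        using u(1) by blast
    qed
  next
    assume ann: "\<forall>x \<in> C. \<exists>u \<in> A - P. u \<otimes> x \<in> B"
    have all: "(p, q) \<in> ?rel" if pq: "p \<in> ?F" "q \<in> ?F" for p q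
    proof -
      obtain x s y t where p: "p = (B +> x, s)" "x \<in> C" "s \<in> A - P" and q: "q = (B +> y, t)" "y \<in> C" "t \<in> A - P"
        using pq unfolding quotient_module_sel(1) by auto
      obtain u where u: "u \<in> A - P" "u \<otimes> x \<in> B"
        using ann p(2) by blast
      obtain v where v: "v \<in> A - P" "v \<otimes> y \<in> B"
        using ann q(2) by blast
      have mem: "u \<in> A" "v \<in> A" "s \<in> A" "t \<in> A"
        using u v p q by auto
      have [simp]: "x \<in> carrier S" "y \<in> carrier S" "s \<in> carrier S" "t \<in> carrier S" "u \<in> carrier S" "v \<in> carrier S"
        using mem Ac Cc p(2) q(2) by auto
      have uv: "u \<otimes> v \<in> A - P"
        using P(3)[OF mem(1,2)] u(1) v(1) L_closed(5)[OF A(1) mem(1,2)] by blast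
      have "u \<otimes> v \<otimes> (t \<otimes> x) = (v \<otimes> t) \<otimes> (u \<otimes> x)"
        by - (rule poly_eqI[of "[u,v,t,x]"], (rule poly_reify)+, simp_all add: poly_simps)
      moreover have "(v \<otimes> t) \<otimes> (u \<otimes> x) \<in> B"
        by (rule L_closed(5)[OF B(1) AB[OF L_closed(5)[OF A(1) mem(2,4)]] u(2)])
      ultimately have 1: "B +> (u \<otimes> v \<otimes> (t \<otimes> x)) = B"
        using self[of "u \<otimes> v \<otimes> (t \<otimes> x)"] by simp
      have "u \<otimes> v \<otimes> (s \<otimes> y) = (u \<otimes> s) \<otimes> (v \<otimes> y)"
        by - (rule poly_eqI[of "[u,v,s,y]"], (rule poly_reify)+, simp_all add: poly_simps)
      moreover have "(u \<otimes> s) \<otimes> (v \<otimes> y) \<in> B"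
        by (rule L_closed(5)[OF B(1) AB[OF L_closed(5)[OF A(1) mem(1,3)]] v(2)])
      ultimately have 2: "B +> (u \<otimes> v \<otimes> (s \<otimes> y)) = B"
        using self[of "u \<otimes> v \<otimes> (s \<otimes> y)"] by simp
      show ?thesis
        unfolding p(1) q(1) rel[OF p(2) q(2)] using p(3) q(3) uv 1 2 by blast
    qed
    have sub: "?rel \<subseteq> ?F \<times> ?F"
      by (auto simp: localization_rel_def)
    have cls: "?rel `` {p} = ?F" if "p \<in> ?F" for p
      using all[OF that] sub by blast
    have "(B +> \<zero>, \<one>) \<in> ?F"
      using zC oneP unfolding quotient_module_sel(1) by simp
    then have mem: "(\<zero>\<^bsub>?M\<^esub>, \<one>\<^bsub>?A\<^esub>) \<in> ?F"
      unfolding quotient_module_sel(2) using zero by simp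
    have "localized_module ?A ?M P = (\<lambda>p. ?rel `` {p}) ` ?F"
      unfolding localized_module_def quotient_def by blast
    also have "\<dots> = (\<lambda>p. ?F) ` ?F"
      by (rule image_cong[OF refl cls])
    also have "\<dots> = {?F}"
      using mem by blast
    finally show "localized_module ?A ?M P = {?rel `` {(\<zero>\<^bsub>?M\<^esub>, \<one>\<^bsub>?A\<^esub>)}}"
      using cls[OF mem] by simp
  qed
  show ?thesis
    unfolding Supp_quot_def Supp_def mem_Collect_eq using True loc by blast
qed

lemma prime_power_mem:
  assumes A: "A \<in> L" and P: "primeideal P (S\<lparr>carrier := A\<rparr>)" and a: "a \<in> A" "a [^] (k::nat) \<in> P"
  shows "a \<in> P"
  using a(2)
proof (induction k)
  case 0
  then have "\<one> \<in> P"
    by simp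
  then show ?case
    using P sub_ideal_one[OF A, of P] unfolding primeideal_iff[OF A] by blast
next
  case (Suc k)
  then have "a [^] k \<otimes> a \<in> P"
    by simp
  then show ?case
    using Suc.IH P L_pow[OF A a(1)] a(1) unfolding primeideal_iff[OF A] by blast
qed

text \<open>
  Every \<open>a \<in> m\<close> has a power that multiplies a given \<open>x\<close> into \<open>R \<subseteq> B\<close>.
\<close>
lemma Supp_contains_m:
  assumes A: "A \<in> L" "A \<subseteq> B" and B: "B \<in> L" "B \<subseteq> C" and C: "C \<in> L"
    and P: "P \<in> Supp_quot S A C B"
  shows "m \<subseteq> P"
proof
  fix a assume a: "a \<in> m"
  have prime: "primeideal P (S\<lparr>carrier := A\<rparr>)"
    using P unfolding Supp_quot_iff[OF A B C] by blast
  obtain x where x: "x \<in> C" "\<And>s. s \<in> A - P \<Longrightarrow> s \<otimes> x \<notin> B"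
    using P unfolding Supp_quot_iff[OF A B C] by blast
  have xc: "x \<in> carrier S" and aR: "a \<in> R" and aA: "a \<in> A" and ac: "a \<in> carrier S"
    using L_carrier[OF C x(1)] m_closed(2)[OF a] L_R[OF A(1)] L_carrier[OF R_L] by auto
  obtain D j where D: "D \<in> L" "x \<in> D" "\<And>c. c \<in> D \<Longrightarrow> c \<otimes> a [^] (j::nat) \<in> R"
    by (rule power_conducts[OF resid_local_at[OF resid_R] a xc]) (rule that; assumption)
  have "a [^] j \<otimes> x = x \<otimes> a [^] j"
    using xc ac by (simp add: m_comm)
  then have "a [^] j \<otimes> x \<in> B"
    using D(3)[OF D(2)] L_R[OF B(1)] by simp
  then have "a [^] j \<in> P"
    using x(2)[of "a [^] j"] L_pow[OF A(1) aA, of j] by blast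
  then show "a \<in> P"
    by (rule prime_power_mem[OF A(1) prime aA])
qed

lemma m_prime: "primeideal m (S\<lparr>carrier := R\<rparr>)"
  unfolding primeideal_iff[OF R_L]
proof (intro conjI ballI impI m_ideal)
  show "m \<noteq> R"
    using one_m L_closed(2)[OF R_L] by blast
  fix a b assume ab: "a \<in> R" "b \<in> R" "a \<otimes> b \<in> m"
  show "a \<in> m \<or> b \<in> m"
  proof (rule disjCI)
    assume "b \<notin> m"
    then obtain z where z: "z \<in> R" "b \<otimes> z = \<one>"
      using R_unit ab by blast
    have [simp]: "a \<in> carrier S" "b \<in> carrier S" "z \<in> carrier S"
      using ab z L_carrier[OF R_L] by auto
    have "z \<otimes> (a \<otimes> b) = b \<otimes> z \<otimes> a"
      by - (rule poly_eqI[of "[z,a,b]"], (rule poly_reify)+, simp_all add: poly_simps)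
    then show "a \<in> m"
      using m_closed(6)[OF z(1) ab(3)] unfolding z(2) by simp
  qed
qed

lemma Supp_R:
  assumes C: "C \<in> L"
  shows "Supp_quot S R C R = (if C = R then {} else {m})"
proof -
  have RC: "R \<subseteq> C"
    using R_le[OF C] .
  have "P = m" if P: "P \<in> Supp_quot S R C R" for P
  proof -
    have "sub_ideal P R" "P \<noteq> R"
      using P unfolding Supp_quot_iff[OF R_L order_refl R_L RC C] primeideal_iff[OF R_L] by blast+
    moreover have "m \<subseteq> P"
      by (rule Supp_contains_m[OF R_L order_refl R_L RC C P])
    moreover have "m \<in> Max_ideals (S\<lparr>carrier := R\<rparr>)"
      using Max_ideals_R by simp
    ultimately show ?thesis
      unfolding Max_ideals_iff[OF R_L] by blast
  qed
  moreover have "m \<in> Supp_quot S R C R \<longleftrightarrow> C \<noteq> R"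
  proof -
    have "(\<exists>x \<in> C. \<forall>s \<in> R - m. s \<otimes> x \<notin> R) \<longleftrightarrow> C \<noteq> R"
    proof
      assume "\<exists>x \<in> C. \<forall>s \<in> R - m. s \<otimes> x \<notin> R"
      then obtain x where x: "x \<in> C" "\<forall>s \<in> R - m. s \<otimes> x \<notin> R"
        by blast
      have "\<one> \<in> R - m"
        using one_m by simp
      then have "\<one> \<otimes> x \<notin> R"
        using x(2) by blast
      then show "C \<noteq> R"
        using x(1) L_carrier[OF C x(1)] by auto
    next
      assume "C \<noteq> R"
      then obtain x where x: "x \<in> C" "x \<notin> R"
        using RC by blast
      have "s \<otimes> x \<notin> R" if s: "s \<in> R - m" for s
        using divide_ring[OF resid_local_at[OF resid_R], of x s R] s x L_carrier[OF C x(1)] by auto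
      then show "\<exists>x \<in> C. \<forall>s \<in> R - m. s \<otimes> x \<notin> R"
        using x(1) by blast
    qed
    then show ?thesis
      unfolding Supp_quot_iff[OF R_L order_refl R_L RC C] using m_prime by blast
  qed
  ultimately show ?thesis
    by auto
qed

section \<open>The maximal ideals of U and the splitter\<close>

text \<open>
  For \<open>d = e\<close> and \<open>d = 1 - e\<close> these are the two maximal ideals of \<open>U\<close>.
\<close>
definition M :: "'a \<Rightarrow> 'a set" where
  "M d = {u \<in> U. d \<otimes> u \<in> n}"

lemma M_ideal:
  assumes e: "split_idem e"
  shows "sub_ideal (M e) U"
  unfolding sub_ideal_def
proof (intro conjI ballI)
  note nT = nT_closed[OF e]
  have [simp]: "e \<in> carrier S"
    using split_carrier[OF e] .
  show "M e \<subseteq> U"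
    by (auto simp: M_def)
  show "\<zero> \<in> M e"
    using n_closed(1) by (simp add: M_def)
  fix p assume p: "p \<in> M e"
  have pc: "p \<in> carrier S" and p': "p \<in> U" "e \<otimes> p \<in> n"
    using p U_carrier by (auto simp: M_def)
  show "p \<oplus> q \<in> M e" if q: "q \<in> M e" for q
  proof -
    have "q \<in> carrier S" "q \<in> U" "e \<otimes> q \<in> n"
      using q U_carrier by (auto simp: M_def)
    then show ?thesis
      using n_closed(3)[OF p'(2), of "e \<otimes> q"] p'(1) pc by (simp add: M_def r_distr)
  qed
  show "b \<otimes> p \<in> M e" if b: "b \<in> U" for b
  proof -
    have "e \<otimes> (b \<otimes> p) = b \<otimes> (e \<otimes> p)"
      using U_carrier[OF b] pc by (simp add: m_ac)
    then show ?thesis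
      using nT(2)[OF UT[OF b] p'(2)] b p'(1) by (simp add: M_def)
  qed
qed

lemma M_maximal:
  assumes e: "split_idem e"
  shows "M e \<in> Max_ideals (S\<lparr>carrier := U\<rparr>)"
  unfolding Max_ideals_iff[OF U_L]
proof (intro conjI allI impI)
  have [simp]: "e \<in> carrier S"
    using split_carrier[OF e] .
  show I: "sub_ideal (M e) U"
    by (rule M_ideal[OF e])
  have one: "\<one> \<notin> M e"
    using e_notin_n[OF e] by (simp add: M_def)
  then show "M e \<noteq> U"
    using L_closed(2)[OF U_L] by blast
  fix J assume J: "sub_ideal J U" "M e \<subseteq> J"
  show "J = M e \<or> J = U"
  proof (rule disjCI)
    assume "J \<noteq> U"
    then have oneJ: "\<one> \<notin> J"
      using sub_ideal_one[OF U_L J(1)] by blast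
    note Jc = sub_ideal_closed[OF J(1) U_L]
    have "s \<in> M e" if s: "s \<in> J" for s
    proof (rule ccontr)
      assume "s \<notin> M e"
      then have es: "e \<otimes> s \<notin> n" and sU: "s \<in> U"
        using Jc(2)[OF s] by (auto simp: M_def)
      obtain z where z: "z \<in> R" "e \<otimes> (s \<otimes> z \<ominus> \<one>) \<in> n"
        by (rule component_inverse[OF e UT[OF sU] es])
      have [simp]: "z \<in> carrier S" "s \<in> carrier S"
        using z L_carrier[OF R_L] U_carrier[OF sU] by auto
      have "z \<otimes> s \<ominus> \<one> = s \<otimes> z \<ominus> \<one>"
        by (simp add: m_comm)
      then have "e \<otimes> (z \<otimes> s \<ominus> \<one>) \<in> n"
        using z(2) by simp
      moreover have "z \<otimes> s \<ominus> \<one> \<in> U"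
        using L_R[OF U_L z(1)] sU by simp
      ultimately have "z \<otimes> s \<ominus> \<one> \<in> J"
        using J(2) by (auto simp: M_def)
      then have "z \<otimes> s \<ominus> (z \<otimes> s \<ominus> \<one>) \<in> J"
        using Jc(4)[OF Jc(6)[OF L_R[OF U_L z(1)] s]] by blast
      moreover have "z \<otimes> s \<ominus> (z \<otimes> s \<ominus> \<one>) = \<one>"
        by - (rule poly_eqI[of "[z,s]"], (rule poly_reify)+, simp_all add: poly_simps)
      ultimately show False
        using oneJ by simp
    qed
    then show "J = M e"
      using J(2) by blast
  qed
qed

lemma M_prime:
  assumes e: "split_idem e"
  shows "primeideal (M e) (S\<lparr>carrier := U\<rparr>)"
  unfolding primeideal_iff[OF U_L]
proof (intro conjI ballI impI M_ideal[OF e])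
  show "M e \<noteq> U"
    using M_maximal[OF e] unfolding Max_ideals_iff[OF U_L] by blast
  fix a b assume ab: "a \<in> U" "b \<in> U" "a \<otimes> b \<in> M e"
  then show "a \<in> M e \<or> b \<in> M e"
    using component_prime[OF e UT[OF ab(1)] _ UT[OF ab(2)]] unfolding M_def by blast
qed

lemma M_distinct:
  assumes e: "split_idem e"
  shows "M e \<noteq> M (\<one> \<ominus> e)"
proof -
  have [simp]: "e \<in> carrier S"
    using split_carrier[OF e] .
  have "(\<one> \<ominus> e) \<otimes> e = \<ominus> (e \<otimes> e \<ominus> e)"
    by - (rule poly_eqI[of "[e]"], (rule poly_reify)+, simp_all add: poly_simps)
  then have "e \<in> M (\<one> \<ominus> e)"
    using n_closed(5)[OF f_n[OF e]] e_U[OF e] by (simp add: M_def)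
  moreover have "e \<notin> M e"
    using e_power_notin[OF e, of 1] by (simp add: M_def)
  ultimately show ?thesis
    by blast
qed

text \<open>
  An ideal contained neither in \<open>M e\<close> nor in \<open>M (1 - e)\<close> contains comaximal elements.
\<close>
lemma Max_ideals_U:
  assumes e: "split_idem e"
  shows "Max_ideals (S\<lparr>carrier := U\<rparr>) = {M e, M (\<one> \<ominus> e)}"
proof
  note e' = split_idem_complement[OF e]
  show "{M e, M (\<one> \<ominus> e)} \<subseteq> Max_ideals (S\<lparr>carrier := U\<rparr>)"
    using M_maximal[OF e] M_maximal[OF e'] by blast
  show "Max_ideals (S\<lparr>carrier := U\<rparr>) \<subseteq> {M e, M (\<one> \<ominus> e)}"
  proof
    fix Q assume "Q \<in> Max_ideals (S\<lparr>carrier := U\<rparr>)"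
    then have Q: "sub_ideal Q U" "Q \<noteq> U" "\<And>J. sub_ideal J U \<Longrightarrow> Q \<subseteq> J \<Longrightarrow> J = Q \<or> J = U"
      unfolding Max_ideals_iff[OF U_L] by blast+
    note Qc = sub_ideal_closed[OF Q(1) U_L]
    have "Q \<subseteq> M e \<or> Q \<subseteq> M (\<one> \<ominus> e)"
    proof (rule ccontr)
      assume "\<not> ?thesis"
      then obtain u1 u2 where u: "u1 \<in> Q" "u2 \<in> Q" "u1 \<notin> M e" "u2 \<notin> M (\<one> \<ominus> e)"
        by blast
      have uU: "u1 \<in> U" "u2 \<in> U" "e \<otimes> u1 \<notin> n" "(\<one> \<ominus> e) \<otimes> u2 \<notin> n"
        using u Qc(2) by (auto simp: M_def)
      obtain p q where pq: "p \<in> U" "q \<in> U" "\<one> = p \<otimes> u1 \<oplus> q \<otimes> u2"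
        using comaximal[OF e U_L e_U[OF e] U_T uU] by blast
      have "\<one> \<in> Q"
        unfolding pq(3) by (rule Qc(3)[OF Qc(6)[OF pq(1) u(1)] Qc(6)[OF pq(2) u(2)]])
      then show False
        using sub_ideal_one[OF U_L Q(1)] Q(2) by blast
    qed
    then show "Q \<in> {M e, M (\<one> \<ominus> e)}"
      using Q(3)[OF M_ideal[OF e]] Q(3)[OF M_ideal[OF e']] M_prime[OF e] M_prime[OF e']
      unfolding primeideal_iff[OF U_L] by blast
  qed
qed

text \<open>
  Such a prime contains \<open>n \<inter> U\<close>, hence \<open>e (1 - e)\<close>, hence \<open>e\<close> or \<open>1 - e\<close>.
\<close>
lemma prime_over_m:
  assumes e: "split_idem e" and P: "primeideal P (S\<lparr>carrier := U\<rparr>)" and mP: "m \<subseteq> P"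
  shows "P = M e \<or> P = M (\<one> \<ominus> e)"
proof -
  note e' = split_idem_complement[OF e]
  have P': "sub_ideal P U" "P \<noteq> U" "\<And>a b. a \<in> U \<Longrightarrow> b \<in> U \<Longrightarrow> a \<otimes> b \<in> P \<Longrightarrow> a \<in> P \<or> b \<in> P"
    using P unfolding primeideal_iff[OF U_L] by blast+
  note Pc = sub_ideal_closed[OF P'(1) U_L]
  have [simp]: "e \<in> carrier S"
    using split_carrier[OF e] .
  have nP: "u \<in> P" if u: "u \<in> U" "u \<in> n" for u
  proof -
    obtain k where "u [^] (2 ^ k :: nat) \<in> m"
      using n_nilpotent[OF u(2)] by blast
    then show ?thesis
      using prime_power_mem[OF U_L P u(1)] mP by blast
  qed
  have eU: "e \<in> U" "\<one> \<ominus> e \<in> U"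
    using e_U[OF e] e_U[OF e'] by auto
  have sub: "M (\<one> \<ominus> d) \<subseteq> P" if d: "d \<in> P" "d \<in> carrier S" for d
  proof
    fix u assume u: "u \<in> M (\<one> \<ominus> d)"
    then have uU: "u \<in> U" and un: "(\<one> \<ominus> d) \<otimes> u \<in> n" and [simp]: "u \<in> carrier S"
      using U_carrier by (auto simp: M_def)
    have dU: "d \<in> U"
      using Pc(2)[OF d(1)] .
    have "u = u \<otimes> d \<oplus> (\<one> \<ominus> d) \<otimes> u"
      using d(2) by - (rule poly_eqI[of "[u,d]"], (rule poly_reify)+, simp_all add: poly_simps)
    moreover have "(\<one> \<ominus> d) \<otimes> u \<in> U"
      using dU uU by simp
    ultimately show "u \<in> P"
      using Pc(3)[OF Pc(6)[OF uU d(1)] nP[OF _ un]] by simp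
  qed
  have "e \<otimes> (\<one> \<ominus> e) = \<ominus> (e \<otimes> e \<ominus> e)"
    by - (rule poly_eqI[of "[e]"], (rule poly_reify)+, simp_all add: poly_simps)
  then have "e \<otimes> (\<one> \<ominus> e) \<in> n"
    using n_closed(5)[OF f_n[OF e]] by simp
  then have "e \<otimes> (\<one> \<ominus> e) \<in> P"
    using nP[of "e \<otimes> (\<one> \<ominus> e)"] eU by simp
  then have "e \<in> P \<or> \<one> \<ominus> e \<in> P"
    using P'(3)[OF eU] by blast
  then have "M (\<one> \<ominus> e) \<subseteq> P \<or> M e \<subseteq> P"
    using sub[of e] sub[of "\<one> \<ominus> e"] complement_twice[of e] by auto
  then show ?thesis
    using M_maximal[OF e] M_maximal[OF e'] P'(1,2) unfolding Max_ideals_iff[OF U_L] by blast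
qed

lemma Supp_U_iff:
  assumes e: "split_idem e" and B: "B \<in> L" "U \<subseteq> B" "B \<subseteq> C" and C: "C \<in> L"
  shows "M e \<in> Supp_quot S U C B \<longleftrightarrow> (\<exists>x \<in> C. \<forall>s \<in> U. e \<otimes> s \<notin> n \<longrightarrow> s \<otimes> x \<notin> B)"
  unfolding Supp_quot_iff[OF U_L B(2,1,3) C] using M_prime[OF e] by (auto simp: M_def)

lemma Supp_U_sub:
  assumes e: "split_idem e" and B: "B \<in> L" "U \<subseteq> B" "B \<subseteq> C" and C: "C \<in> L"
  shows "Supp_quot S U C B \<subseteq> {M e, M (\<one> \<ominus> e)}"
proof
  fix P assume P: "P \<in> Supp_quot S U C B"
  then have "primeideal P (S\<lparr>carrier := U\<rparr>)"
    unfolding Supp_quot_iff[OF U_L B(2,1,3) C] by blast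
  then show "P \<in> {M e, M (\<one> \<ominus> e)}"
    using prime_over_m[OF e _ Supp_contains_m[OF U_L B(2,1,3) C P]] by blast
qed

lemma Supp_U_V:
  assumes e: "split_idem e" and C: "C \<in> L" "U \<subseteq> C"
  shows "M e \<in> Supp_quot S U C U \<longleftrightarrow> \<not> C \<subseteq> V e"
  unfolding Supp_U_iff[OF e U_L order_refl C(2,1)] V_def using L_carrier[OF C(1)] by blast

lemma Supp_U:
  assumes e: "split_idem e" and C: "C \<in> L" "U \<subseteq> C"
  shows "Supp_quot S U C U = {P. P = M e \<and> \<not> C \<subseteq> V e \<or> P = M (\<one> \<ominus> e) \<and> \<not> C \<subseteq> V (\<one> \<ominus> e)}"
  using Supp_U_sub[OF e U_L order_refl C(2,1)] Supp_U_V[OF e C] Supp_U_V[OF split_idem_complement[OF e] C]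
  by blast

lemma MSupp_U:
  assumes e: "split_idem e" and B: "B \<in> L" "U \<subseteq> B" "B \<subseteq> C" and C: "C \<in> L"
  shows "MSupp_quot S U C B = Supp_quot S U C B"
  unfolding MSupp_quot_def Max_ideals_U[OF e] using Supp_U_sub[OF e B C] by blast

text \<open>
  The condition on \<open>Y / U\<close> says \<open>Y \<subseteq> V e\<close>. The condition on \<open>S / Y\<close> says that every \<open>x\<close> lies in \<open>Y\<close> after
  localization at \<open>M (1 - e)\<close>; for \<open>x \<in> V e\<close> it also lies in \<open>Y\<close> after localization at \<open>M e\<close>, so \<open>x \<in> Y\<close>.
\<close>
lemma splitter_V:
  assumes e: "split_idem e" and SV: "\<not> carrier S \<subseteq> V e" "\<not> carrier S \<subseteq> V (\<one> \<ominus> e)"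
  shows "splitter S U (carrier S) {M (\<one> \<ominus> e)} = V e"
proof -
  note e' = split_idem_complement[OF e]
  note V1 = V_L[OF e] and V2 = V_L[OF e'] and UV = U_V[OF e]
  have [simp]: "e \<in> carrier S"
    using split_carrier[OF e] .
  have dist: "M e \<noteq> M (\<one> \<ominus> e)"
    by (rule M_distinct[OF e])
  have US: "U \<subseteq> carrier S"
    using le_S[OF U_L] .
  have MS: "MSupp_quot S U (carrier S) U = {M e, M (\<one> \<ominus> e)}"
    using MSupp_U[OF e U_L order_refl US S_L] Supp_U[OF e S_L US] SV by blast
  have tgt: "{M e, M (\<one> \<ominus> e)} - {M (\<one> \<ominus> e)} = {M e}"
    using dist by blast
  have inter: "intermediate_rings S U (carrier S) = between U (carrier S)"
    by (rule intermediate_rings_between[OF U_L])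
  show ?thesis
    unfolding splitter_def MS tgt inter
  proof (rule the_equality)
    have nV: "\<not> V e \<subseteq> V (\<one> \<ominus> e)"
    proof
      assume le: "V e \<subseteq> V (\<one> \<ominus> e)"
      have "carrier S \<subseteq> V (\<one> \<ominus> e)"
        using V_join[OF e] compositum_least[OF V2 le order_refl] by simp
      then show False
        using SV by blast
    qed
    have 1: "MSupp_quot S U (V e) U = {M (\<one> \<ominus> e)}"
      using MSupp_U[OF e U_L order_refl UV V1] Supp_U[OF e V1 UV] nV by blast
    have "M e \<in> Supp_quot S U (carrier S) (V e)"
      unfolding Supp_U_iff[OF e V1 UV le_S[OF V1] S_L]
    proof -
      obtain x where x: "x \<in> carrier S" "x \<notin> V e"
        using SV by blast
      have "s \<otimes> x \<notin> V e" if s: "s \<in> U" "e \<otimes> s \<notin> n" for s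
      proof
        assume "s \<otimes> x \<in> V e"
        then obtain t where t: "t \<in> U" "e \<otimes> t \<notin> n" "t \<otimes> (s \<otimes> x) \<in> U"
          by (auto simp: V_def)
        have "t \<otimes> s \<otimes> x \<in> U"
          using t(3) U_carrier[OF t(1)] U_carrier[OF s(1)] x(1) by (simp add: m_assoc)
        moreover have "e \<otimes> (t \<otimes> s) \<notin> n" "t \<otimes> s \<in> U"
          using component_prime[OF e UT[OF t(1)] t(2) UT[OF s(1)] s(2)] t s by simp_all
        ultimately have "x \<in> V e"
          unfolding V_def using x(1) by blast
        then show False
          using x(2) by blast
      qed
      then show "\<exists>x \<in> carrier S. \<forall>s \<in> U. e \<otimes> s \<notin> n \<longrightarrow> s \<otimes> x \<notin> V e"
        using x(1) by blast
    qed
    moreover have "M (\<one> \<ominus> e) \<notin> Supp_quot S U (carrier S) (V e)"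
      unfolding Supp_U_iff[OF e' V1 UV le_S[OF V1] S_L]
    proof
      assume "\<exists>x \<in> carrier S. \<forall>s \<in> U. (\<one> \<ominus> e) \<otimes> s \<notin> n \<longrightarrow> s \<otimes> x \<notin> V e"
      then obtain x where x: "x \<in> carrier S" "\<And>s. s \<in> U \<Longrightarrow> (\<one> \<ominus> e) \<otimes> s \<notin> n \<Longrightarrow> s \<otimes> x \<notin> V e"
        by blast
      obtain j where j: "(\<one> \<ominus> e) [^] (j::nat) \<otimes> x \<in> V e"
        using power_in_V[OF e x(1)] by blast
      then show False
        using x(2)[OF L_pow[OF U_L e_U[OF e']] e_power_notin[OF e']] by blast
    qed
    ultimately have 2: "MSupp_quot S U (carrier S) (V e) = {M e}"
      using MSupp_U[OF e V1 UV le_S[OF V1] S_L] Supp_U_sub[OF e V1 UV le_S[OF V1] S_L] by blast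
    show "V e \<in> between U (carrier S) \<and> MSupp_quot S U (V e) U = {M (\<one> \<ominus> e)} \<and>
        MSupp_quot S U (carrier S) (V e) = {M e}"
      using 1 2 V1 UV le_S[OF V1] by (simp add: between_iff)
  next
    fix Y assume Y: "Y \<in> between U (carrier S) \<and> MSupp_quot S U Y U = {M (\<one> \<ominus> e)} \<and>
        MSupp_quot S U (carrier S) Y = {M e}"
    then have YL: "Y \<in> L" "U \<subseteq> Y" and YS: "Y \<subseteq> carrier S"
      by (simp_all add: between_iff)
    have "M e \<notin> Supp_quot S U Y U"
      using Y dist MSupp_U[OF e U_L order_refl YL(2,1)] by auto
    then have le: "Y \<subseteq> V e"
      using Supp_U_V[OF e YL] by blast
    have "M (\<one> \<ominus> e) \<notin> Supp_quot S U (carrier S) Y"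
      using Y dist MSupp_U[OF e YL YS S_L] by auto
    then have ann: "\<exists>s \<in> U. (\<one> \<ominus> e) \<otimes> s \<notin> n \<and> s \<otimes> x \<in> Y" if "x \<in> carrier S" for x
      using that unfolding Supp_U_iff[OF e' YL YS S_L] by blast
    have "V e \<subseteq> Y"
    proof
      fix x assume "x \<in> V e"
      then obtain t where t: "t \<in> U" "e \<otimes> t \<notin> n" "t \<otimes> x \<in> U" and x: "x \<in> carrier S"
        by (auto simp: V_def)
      obtain s where s: "s \<in> U" "(\<one> \<ominus> e) \<otimes> s \<notin> n" "s \<otimes> x \<in> Y"
        using ann[OF x] by blast
      show "x \<in> Y"
        by (rule comaximal_mem[OF e U_L e_U[OF e] U_T YL t(1) s(1) t(2) s(2) x subsetD[OF YL(2) t(3)] s(3)])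
    qed
    then show "Y = V e"
      using le by blast
  qed
qed

section \<open>The counting formulas\<close>

lemma one_sided_idem:
  assumes NT: "N \<noteq> T"
  obtains e where "split_idem e" "T \<inter> V e = U"
proof (rule split_idem_exists[OF NT])
  fix e assume e: "split_idem e"
  then show thesis
    using one_sided[OF e] that split_idem_complement[OF e] by blast
qed

theorem counting:
  "ecard (Max_ideals (S\<lparr>carrier := U\<rparr>)) \<le> 2 \<and> ecard (Supp_quot S U T U) \<le> 1 \<and>
    (ecard (Supp_quot S U T U) = 0 \<longrightarrow>
       ecard (intermediate_rings S R (carrier S)) =
         extension_length S R N + ecard (intermediate_rings S T (carrier S))
           + (if N = T then 0 else 1)) \<and>
    (ecard (Supp_quot S U T U) = 1 \<and> ecard (Max_ideals (S\<lparr>carrier := U\<rparr>)) = 2 \<longrightarrow>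
       (\<exists>M M'. Max_ideals (S\<lparr>carrier := U\<rparr>) = {M, M'} \<and> Supp_quot S U T U = {M} \<and>
          (ecard (Supp_quot S U (carrier S) U) = 2 \<longrightarrow>
             ecard (intermediate_rings S R (carrier S)) =
               extension_length S R N + ecard (intermediate_rings S T (carrier S))
                 + extension_length S U T
                     * ecard (intermediate_rings S U (splitter S U (carrier S) {M'})) + 1) \<and>
          (ecard (Supp_quot S U (carrier S) U) = 1 \<longrightarrow>
             ecard (intermediate_rings S R (carrier S)) =
               extension_length S R N + ecard (intermediate_rings S T (carrier S))
                 + extension_length S U T + 1))) \<and>
    (ecard (Supp_quot S U T U) = 1 \<and> ecard (Max_ideals (S\<lparr>carrier := U\<rparr>)) = 1 \<longrightarrow>
       ecard (intermediate_rings S R (carrier S)) =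
         extension_length S R N + ecard (intermediate_rings S T (carrier S)))"
proof (cases "N = T")
  case True
  note UR = U_eq_R[OF True]
  have max: "ecard (Max_ideals (S\<lparr>carrier := U\<rparr>)) = 1"
    unfolding UR Max_ideals_R by simp
  have supp: "ecard (Supp_quot S U T U) \<le> 1"
    unfolding UR Supp_R[OF T_L] by simp
  have count: "ecard L = extension_length S R N + ecard (intermediate_rings S T (carrier S))"
    using count_local[OF True] intermediate_rings_between[OF T_L] by simp
  have "(1::enat) \<le> 2"
    by (simp add: one_enat_def numeral_eq_enat)
  then show ?thesis
    unfolding max count using supp True one_noteq_two by simp
next
  case False
  obtain e where e: "split_idem e" and TV: "T \<inter> V e = U"
    by (rule one_sided_idem[OF False])
  note e' = split_idem_complement[OF e]
  note V1 = V_L[OF e] and V2 = V_L[OF e']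
  have max: "Max_ideals (S\<lparr>carrier := U\<rparr>) = {M e, M (\<one> \<ominus> e)}"
    by (rule Max_ideals_U[OF e])
  have max2: "ecard (Max_ideals (S\<lparr>carrier := U\<rparr>)) = 2"
    unfolding max by (rule ecard_pair[OF M_distinct[OF e]])
  have TV2: "T \<subseteq> V (\<one> \<ominus> e)"
    by (rule T_le_V[OF e TV])
  have TV1: "T \<subseteq> V e \<longleftrightarrow> U = T"
    using TV U_T by blast
  have supp: "Supp_quot S U T U = (if U = T then {} else {M e})"
    using Supp_U[OF e T_L U_T] TV1 TV2 by auto
  have supp1: "ecard (Supp_quot S U T U) = (if U = T then 0 else 1)"
    unfolding supp by simp
  define len where "len = extension_length S R N"
  define t where "t = ecard (intermediate_rings S T (carrier S))"
  have count: "ecard L = len + 1 + ecard (intermediate_rings S U (carrier S))"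
    using count_nonlocal[OF e] intermediate_rings_between[OF U_L] by (simp add: len_def)
  have count2: "ecard (intermediate_rings S U (carrier S)) =
      extension_length S U T * ecard (intermediate_rings S U (V e)) + t"
    using count_components[OF e TV] unfolding t_def intermediate_rings_between[OF U_L]
      intermediate_rings_between[OF T_L] .
  have SV2: "U \<noteq> T \<Longrightarrow> \<not> carrier S \<subseteq> V e"
    using TV1 le_S[OF T_L] by blast
  have US: "U \<subseteq> carrier S"
    using le_S[OF U_L] .
  have two: "ecard L = len + t + extension_length S U T * ecard (intermediate_rings S U (splitter S U (carrier S) {M (\<one> \<ominus> e)})) + 1"
    if UT: "U \<noteq> T" and s: "ecard (Supp_quot S U (carrier S) U) = 2"
  proof -
    have "\<not> carrier S \<subseteq> V (\<one> \<ominus> e)"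
    proof
      assume "carrier S \<subseteq> V (\<one> \<ominus> e)"
      then have "Supp_quot S U (carrier S) U = {M e}"
        using Supp_U[OF e S_L US] SV2[OF UT] by blast
      then show False
        using s one_noteq_two by simp
    qed
    then have sp: "splitter S U (carrier S) {M (\<one> \<ominus> e)} = V e"
      by (rule splitter_V[OF e SV2[OF UT]])
    show ?thesis
      unfolding count count2 sp by (simp add: ac_simps)
  qed
  have one: "ecard L = len + t + extension_length S U T + 1"
    if UT: "U \<noteq> T" and s: "ecard (Supp_quot S U (carrier S) U) = 1"
  proof -
    have "carrier S \<subseteq> V (\<one> \<ominus> e)"
    proof (rule ccontr)
      assume "\<not> carrier S \<subseteq> V (\<one> \<ominus> e)"
      then have "Supp_quot S U (carrier S) U = {M e, M (\<one> \<ominus> e)}"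
        using Supp_U[OF e S_L US] SV2[OF UT] by blast
      then show False
        using s one_noteq_two ecard_pair[OF M_distinct[OF e]] by simp
    qed
    then have "V e = U"
      using V_inter[OF e] le_S[OF V1] by blast
    moreover have "intermediate_rings S U U = {U}"
      unfolding intermediate_rings_between[OF U_L] between_def using U_L by blast
    ultimately have "ecard (intermediate_rings S U (V e)) = 1"
      by simp
    then show ?thesis
      unfolding count count2 by (simp add: ac_simps)
  qed
  have zero: "ecard L = len + t + 1" if UT: "U = T"
    unfolding count using t_def UT by (simp add: ac_simps)
  show ?thesis
    unfolding len_def[symmetric] t_def[symmetric]
  proof (intro conjI impI)
    show "ecard (Max_ideals (S\<lparr>carrier := U\<rparr>)) \<le> 2"
      unfolding max2 by simp
    show "ecard (Supp_quot S U T U) \<le> 1"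
      unfolding supp1 by simp
    show "ecard L = len + t + (if N = T then 0 else 1)" if "ecard (Supp_quot S U T U) = 0"
    proof -
      have "U = T"
        using that one_noteq_two unfolding supp1 by (simp split: if_splits)
      then show ?thesis
        using zero False by simp
    qed
    show "ecard L = len + t" if "ecard (Supp_quot S U T U) = 1 \<and> ecard (Max_ideals (S\<lparr>carrier := U\<rparr>)) = 1"
      using that one_noteq_two unfolding max2 by simp
    assume "ecard (Supp_quot S U T U) = 1 \<and> ecard (Max_ideals (S\<lparr>carrier := U\<rparr>)) = 2"
    then have UT: "U \<noteq> T"
      using one_noteq_two unfolding supp1 by (simp split: if_splits)
    show "\<exists>M M'. Max_ideals (S\<lparr>carrier := U\<rparr>) = {M, M'} \<and> Supp_quot S U T U = {M} \<and>
          (ecard (Supp_quot S U (carrier S) U) = 2 \<longrightarrow>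
             ecard L = len + t + extension_length S U T
                     * ecard (intermediate_rings S U (splitter S U (carrier S) {M'})) + 1) \<and>
          (ecard (Supp_quot S U (carrier S) U) = 1 \<longrightarrow>
             ecard L = len + t + extension_length S U T + 1)"
      using max supp UT two[OF UT] one[OF UT]
      by (intro exI[of _ "M e"] exI[of _ "M (\<one> \<ominus> e)"]) simp
  qed
qed

end

theorem theorem8p2:
  fixes S :: "('a, 'm) ring_scheme" and R T U N :: "'a set"
  assumes "cring S" and "subring R S" and "R \<subset> carrier S"
    and "integral_extension S R (carrier S)"
    and "distributive_extension S R (carrier S)"
    and "FCP_extension S R (carrier S)"
    and "local_ring (S\<lparr>carrier := R\<rparr>)"
    and "T = t_closure S R" and "U = u_closure S R" and "N = seminormalization S R"
  shows "ecard (Max_ideals (S\<lparr>carrier := U\<rparr>)) \<le> 2 \<and> ecard (Supp_quot S U T U) \<le> 1 \<and>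
    (ecard (Supp_quot S U T U) = 0 \<longrightarrow>
       ecard (intermediate_rings S R (carrier S)) =
         extension_length S R N + ecard (intermediate_rings S T (carrier S))
           + (if N = T then 0 else 1)) \<and>
    (ecard (Supp_quot S U T U) = 1 \<and> ecard (Max_ideals (S\<lparr>carrier := U\<rparr>)) = 2 \<longrightarrow>
       (\<exists>M M'. Max_ideals (S\<lparr>carrier := U\<rparr>) = {M, M'} \<and> Supp_quot S U T U = {M} \<and>
          (ecard (Supp_quot S U (carrier S) U) = 2 \<longrightarrow>
             ecard (intermediate_rings S R (carrier S)) =
               extension_length S R N + ecard (intermediate_rings S T (carrier S))
                 + extension_length S U T
                     * ecard (intermediate_rings S U (splitter S U (carrier S) {M'})) + 1) \<and>
          (ecard (Supp_quot S U (carrier S) U) = 1 \<longrightarrow>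
             ecard (intermediate_rings S R (carrier S)) =
               extension_length S R N + ecard (intermediate_rings S T (carrier S))
                 + extension_length S U T + 1))) \<and>
    (ecard (Supp_quot S U T U) = 1 \<and> ecard (Max_ideals (S\<lparr>carrier := U\<rparr>)) = 1 \<longrightarrow>
       ecard (intermediate_rings S R (carrier S)) =
         extension_length S R N + ecard (intermediate_rings S T (carrier S)))"
proof -
  have "distributive_local_extension S R"
    using assms by (intro distributive_local_extension.intro distributive_local_extension_axioms.intro)
  then show ?thesis
    unfolding assms(8-10) by (rule distributive_local_extension.counting)
qed

end
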